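(* Let $n\geq 0$ be an arbitrary integer. Then: (1) The identity functors $id:\mathcal M\to B_n\mathcal M$ and $id: B_{n+1}\mathcal M\to B_n\mathcal M$ are left Quillen functors, so that one has a (commutative) tower of left Quillen functors, under $\mathcal M$, $$\cdots \xrightarrow{id} B_{n+1}\mathcal M\xrightarrow{id} B_n\mathcal M\xrightarrow{id}\cdots\xrightarrow{id} B_1\mathcal M\xrightarrow{id} B_0\mathcal M ,$$ and the corresponding tower of associated homotopy categories is $$\cdots \rightleftarrows \mathcal H(B_{n+1})\rightleftarrows \mathcal H(B_n)\rightleftarrows\cdots\rightleftarrows \mathcal H(B_1)\rightleftarrows \mathcal H(B_0)$$ under $\mathcal H$, where the derived adjunctions are $(id, b_u^{(n)}):\mathcal H\to \mathcal H(B_n)$ and $(id,b_u^{(n+1)}):\mathcal H(B_{n+2})\to \mathcal H(B_{n+1})$, $(id,b_u^{(n)}):\mathcal H(B_{n+1})\to\mathcal H(B_n)$, and so on; that is, the left adjoints are induced by the identity functor, and the right adjoint out of $\mathcal H(B_n)$ is induced by the fibrant replacement functor $b_u^{(n)}$ of $B_n\mathcal M$. (2) Likewise, the identity functors $id:\mathcal M\to WB_n\mathcal M$ and $id: WB_{n+1}\mathcal M\to WB_n\mathcal M$ are left Quillen functors, giving a (commutative) tower of left Quillen functors, under $\mathcal M$, $$\cdots \xrightarrow{id} WB_{n+1}\mathcal M\xrightarrow{id} WB_n\mathcal M\xrightarrow{id}\cdots\xrightarrow{id} WB_1\mathcal M\xrightarrow{id} WB_0\mathcal M ,$$ and the corresponding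 tower of associated homotopy categories is $$\cdots \rightleftarrows \mathcal H(WB_{n+1})\rightleftarrows \mathcal H(WB_n)\rightleftarrows\cdots\rightleftarrows \mathcal H(WB_1)\rightleftarrows \mathcal H(WB_0)$$ under $\mathcal H$, where all left adjoints are induced by the identity functor, and the right adjoints $\mathcal H(WB_n)\to\mathcal H$ and $\mathcal H(WB_n)\to \mathcal H(WB_{n+1})$ are induced by the fibrant replacement functor $wb_u^{(n)}$ of $WB_n\mathcal M$.
   Context: $X$ is a Noetherian separated base scheme of finite Krull dimension, and $Sm_X$ is the category of smooth schemes of finite type over $X$, regarded as a site with the Nisnevich topology. All maps of schemes are over $X$, and closed subsets are considered as closed subschemes with the reduced structure. $\mathcal M$ is the category of pointed simplicial presheaves on $Sm_X$ with Jardine's motivic (injective) model structure: cofibrations are the monomorphisms (so every object is cofibrant) and weak equivalences are the motivic ($\mathbb A^1$-local Nisnevich) weak equivalences; $\mathcal H$ is its homotopy category. For $Y\in Sm_X$, $Y_+$ denotes the presheaf represented by $Y$ with a disjoint base point. For $Z$ closed in $Y$, $codim_Y Z$ is the infimum of $\dim \mathcal O_{Y,z}$ over the generic points $z$ of $Z$ (so it is $\infty$ if $Z=\emptyset$). For $n\ge 0$: $B_n$ is the set of maps $\iota_{U,Y}:U_+\to Y_+$ in $\mathcal M$ induced by open immersions $U\to Y$ with $Y\in Sm_X$ irreducible and $codim_Y(Y\setminus U)\ge n+1$; $WB_n$ is the set of those maps $\iota_{U,Y}:U_+\to Y_+$ induced by open immersions with $Y\in Sm_X$ irreducible, $Z=Y\setminus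 U\in Sm_X$ and $codim_Y Z\ge n+1$. $B_n\mathcal M$ and $WB_n\mathcal M$ denote the left Bousfield localizations of $\mathcal M$ with respect to $B_n$ and $WB_n$, with fibrant replacement functors $b_u^{(n)}$, $wb_u^{(n)}$ and homotopy categories $\mathcal H(B_n)$, $\mathcal H(WB_n)$, respectively. *)

theory Defs
  imports "HOL-Homology.Homology" "HOL-Algebra.Ring_Divisibility" "HOL-Combinatorics.Permutations"
    "HOL-Library.Extended_Nat" "HOL-Library.FuncSet"
begin

section \<open>Categories, functors, adjunctions\<close>

record ('o, 'm) cat =
  Ob :: "'o set"
  Ar :: "'m set"
  src :: "'m \<Rightarrow> 'o"
  tgt :: "'m \<Rightarrow> 'o"
  idn :: "'o \<Rightarrow> 'm"
  cmp :: "'m \<Rightarrow> 'm \<Rightarrow> 'm"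

text \<open>\<open>cmp C g f\<close> is the composite "first \<open>f\<close>, then \<open>g\<close>".\<close>

definition in_hom :: "('o, 'm, 'z) cat_scheme \<Rightarrow> 'o \<Rightarrow> 'o \<Rightarrow> 'm \<Rightarrow> bool" where
  "in_hom C A B f \<longleftrightarrow> f \<in> Ar C \<and> src C f = A \<and> tgt C f = B"

definition is_category :: "('o, 'm, 'z) cat_scheme \<Rightarrow> bool" where
  "is_category C \<longleftrightarrow>
     (\<forall>f\<in>Ar C. src C f \<in> Ob C \<and> tgt C f \<in> Ob C) \<and>
     (\<forall>A\<in>Ob C. in_hom C A A (idn C A)) \<and>
     (\<forall>f\<in>Ar C. \<forall>g\<in>Ar C. tgt C f = src C g \<longrightarrow> in_hom C (src C f) (tgt C g) (cmp C g f)) \<and>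
     (\<forall>f\<in>Ar C. cmp C f (idn C (src C f)) = f \<and> cmp C (idn C (tgt C f)) f = f) \<and>
     (\<forall>f\<in>Ar C. \<forall>g\<in>Ar C. \<forall>h\<in>Ar C. tgt C f = src C g \<and> tgt C g = src C h \<longrightarrow>
        cmp C h (cmp C g f) = cmp C (cmp C h g) f)"

record ('o, 'm, 'p, 'n) func =
  fob :: "'o \<Rightarrow> 'p"
  far :: "'m \<Rightarrow> 'n"

definition is_functor ::
  "('o, 'm, 'y) cat_scheme \<Rightarrow> ('p, 'n, 'z) cat_scheme \<Rightarrow> ('o, 'm, 'p, 'n) func \<Rightarrow> bool" where
  "is_functor C D F \<longleftrightarrow> is_category C \<and> is_category D \<and>
     (\<forall>A\<in>Ob C. fob F A \<in> Ob D \<and> far F (idn C A) = idn D (fob F A)) \<and>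
     (\<forall>f\<in>Ar C. in_hom D (fob F (src C f)) (fob F (tgt C f)) (far F f)) \<and>
     (\<forall>f\<in>Ar C. \<forall>g\<in>Ar C. tgt C f = src C g \<longrightarrow>
        far F (cmp C g f) = cmp D (far F g) (far F f))"

definition functor_eq ::
  "('o, 'm, 'z) cat_scheme \<Rightarrow> ('o, 'm, 'p, 'n) func \<Rightarrow> ('o, 'm, 'p, 'n) func \<Rightarrow> bool" where
  "functor_eq C F G \<longleftrightarrow> (\<forall>A\<in>Ob C. fob F A = fob G A) \<and> (\<forall>f\<in>Ar C. far F f = far G f)"

definition id_func :: "('o, 'm, 'o, 'm) func" where
  "id_func = \<lparr>fob = (\<lambda>A. A), far = (\<lambda>f. f)\<rparr>"

definition comp_func ::
  "('p, 'n, 'q, 'k) func \<Rightarrow> ('o, 'm, 'p, 'n) func \<Rightarrow> ('o, 'm, 'q, 'k) func" where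
  "comp_func G F = \<lparr>fob = fob G \<circ> fob F, far = far G \<circ> far F\<rparr>"

definition nat_trans ::
  "('o, 'm, 'y) cat_scheme \<Rightarrow> ('p, 'n, 'z) cat_scheme \<Rightarrow> ('o, 'm, 'p, 'n) func \<Rightarrow>
   ('o, 'm, 'p, 'n) func \<Rightarrow> ('o \<Rightarrow> 'n) \<Rightarrow> bool" where
  "nat_trans C D F G t \<longleftrightarrow>
     (\<forall>A\<in>Ob C. in_hom D (fob F A) (fob G A) (t A)) \<and>
     (\<forall>f\<in>Ar C. cmp D (t (tgt C f)) (far F f) = cmp D (far G f) (t (src C f)))"

text \<open>\<open>F\<close> is left adjoint to \<open>G\<close>, with the displayed unit and counit.\<close>

definition adjunction ::
  "('o, 'm, 'y) cat_scheme \<Rightarrow> ('p, 'n, 'z) cat_scheme \<Rightarrow> ('o, 'm, 'p, 'n) func \<Rightarrow>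
   ('p, 'n, 'o, 'm) func \<Rightarrow> ('o \<Rightarrow> 'm) \<Rightarrow> ('p \<Rightarrow> 'n) \<Rightarrow> bool" where
  "adjunction C D F G unit counit \<longleftrightarrow>
     is_functor C D F \<and> is_functor D C G \<and>
     nat_trans C C id_func (comp_func G F) unit \<and>
     nat_trans D D (comp_func F G) id_func counit \<and>
     (\<forall>A\<in>Ob C. cmp D (counit (fob F A)) (far F (unit A)) = idn D (fob F A)) \<and>
     (\<forall>B\<in>Ob D. cmp C (far G (counit B)) (unit (fob G B)) = idn C (fob G B))"

definition is_initial :: "('o, 'm, 'z) cat_scheme \<Rightarrow> 'o \<Rightarrow> bool" where
  "is_initial C I \<longleftrightarrow> I \<in> Ob C \<and> (\<forall>A\<in>Ob C. \<exists>!f. in_hom C I A f)"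

definition is_terminal :: "('o, 'm, 'z) cat_scheme \<Rightarrow> 'o \<Rightarrow> bool" where
  "is_terminal C T \<longleftrightarrow> T \<in> Ob C \<and> (\<forall>A\<in>Ob C. \<exists>!f. in_hom C A T f)"

definition is_pullback :: "('o, 'm, 'z) cat_scheme \<Rightarrow> 'm \<Rightarrow> 'm \<Rightarrow> 'm \<Rightarrow> 'm \<Rightarrow> bool" where
  "is_pullback C p q f g \<longleftrightarrow> {p, q, f, g} \<subseteq> Ar C \<and> src C p = src C q \<and>
     tgt C p = src C f \<and> tgt C q = src C g \<and> tgt C f = tgt C g \<and> cmp C f p = cmp C g q \<and>
     (\<forall>u\<in>Ar C. \<forall>v\<in>Ar C. src C u = src C v \<and> tgt C u = src C f \<and> tgt C v = src C g \<and>
        cmp C f u = cmp C g v \<longrightarrow>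
        (\<exists>!h. in_hom C (src C u) (src C p) h \<and> cmp C p h = u \<and> cmp C q h = v))"

definition is_pushout :: "('o, 'm, 'z) cat_scheme \<Rightarrow> 'm \<Rightarrow> 'm \<Rightarrow> 'm \<Rightarrow> 'm \<Rightarrow> bool" where
  "is_pushout C i j f g \<longleftrightarrow> {i, j, f, g} \<subseteq> Ar C \<and> tgt C i = tgt C j \<and>
     src C i = tgt C f \<and> src C j = tgt C g \<and> src C f = src C g \<and> cmp C i f = cmp C j g \<and>
     (\<forall>u\<in>Ar C. \<forall>v\<in>Ar C. tgt C u = tgt C v \<and> src C u = tgt C f \<and> src C v = tgt C g \<and>
        cmp C u f = cmp C v g \<longrightarrow>
        (\<exists>!h. in_hom C (tgt C i) (tgt C u) h \<and> cmp C h i = u \<and> cmp C h j = v))"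

text \<open>A terminal object and pullbacks give all finite limits, and dually.\<close>

definition finitely_bicomplete :: "('o, 'm, 'z) cat_scheme \<Rightarrow> bool" where
  "finitely_bicomplete C \<longleftrightarrow>
     (\<exists>T. is_terminal C T) \<and> (\<exists>I. is_initial C I) \<and>
     (\<forall>f\<in>Ar C. \<forall>g\<in>Ar C. tgt C f = tgt C g \<longrightarrow> (\<exists>p q. is_pullback C p q f g)) \<and>
     (\<forall>f\<in>Ar C. \<forall>g\<in>Ar C. src C f = src C g \<longrightarrow> (\<exists>i j. is_pushout C i j f g))"


section \<open>Model categories and Quillen functors\<close>

record ('o, 'm) model = "('o, 'm) cat" +
  cof :: "'m set"
  fib :: "'m set"
  weq :: "'m set"

definition has_lift :: "('o, 'm, 'z) cat_scheme \<Rightarrow> 'm \<Rightarrow> 'm \<Rightarrow> bool" where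
  "has_lift C i p \<longleftrightarrow>
     (\<forall>u\<in>Ar C. \<forall>v\<in>Ar C. src C u = src C i \<and> tgt C u = src C p \<and>
        src C v = tgt C i \<and> tgt C v = tgt C p \<and> cmp C p u = cmp C v i \<longrightarrow>
        (\<exists>h. in_hom C (tgt C i) (src C p) h \<and> cmp C h i = u \<and> cmp C p h = v))"

definition is_retract :: "('o, 'm, 'z) cat_scheme \<Rightarrow> 'm \<Rightarrow> 'm \<Rightarrow> bool" where
  "is_retract C f g \<longleftrightarrow> f \<in> Ar C \<and> g \<in> Ar C \<and>
     (\<exists>i r j s. in_hom C (src C f) (src C g) i \<and> in_hom C (src C g) (src C f) r \<and>
        in_hom C (tgt C f) (tgt C g) j \<and> in_hom C (tgt C g) (tgt C f) s \<and>
        cmp C r i = idn C (src C f) \<and> cmp C s j = idn C (tgt C f) \<and>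
        cmp C g i = cmp C j f \<and> cmp C f r = cmp C s g)"

text \<open>Quillen's axioms for a closed model category. Only finite limits and colimits are required
  (Quillen's original axiom): the sets occurring below are subsets of a fixed type, and a category
  of presheaves of such sets can only have limits and colimits of bounded size.\<close>

definition model_category :: "('o, 'm, 'z) model_scheme \<Rightarrow> bool" where
  "model_category M \<longleftrightarrow>
     is_category M \<and> finitely_bicomplete M \<and>
     cof M \<subseteq> Ar M \<and> fib M \<subseteq> Ar M \<and> weq M \<subseteq> Ar M \<and>
     (\<forall>f\<in>Ar M. \<forall>g\<in>Ar M. tgt M f = src M g \<longrightarrow>
        (f \<in> weq M \<and> g \<in> weq M \<longrightarrow> cmp M g f \<in> weq M) \<and>
        (f \<in> weq M \<and> cmp M g f \<in> weq M \<longrightarrow> g \<in> weq M) \<and>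
        (g \<in> weq M \<and> cmp M g f \<in> weq M \<longrightarrow> f \<in> weq M)) \<and>
     (\<forall>f g. is_retract M f g \<longrightarrow>
        (g \<in> cof M \<longrightarrow> f \<in> cof M) \<and> (g \<in> fib M \<longrightarrow> f \<in> fib M) \<and> (g \<in> weq M \<longrightarrow> f \<in> weq M)) \<and>
     (\<forall>i\<in>cof M \<inter> weq M. \<forall>p\<in>fib M. has_lift M i p) \<and>
     (\<forall>i\<in>cof M. \<forall>p\<in>fib M \<inter> weq M. has_lift M i p) \<and>
     (\<forall>f\<in>Ar M. (\<exists>i\<in>cof M \<inter> weq M. \<exists>p\<in>fib M. tgt M i = src M p \<and> f = cmp M p i) \<and>
        (\<exists>i\<in>cof M. \<exists>p\<in>fib M \<inter> weq M. tgt M i = src M p \<and> f = cmp M p i))"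

definition fibrant :: "('o, 'm, 'z) model_scheme \<Rightarrow> 'o \<Rightarrow> bool" where
  "fibrant M A \<longleftrightarrow> (\<exists>f T. is_terminal M T \<and> in_hom M A T f \<and> f \<in> fib M)"

definition fibrant_replacement ::
  "('o, 'm, 'z) model_scheme \<Rightarrow> ('o, 'm, 'o, 'm) func \<Rightarrow> ('o \<Rightarrow> 'm) \<Rightarrow> bool" where
  "fibrant_replacement M R \<eta> \<longleftrightarrow> is_functor M M R \<and> nat_trans M M id_func R \<eta> \<and>
     (\<forall>A\<in>Ob M. fibrant M (fob R A) \<and> \<eta> A \<in> weq M)"

definition left_quillen ::
  "('o, 'm, 'y) model_scheme \<Rightarrow> ('p, 'n, 'z) model_scheme \<Rightarrow> ('o, 'm, 'p, 'n) func \<Rightarrow> bool" where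
  "left_quillen M N F \<longleftrightarrow> model_category M \<and> model_category N \<and>
     (\<exists>G unit counit. adjunction M N F G unit counit) \<and>
     far F ` cof M \<subseteq> cof N \<and> far F ` (cof M \<inter> weq M) \<subseteq> cof N \<inter> weq N"


section \<open>The homotopy category\<close>

text \<open>The localization of a category at a class \<open>W\<close> of arrows (Gabriel-Zisman): same objects,
  and arrows the zigzags, with arrows of \<open>W\<close> allowed backwards, modulo the congruence generated by
  the composition of the category and the relations making each \<open>Bwd w\<close> inverse to \<open>Fwd w\<close>.
  Zigzags are read from left to right.\<close>

datatype 'm zstep = Fwd 'm | Bwd 'm

fun zpath :: "('o, 'm, 'z) cat_scheme \<Rightarrow> 'm set \<Rightarrow> 'o \<Rightarrow> 'o \<Rightarrow> 'm zstep list \<Rightarrow> bool" where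
  "zpath C W a b [] \<longleftrightarrow> a \<in> Ob C \<and> a = b"
| "zpath C W a b (Fwd f # u) \<longleftrightarrow> f \<in> Ar C \<and> src C f = a \<and> zpath C W (tgt C f) b u"
| "zpath C W a b (Bwd f # u) \<longleftrightarrow> f \<in> W \<and> f \<in> Ar C \<and> tgt C f = a \<and> zpath C W (src C f) b u"

inductive zeq ::
  "('o, 'm, 'z) cat_scheme \<Rightarrow> 'm set \<Rightarrow> 'o \<Rightarrow> 'o \<Rightarrow> 'm zstep list \<Rightarrow> 'm zstep list \<Rightarrow> bool"
  for C W where
  zrefl: "zpath C W a b u \<Longrightarrow> zeq C W a b u u"
| zsym: "zeq C W a b u v \<Longrightarrow> zeq C W a b v u"
| ztrans: "zeq C W a b u v \<Longrightarrow> zeq C W a b v w \<Longrightarrow> zeq C W a b u w"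
| zcong: "zpath C W a b u \<Longrightarrow> zeq C W b c v v' \<Longrightarrow> zpath C W c d w \<Longrightarrow>
          zeq C W a d (u @ v @ w) (u @ v' @ w)"
| zid: "a \<in> Ob C \<Longrightarrow> zeq C W a a [Fwd (idn C a)] []"
| zcmp: "f \<in> Ar C \<Longrightarrow> g \<in> Ar C \<Longrightarrow> tgt C f = src C g \<Longrightarrow>
         zeq C W (src C f) (tgt C g) [Fwd f, Fwd g] [Fwd (cmp C g f)]"
| zinv1: "w \<in> W \<Longrightarrow> w \<in> Ar C \<Longrightarrow> zeq C W (src C w) (src C w) [Fwd w, Bwd w] []"
| zinv2: "w \<in> W \<Longrightarrow> w \<in> Ar C \<Longrightarrow> zeq C W (tgt C w) (tgt C w) [Bwd w, Fwd w] []"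

type_synonym ('o, 'm) ho_ar = "'o \<times> 'o \<times> 'm zstep list set"

definition zclass ::
  "('o, 'm, 'z) cat_scheme \<Rightarrow> 'm set \<Rightarrow> 'o \<Rightarrow> 'o \<Rightarrow> 'm zstep list \<Rightarrow> ('o, 'm) ho_ar" where
  "zclass C W a b u = (a, b, {v. zeq C W a b u v})"

definition localization ::
  "('o, 'm, 'z) cat_scheme \<Rightarrow> 'm set \<Rightarrow> ('o, ('o, 'm) ho_ar) cat" where
  "localization C W =
     \<lparr>Ob = Ob C,
      Ar = {zclass C W a b u | a b u. zpath C W a b u},
      src = (\<lambda>(a, b, p). a),
      tgt = (\<lambda>(a, b, p). b),
      idn = (\<lambda>a. zclass C W a a []),
      cmp = (\<lambda>(b', c, q) (a, b, p). (a, c, {w. \<exists>u\<in>p. \<exists>v\<in>q. zeq C W a c (u @ v) w}))\<rparr>"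

definition Ho :: "('o, 'm, 'z) model_scheme \<Rightarrow> ('o, ('o, 'm) ho_ar) cat" where
  "Ho M = localization M (weq M)"

definition ho_proj :: "('o, 'm, 'z) model_scheme \<Rightarrow> ('o, 'm, 'o, ('o, 'm) ho_ar) func" where
  "ho_proj M = \<lparr>fob = (\<lambda>A. A), far = (\<lambda>f. zclass M (weq M) (src M f) (tgt M f) [Fwd f])\<rparr>"

text \<open>The functor of homotopy categories induced by a functor \<open>F\<close> which preserves weak
  equivalences between the objects concerned: apply \<open>F\<close> to each step of a zigzag.\<close>

definition ho_map ::
  "('p, 'n, 'z) model_scheme \<Rightarrow> ('o, 'm, 'p, 'n) func \<Rightarrow>
   ('o, ('o, 'm) ho_ar, 'p, ('p, 'n) ho_ar) func" where
  "ho_map N F =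
     \<lparr>fob = fob F,
      far = (\<lambda>(a, b, p). (fob F a, fob F b,
        {v. \<exists>u\<in>p. zeq N (weq N) (fob F a) (fob F b) (map (map_zstep (far F)) u) v}))\<rparr>"

definition induced_on_Ho ::
  "('o, 'm, 'y) model_scheme \<Rightarrow> ('p, 'n, 'z) model_scheme \<Rightarrow> ('o, 'm, 'p, 'n) func \<Rightarrow> bool" where
  "induced_on_Ho M N F \<longleftrightarrow> is_functor (Ho M) (Ho N) (ho_map N F) \<and>
     functor_eq M (comp_func (ho_map N F) (ho_proj M)) (comp_func (ho_proj N) F)"

text \<open>Let \<open>M\<close>, \<open>N\<close> be model structures on one category in which every object is
  cofibrant, such that the identity is a left Quillen functor from \<open>M\<close> to \<open>N\<close>, and let
  \<open>(R, \<eta>)\<close> be a fibrant replacement in \<open>N\<close>. The derived adjunction has as left adjoint the functor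
  induced by the identity, as right adjoint the functor induced by \<open>R\<close>, as unit the class of \<open>\<eta>\<close> and
  as counit the inverse of the class of \<open>\<eta>\<close>.\<close>

definition derived_id_adjunction ::
  "('o, 'm, 'y) model_scheme \<Rightarrow> ('o, 'm, 'z) model_scheme \<Rightarrow> ('o, 'm, 'o, 'm) func \<Rightarrow> ('o \<Rightarrow> 'm) \<Rightarrow> bool"
  where
  "derived_id_adjunction M N R \<eta> \<longleftrightarrow>
     induced_on_Ho M N id_func \<and> induced_on_Ho N M R \<and>
     adjunction (Ho M) (Ho N) (ho_map N id_func) (ho_map M R)
       (\<lambda>A. zclass M (weq M) A (fob R A) [Fwd (\<eta> A)])
       (\<lambda>A. zclass N (weq N) (fob R A) A [Bwd (\<eta> A)])"


section \<open>Simplicial sets and their weak equivalences\<close>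

text \<open>The monotone maps from \<open>[m] = {0,...,m}\<close> to \<open>[n]\<close>, extended by \<open>undefined\<close>.\<close>

definition Delta :: "nat \<Rightarrow> nat \<Rightarrow> (nat \<Rightarrow> nat) set" where
  "Delta m n = {\<theta> \<in> {..m} \<rightarrow>\<^sub>E {..n}. mono_on {..m} \<theta>}"

text \<open>\<open>sact K m n \<theta>\<close> is the operator \<open>K\<^sub>n \<rightarrow> K\<^sub>m\<close> of \<open>\<theta> : [m] \<rightarrow> [n]\<close>.\<close>

record 'u sset =
  simp :: "nat \<Rightarrow> 'u set"
  sact :: "nat \<Rightarrow> nat \<Rightarrow> (nat \<Rightarrow> nat) \<Rightarrow> 'u \<Rightarrow> 'u"

definition is_sset :: "'u sset \<Rightarrow> bool" where
  "is_sset K \<longleftrightarrow>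
     (\<forall>m n. \<forall>\<theta>\<in>Delta m n. \<forall>x\<in>simp K n. sact K m n \<theta> x \<in> simp K m) \<and>
     (\<forall>n. \<forall>x\<in>simp K n. sact K n n (restrict (\<lambda>i. i) {..n}) x = x) \<and>
     (\<forall>l m n. \<forall>\<psi>\<in>Delta l m. \<forall>\<theta>\<in>Delta m n. \<forall>x\<in>simp K n.
        sact K l m \<psi> (sact K m n \<theta> x) = sact K l n (compose {..l} \<theta> \<psi>) x)"

definition is_sset_map :: "'u sset \<Rightarrow> 'v sset \<Rightarrow> (nat \<Rightarrow> 'u \<Rightarrow> 'v) \<Rightarrow> bool" where
  "is_sset_map K L f \<longleftrightarrow>
     (\<forall>n. \<forall>x\<in>simp K n. f n x \<in> simp L n) \<and>
     (\<forall>m n. \<forall>\<theta>\<in>Delta m n. \<forall>x\<in>simp K n. f m (sact K m n \<theta> x) = sact L m n \<theta> (f n x))"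

text \<open>Geometric realization: the quotient of the disjoint union of the \<open>{x} \<times> \<Delta>\<^sup>n\<close>, \<open>x \<in> K\<^sub>n\<close>,
  by the equivalence relation generated by \<open>(m, \<theta>\<^sup>*x, t) ~ (n, x, \<theta>\<^sub>*t)\<close>.\<close>

type_synonym 'u gpoint = "nat \<times> 'u \<times> (nat \<Rightarrow> real)"

definition push_simplex :: "nat \<Rightarrow> (nat \<Rightarrow> nat) \<Rightarrow> (nat \<Rightarrow> real) \<Rightarrow> nat \<Rightarrow> real" where
  "push_simplex m \<theta> t = (\<lambda>j. \<Sum>i | i \<le> m \<and> \<theta> i = j. t i)"

definition grel :: "'u sset \<Rightarrow> ('u gpoint \<times> 'u gpoint) set" where
  "grel K = {((m, sact K m n \<theta> x, t), (n, x, push_simplex m \<theta> t)) | m n \<theta> x t.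
     \<theta> \<in> Delta m n \<and> x \<in> simp K n \<and> t \<in> standard_simplex m}"

definition gclass :: "'u sset \<Rightarrow> 'u gpoint \<Rightarrow> 'u gpoint set" where
  "gclass K p = {q. (p, q) \<in> (grel K \<union> (grel K)\<inverse>)\<^sup>*}"

definition realization :: "'u sset \<Rightarrow> 'u gpoint set topology" where
  "realization K = topology (\<lambda>S.
     S \<subseteq> {gclass K (n, x, t) | n x t. x \<in> simp K n \<and> t \<in> standard_simplex n} \<and>
     (\<forall>n. \<forall>x\<in>simp K n. openin (subtopology (powertop_real UNIV) (standard_simplex n))
        {t \<in> standard_simplex n. gclass K (n, x, t) \<in> S}))"

definition realization_map :: "'v sset \<Rightarrow> (nat \<Rightarrow> 'u \<Rightarrow> 'v) \<Rightarrow> 'u gpoint set \<Rightarrow> 'v gpoint set" where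
  "realization_map L f c = (\<Union>(n, x, t)\<in>c. gclass L (n, f n x, t))"

definition vertex_point :: "'u sset \<Rightarrow> 'u \<Rightarrow> 'u gpoint set" where
  "vertex_point K x = gclass K (0, x, (\<lambda>i. if i = 0 then 1 else 0))"

text \<open>Elements of \<open>\<pi>\<^sub>n(T, b)\<close>, \<open>n \<ge> 1\<close>, are represented by maps of the cube \<open>I\<^sup>n\<close> sending the
  boundary to \<open>b\<close>, up to homotopy rel boundary. The 0-cube is a point with empty boundary, so that
  for \<open>n = 0\<close> one gets \<open>\<pi>\<^sub>0(T)\<close>, and \<open>b\<close> plays no role.\<close>

definition cube :: "nat \<Rightarrow> (nat \<Rightarrow> real) topology" where
  "cube n = product_topology (\<lambda>_. top_of_set {0..1}) {..<n}"

definition cube_boundary :: "nat \<Rightarrow> (nat \<Rightarrow> real) set" where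
  "cube_boundary n = {t \<in> topspace (cube n). \<exists>i<n. t i = 0 \<or> t i = 1}"

definition spheroid :: "nat \<Rightarrow> 't topology \<Rightarrow> 't \<Rightarrow> ((nat \<Rightarrow> real) \<Rightarrow> 't) \<Rightarrow> bool" where
  "spheroid n T b \<gamma> \<longleftrightarrow> continuous_map (cube n) T \<gamma> \<and> \<gamma> ` cube_boundary n \<subseteq> {b}"

definition spheroid_htpc ::
  "nat \<Rightarrow> 't topology \<Rightarrow> 't \<Rightarrow> ((nat \<Rightarrow> real) \<Rightarrow> 't) \<Rightarrow> ((nat \<Rightarrow> real) \<Rightarrow> 't) \<Rightarrow> bool" where
  "spheroid_htpc n T b \<gamma> \<delta> \<longleftrightarrow> homotopic_with (\<lambda>h. h ` cube_boundary n \<subseteq> {b}) (cube n) T \<gamma> \<delta>"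

definition bij_on_pi :: "nat \<Rightarrow> 's topology \<Rightarrow> 's \<Rightarrow> 't topology \<Rightarrow> 't \<Rightarrow> ('s \<Rightarrow> 't) \<Rightarrow> bool" where
  "bij_on_pi n S a T b f \<longleftrightarrow>
     (\<forall>\<gamma> \<delta>. spheroid n S a \<gamma> \<and> spheroid n S a \<delta> \<and> spheroid_htpc n T b (f \<circ> \<gamma>) (f \<circ> \<delta>) \<longrightarrow>
        spheroid_htpc n S a \<gamma> \<delta>) \<and>
     (\<forall>\<gamma>. spheroid n T b \<gamma> \<longrightarrow> (\<exists>\<delta>. spheroid n S a \<delta> \<and> spheroid_htpc n T b (f \<circ> \<delta>) \<gamma>))"

definition sset_weq :: "'u sset \<Rightarrow> 'v sset \<Rightarrow> (nat \<Rightarrow> 'u \<Rightarrow> 'v) \<Rightarrow> bool" where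
  "sset_weq K L f \<longleftrightarrow> is_sset K \<and> is_sset L \<and> is_sset_map K L f \<and>
     bij_on_pi 0 (realization K) undefined (realization L) undefined (realization_map L f) \<and>
     (\<forall>n\<ge>1. \<forall>x\<in>simp K 0. bij_on_pi n (realization K) (vertex_point K x)
        (realization L) (vertex_point L (f 0 x)) (realization_map L f))"

definition coface :: "nat \<Rightarrow> nat \<Rightarrow> nat \<Rightarrow> nat" where
  "coface n i = restrict (\<lambda>j. if j < i then j else Suc j) {..<n}"

text \<open>The \<open>i\<close>-th face of an \<open>n\<close>-simplex, \<open>n \<ge> 1\<close>.\<close>

definition face :: "'u sset \<Rightarrow> nat \<Rightarrow> nat \<Rightarrow> 'u \<Rightarrow> 'u" where
  "face K n i = sact K (n - 1) n (coface n i)"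

definition kan_fibration :: "'u sset \<Rightarrow> 'v sset \<Rightarrow> (nat \<Rightarrow> 'u \<Rightarrow> 'v) \<Rightarrow> bool" where
  "kan_fibration K L f \<longleftrightarrow> is_sset K \<and> is_sset L \<and> is_sset_map K L f \<and>
     (\<forall>n\<ge>1. \<forall>k\<le>n. \<forall>y z. (\<forall>i\<le>n. i \<noteq> k \<longrightarrow> y i \<in> simp K (n - 1) \<and> f (n - 1) (y i) = face L n i z) \<and>
        (\<forall>j\<le>n. \<forall>i<j. i \<noteq> k \<and> j \<noteq> k \<and> 2 \<le> n \<longrightarrow> face K (n - 1) i (y j) = face K (n - 1) (j - 1) (y i)) \<and>
        z \<in> simp L n \<longrightarrow>
        (\<exists>x\<in>simp K n. f n x = z \<and> (\<forall>i\<le>n. i \<noteq> k \<longrightarrow> face K n i x = y i)))"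


section \<open>Simplicial presheaves\<close>

text \<open>Simplicial presheaves on \<open>C\<close> whose sets of sections are subsets of the type \<open>'u\<close>.
  For an arrow \<open>f : U \<rightarrow> V\<close> of \<open>C\<close>, \<open>rstr A f\<close> maps the simplicial set \<open>sect A V\<close> to \<open>sect A U\<close>.\<close>

record ('o, 'm, 'u) spsh =
  sect :: "'o \<Rightarrow> 'u sset"
  rstr :: "'m \<Rightarrow> nat \<Rightarrow> 'u \<Rightarrow> 'u"

definition is_spsh :: "('o, 'm, 'z) cat_scheme \<Rightarrow> ('o, 'm, 'u, 'y) spsh_scheme \<Rightarrow> bool" where
  "is_spsh C A \<longleftrightarrow>
     (\<forall>U\<in>Ob C. is_sset (sect A U)) \<and>
     (\<forall>f\<in>Ar C. is_sset_map (sect A (tgt C f)) (sect A (src C f)) (rstr A f)) \<and>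
     (\<forall>U\<in>Ob C. \<forall>n. \<forall>x\<in>simp (sect A U) n. rstr A (idn C U) n x = x) \<and>
     (\<forall>f\<in>Ar C. \<forall>g\<in>Ar C. tgt C f = src C g \<longrightarrow>
        (\<forall>n. \<forall>x\<in>simp (sect A (tgt C g)) n. rstr A (cmp C g f) n x = rstr A f n (rstr A g n x)))"

text \<open>A map of presheaves is normalized to be \<open>undefined\<close> outside its domain, so that equal maps
  are equal functions.\<close>

definition spsh_map ::
  "('o, 'm, 'z) cat_scheme \<Rightarrow> ('o, 'm, 'u, 'x) spsh_scheme \<Rightarrow> ('o, 'm, 'v, 'y) spsh_scheme \<Rightarrow>
   ('o \<Rightarrow> nat \<Rightarrow> 'u \<Rightarrow> 'v) \<Rightarrow> bool" where
  "spsh_map C A B \<phi> \<longleftrightarrow> \<phi> \<in> extensional (Ob C) \<and>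
     (\<forall>U\<in>Ob C. \<forall>n. \<phi> U n \<in> simp (sect A U) n \<rightarrow>\<^sub>E simp (sect B U) n) \<and>
     (\<forall>U\<in>Ob C. is_sset_map (sect A U) (sect B U) (\<phi> U)) \<and>
     (\<forall>f\<in>Ar C. \<forall>n. \<forall>x\<in>simp (sect A (tgt C f)) n.
        \<phi> (src C f) n (rstr A f n x) = rstr B f n (\<phi> (tgt C f) n x))"

definition spsh_comp ::
  "('o, 'm, 'z) cat_scheme \<Rightarrow> ('o, 'm, 'u, 'y) spsh_scheme \<Rightarrow>
   ('o \<Rightarrow> nat \<Rightarrow> 'v \<Rightarrow> 'w) \<Rightarrow> ('o \<Rightarrow> nat \<Rightarrow> 'u \<Rightarrow> 'v) \<Rightarrow> 'o \<Rightarrow> nat \<Rightarrow> 'u \<Rightarrow> 'w" where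
  "spsh_comp C A \<psi> \<phi> =
     restrict (\<lambda>U n. restrict (\<lambda>x. \<psi> U n (\<phi> U n x)) (simp (sect A U) n)) (Ob C)"

definition spsh_mono ::
  "('o, 'm, 'z) cat_scheme \<Rightarrow> ('o, 'm, 'u, 'y) spsh_scheme \<Rightarrow> ('o \<Rightarrow> nat \<Rightarrow> 'u \<Rightarrow> 'v) \<Rightarrow> bool" where
  "spsh_mono C A \<phi> \<longleftrightarrow> (\<forall>U\<in>Ob C. \<forall>n. inj_on (\<phi> U n) (simp (sect A U) n))"

text \<open>The product \<open>A \<times> \<Delta>\<^sup>n\<close>.\<close>

definition prism ::
  "('o, 'm, 'u, 'y) spsh_scheme \<Rightarrow> nat \<Rightarrow> ('o, 'm, 'u \<times> (nat \<Rightarrow> nat)) spsh" where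
  "prism A n =
     \<lparr>sect = (\<lambda>U. \<lparr>simp = (\<lambda>k. simp (sect A U) k \<times> Delta k n),
                   sact = (\<lambda>l k \<theta> (x, \<sigma>). (sact (sect A U) l k \<theta> x, compose {..l} \<sigma> \<theta>))\<rparr>),
      rstr = (\<lambda>f k (x, \<sigma>). (rstr A f k x, \<sigma>))\<rparr>"

text \<open>The simplicial mapping space: its \<open>n\<close>-simplices are the maps \<open>A \<times> \<Delta>\<^sup>n \<rightarrow> B\<close>.\<close>

definition Map ::
  "('o, 'm, 'z) cat_scheme \<Rightarrow> ('o, 'm, 'u, 'x) spsh_scheme \<Rightarrow> ('o, 'm, 'v, 'y) spsh_scheme \<Rightarrow>
   ('o \<Rightarrow> nat \<Rightarrow> 'u \<times> (nat \<Rightarrow> nat) \<Rightarrow> 'v) sset" where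
  "Map C A B =
     \<lparr>simp = (\<lambda>n. {\<phi>. spsh_map C (prism A n) B \<phi>}),
      sact = (\<lambda>m n \<theta> \<phi>. restrict (\<lambda>U k. restrict (\<lambda>(x, \<sigma>). \<phi> U k (x, compose {..k} \<theta> \<sigma>))
                (simp (sect A U) k \<times> Delta k m)) (Ob C))\<rparr>"

definition Map_pre ::
  "('o, 'm, 'z) cat_scheme \<Rightarrow> ('o, 'm, 'u, 'y) spsh_scheme \<Rightarrow> ('o \<Rightarrow> nat \<Rightarrow> 'u \<Rightarrow> 'v) \<Rightarrow>
   nat \<Rightarrow> ('o \<Rightarrow> nat \<Rightarrow> 'v \<times> (nat \<Rightarrow> nat) \<Rightarrow> 'w) \<Rightarrow> ('o \<Rightarrow> nat \<Rightarrow> 'u \<times> (nat \<Rightarrow> nat) \<Rightarrow> 'w)" where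
  "Map_pre C A f n \<phi> = restrict (\<lambda>U k. restrict (\<lambda>(x, \<sigma>). \<phi> U k (f U k x, \<sigma>))
     (simp (sect A U) k \<times> Delta k n)) (Ob C)"

definition Map_post ::
  "('o, 'm, 'z) cat_scheme \<Rightarrow> ('o, 'm, 'u, 'y) spsh_scheme \<Rightarrow> ('o \<Rightarrow> nat \<Rightarrow> 'v \<Rightarrow> 'w) \<Rightarrow>
   nat \<Rightarrow> ('o \<Rightarrow> nat \<Rightarrow> 'u \<times> (nat \<Rightarrow> nat) \<Rightarrow> 'v) \<Rightarrow> ('o \<Rightarrow> nat \<Rightarrow> 'u \<times> (nat \<Rightarrow> nat) \<Rightarrow> 'w)" where
  "Map_post C A p n \<phi> = restrict (\<lambda>U k. restrict (\<lambda>(x, \<sigma>). p U k (\<phi> U k (x, \<sigma>)))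
     (simp (sect A U) k \<times> Delta k n)) (Ob C)"

text \<open>\<open>cov U R\<close> says that the set \<open>R\<close> of arrows is a covering family of \<open>U\<close>. The map \<open>\<phi>\<close> is a local
  weak equivalence if it induces isomorphisms on the sheaf associated with \<open>\<pi>\<^sub>0\<close> and, for all
  \<open>U\<close> and \<open>x \<in> A(U)\<^sub>0\<close>, on the sheaves on \<open>C/U\<close> associated with \<open>\<pi>\<^sub>n(-, x)\<close>, \<open>n \<ge> 1\<close>; that is, if the
  maps of presheaves of homotopy sets are locally injective and locally surjective. (As \<open>U\<close> and \<open>x\<close>
  vary, it suffices to consider sections over \<open>U\<close> itself.)\<close>

definition local_bij_on_pi ::
  "('o, 'm, 'z) cat_scheme \<Rightarrow> ('o \<Rightarrow> 'm set \<Rightarrow> bool) \<Rightarrow> ('o, 'm, 'u, 'x) spsh_scheme \<Rightarrow>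
   ('o, 'm, 'v, 'y) spsh_scheme \<Rightarrow> ('o \<Rightarrow> nat \<Rightarrow> 'u \<Rightarrow> 'v) \<Rightarrow> nat \<Rightarrow> 'o \<Rightarrow> 'u \<Rightarrow> bool" where
  "local_bij_on_pi C cov A B \<phi> n U x \<longleftrightarrow>
     (let rA = (\<lambda>V. realization (sect A V)); rB = (\<lambda>V. realization (sect B V));
          a = (\<lambda>V y. vertex_point (sect A V) y); b = (\<lambda>V y. vertex_point (sect B V) y);
          F = (\<lambda>V. realization_map (sect B V) (\<phi> V));
          resA = (\<lambda>g. realization_map (sect A (src C g)) (rstr A g));
          resB = (\<lambda>g. realization_map (sect B (src C g)) (rstr B g));
          xA = (\<lambda>g. a (src C g) (rstr A g 0 x));
          xB = (\<lambda>g. b (src C g) (\<phi> (src C g) 0 (rstr A g 0 x)))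
      in
        (\<forall>\<gamma> \<delta>. spheroid n (rA U) (a U x) \<gamma> \<and> spheroid n (rA U) (a U x) \<delta> \<and>
           spheroid_htpc n (rB U) (b U (\<phi> U 0 x)) (F U \<circ> \<gamma>) (F U \<circ> \<delta>) \<longrightarrow>
           (\<exists>R. cov U R \<and>
              (\<forall>g\<in>R. spheroid_htpc n (rA (src C g)) (xA g) (resA g \<circ> \<gamma>) (resA g \<circ> \<delta>)))) \<and>
        (\<forall>\<gamma>. spheroid n (rB U) (b U (\<phi> U 0 x)) \<gamma> \<longrightarrow>
           (\<exists>R. cov U R \<and>
              (\<forall>g\<in>R. \<exists>\<delta>. spheroid n (rA (src C g)) (xA g) \<delta> \<and>
                 spheroid_htpc n (rB (src C g)) (xB g) (F (src C g) \<circ> \<delta>) (resB g \<circ> \<gamma>)))))"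

definition local_weq ::
  "('o, 'm, 'z) cat_scheme \<Rightarrow> ('o \<Rightarrow> 'm set \<Rightarrow> bool) \<Rightarrow> ('o, 'm, 'u, 'x) spsh_scheme \<Rightarrow>
   ('o, 'm, 'v, 'y) spsh_scheme \<Rightarrow> ('o \<Rightarrow> nat \<Rightarrow> 'u \<Rightarrow> 'v) \<Rightarrow> bool" where
  "local_weq C cov A B \<phi> \<longleftrightarrow>
     (\<forall>U\<in>Ob C. local_bij_on_pi C cov A B \<phi> 0 U undefined) \<and>
     (\<forall>n\<ge>1. \<forall>U\<in>Ob C. \<forall>x\<in>simp (sect A U) 0. local_bij_on_pi C cov A B \<phi> n U x)"

definition injective_fibrant ::
  "('o, 'm, 'z) cat_scheme \<Rightarrow> ('o \<Rightarrow> 'm set \<Rightarrow> bool) \<Rightarrow> ('o, 'm, 'u) spsh \<Rightarrow> bool" where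
  "injective_fibrant C cov Z \<longleftrightarrow> is_spsh C Z \<and>
     (\<forall>(A :: ('o, 'm, 'u) spsh) (B :: ('o, 'm, 'u) spsh) i g.
        is_spsh C A \<and> is_spsh C B \<and> spsh_map C A B i \<and> spsh_mono C A i \<and> local_weq C cov A B i \<and>
        spsh_map C A Z g \<longrightarrow> (\<exists>h. spsh_map C B Z h \<and> spsh_comp C A h i = g))"

text \<open>Here \<open>J\<close> is a set of arrows of \<open>C\<close> (below: the projections \<open>\<A>\<^sup>1\<^sub>Y \<rightarrow> Y\<close>). Motivic fibrant
  presheaves are those that are fibrant in the local injective structure and invariant under \<open>J\<close>;
  motivic weak equivalences are detected by mapping into them.\<close>

definition motivic_fibrant ::
  "('o, 'm, 'z) cat_scheme \<Rightarrow> ('o \<Rightarrow> 'm set \<Rightarrow> bool) \<Rightarrow> 'm set \<Rightarrow> ('o, 'm, 'u) spsh \<Rightarrow> bool" where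
  "motivic_fibrant C cov J Z \<longleftrightarrow> injective_fibrant C cov Z \<and>
     (\<forall>p\<in>J. sset_weq (sect Z (tgt C p)) (sect Z (src C p)) (rstr Z p))"

definition motivic_weq ::
  "('o, 'm, 'z) cat_scheme \<Rightarrow> ('o \<Rightarrow> 'm set \<Rightarrow> bool) \<Rightarrow> 'm set \<Rightarrow> ('o, 'm, 'u, 'y) spsh_scheme \<Rightarrow>
   ('o, 'm, 'u, 'y) spsh_scheme \<Rightarrow> ('o \<Rightarrow> nat \<Rightarrow> 'u \<Rightarrow> 'u) \<Rightarrow> bool" where
  "motivic_weq C cov J A B \<phi> \<longleftrightarrow>
     (\<forall>Z :: ('o, 'm, 'u) spsh. motivic_fibrant C cov J Z \<longrightarrow>
        sset_weq (Map C B Z) (Map C A Z) (Map_pre C A \<phi>))"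


section \<open>Pointed simplicial presheaves\<close>

record ('o, 'm, 'u) psp = "('o, 'm, 'u) spsh" +
  bpt :: "'o \<Rightarrow> 'u"

definition is_psp :: "('o, 'm, 'z) cat_scheme \<Rightarrow> ('o, 'm, 'u) psp \<Rightarrow> bool" where
  "is_psp C A \<longleftrightarrow> is_spsh C A \<and> (\<forall>U\<in>Ob C. bpt A U \<in> simp (sect A U) 0) \<and>
     (\<forall>f\<in>Ar C. rstr A f 0 (bpt A (tgt C f)) = bpt A (src C f))"

definition psp_map ::
  "('o, 'm, 'z) cat_scheme \<Rightarrow> ('o, 'm, 'u) psp \<Rightarrow> ('o, 'm, 'u) psp \<Rightarrow> ('o \<Rightarrow> nat \<Rightarrow> 'u \<Rightarrow> 'u) \<Rightarrow> bool"
  where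
  "psp_map C A B \<phi> \<longleftrightarrow> spsh_map C A B \<phi> \<and> (\<forall>U\<in>Ob C. \<phi> U 0 (bpt A U) = bpt B U)"

type_synonym ('o, 'm, 'u) psp_ar =
  "('o, 'm, 'u) psp \<times> ('o, 'm, 'u) psp \<times> ('o \<Rightarrow> nat \<Rightarrow> 'u \<Rightarrow> 'u)"

definition psp_cat ::
  "('o, 'm, 'z) cat_scheme \<Rightarrow> (('o, 'm, 'u) psp, ('o, 'm, 'u) psp_ar) cat" where
  "psp_cat C =
     \<lparr>Ob = {A. is_psp C A},
      Ar = {(A, B, \<phi>). is_psp C A \<and> is_psp C B \<and> psp_map C A B \<phi>},
      src = (\<lambda>(A, B, \<phi>). A),
      tgt = (\<lambda>(A, B, \<phi>). B),
      idn = (\<lambda>A. (A, A, restrict (\<lambda>U n. restrict (\<lambda>x. x) (simp (sect A U) n)) (Ob C))),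
      cmp = (\<lambda>(B', D, \<psi>) (A, B, \<phi>). (A, D, spsh_comp C A \<psi> \<phi>))\<rparr>"

text \<open>The base point in degree \<open>n\<close>.\<close>

definition bptn :: "('o, 'm, 'u) psp \<Rightarrow> 'o \<Rightarrow> nat \<Rightarrow> 'u" where
  "bptn A U n = sact (sect A U) n 0 (restrict (\<lambda>_. 0) {..n}) (bpt A U)"

text \<open>The pointed mapping space: pointed maps from the smash product of \<open>A\<close> with \<open>\<Delta>\<^sup>n\<^sub>+\<close> to \<open>B\<close>,
  i.e. maps \<open>A \<times> \<Delta>\<^sup>n \<rightarrow> B\<close> sending \<open>* \<times> \<Delta>\<^sup>n\<close> to the base point.\<close>

definition pMap ::
  "('o, 'm, 'z) cat_scheme \<Rightarrow> ('o, 'm, 'u) psp \<Rightarrow> ('o, 'm, 'u) psp \<Rightarrow>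
   ('o \<Rightarrow> nat \<Rightarrow> 'u \<times> (nat \<Rightarrow> nat) \<Rightarrow> 'u) sset" where
  "pMap C A B = Map C A B \<lparr>simp := (\<lambda>n. {\<phi> \<in> simp (Map C A B) n.
     \<forall>U\<in>Ob C. \<forall>k. \<forall>\<sigma>\<in>Delta k n. \<phi> U k (bptn A U k, \<sigma>) = bptn B U k})\<rparr>"

text \<open>Cofibrations are the monomorphisms; a map of pointed presheaves is a weak equivalence if the
  underlying unpointed map is one; fibrations are defined by the right lifting property.\<close>

definition motivic_model ::
  "('o, 'm, 'z) cat_scheme \<Rightarrow> ('o \<Rightarrow> 'm set \<Rightarrow> bool) \<Rightarrow> 'm set \<Rightarrow>
   (('o, 'm, 'u) psp, ('o, 'm, 'u) psp_ar) model" where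
  "motivic_model C cov J =
     (let K = psp_cat C;
          c = {(A, B, \<phi>) \<in> Ar K. spsh_mono C A \<phi>};
          w = {(A, B, \<phi>) \<in> Ar K. motivic_weq C cov J A B \<phi>}
      in cat.extend K \<lparr>cof = c, fib = {p \<in> Ar K. \<forall>i\<in>c \<inter> w. has_lift K i p}, weq = w\<rparr>)"

text \<open>Quillen's axiom SM7 for the enrichment given by \<open>pMap\<close>.\<close>

definition pMap_pullback ::
  "('o, 'm, 'z) cat_scheme \<Rightarrow> ('o, 'm, 'u) psp_ar \<Rightarrow> ('o, 'm, 'u) psp_ar \<Rightarrow>
   (('o \<Rightarrow> nat \<Rightarrow> 'u \<times> (nat \<Rightarrow> nat) \<Rightarrow> 'u) \<times> ('o \<Rightarrow> nat \<Rightarrow> 'u \<times> (nat \<Rightarrow> nat) \<Rightarrow> 'u)) sset" where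
  "pMap_pullback C = (\<lambda>(A, B, i). \<lambda>(X, Y, p).
     \<lparr>simp = (\<lambda>n. {(\<phi>, \<psi>). \<phi> \<in> simp (pMap C A X) n \<and> \<psi> \<in> simp (pMap C B Y) n \<and>
                     Map_post C A p n \<phi> = Map_pre C A i n \<psi>}),
      sact = (\<lambda>m n \<theta> (\<phi>, \<psi>). (sact (pMap C A X) m n \<theta> \<phi>, sact (pMap C B Y) m n \<theta> \<psi>))\<rparr>)"

definition pMap_corner ::
  "('o, 'm, 'z) cat_scheme \<Rightarrow> ('o, 'm, 'u) psp_ar \<Rightarrow> ('o, 'm, 'u) psp_ar \<Rightarrow> nat \<Rightarrow>
   ('o \<Rightarrow> nat \<Rightarrow> 'u \<times> (nat \<Rightarrow> nat) \<Rightarrow> 'u) \<Rightarrow>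
   ('o \<Rightarrow> nat \<Rightarrow> 'u \<times> (nat \<Rightarrow> nat) \<Rightarrow> 'u) \<times> ('o \<Rightarrow> nat \<Rightarrow> 'u \<times> (nat \<Rightarrow> nat) \<Rightarrow> 'u)" where
  "pMap_corner C = (\<lambda>(A, B, i). \<lambda>(X, Y, p). \<lambda>n \<phi>. (Map_pre C A i n \<phi>, Map_post C B p n \<phi>))"

definition simplicial_model_category ::
  "('o, 'm, 'z) cat_scheme \<Rightarrow> (('o, 'm, 'u) psp, ('o, 'm, 'u) psp_ar) model \<Rightarrow> bool" where
  "simplicial_model_category C M \<longleftrightarrow> model_category M \<and>
     (\<forall>i\<in>cof M. \<forall>p\<in>fib M.
        kan_fibration (pMap C (tgt M i) (src M p)) (pMap_pullback C i p) (pMap_corner C i p) \<and>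
        (i \<in> weq M \<or> p \<in> weq M \<longrightarrow>
          sset_weq (pMap C (tgt M i) (src M p)) (pMap_pullback C i p) (pMap_corner C i p)))"


section \<open>Left Bousfield localization\<close>

text \<open>In a simplicial model category in which all objects are cofibrant, the simplicial mapping
  space into a fibrant object is a homotopy function complex.\<close>

definition local_object ::
  "('o, 'm, 'z) cat_scheme \<Rightarrow> (('o, 'm, 'u) psp, ('o, 'm, 'u) psp_ar) model \<Rightarrow>
   ('o, 'm, 'u) psp_ar set \<Rightarrow> ('o, 'm, 'u) psp \<Rightarrow> bool" where
  "local_object C M S Z \<longleftrightarrow> Z \<in> Ob M \<and> fibrant M Z \<and>
     (\<forall>(A, B, \<phi>)\<in>S. sset_weq (pMap C B Z) (pMap C A Z) (Map_pre C A \<phi>))"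

definition local_equivalence ::
  "('o, 'm, 'z) cat_scheme \<Rightarrow> (('o, 'm, 'u) psp, ('o, 'm, 'u) psp_ar) model \<Rightarrow>
   ('o, 'm, 'u) psp_ar set \<Rightarrow> ('o, 'm, 'u) psp_ar \<Rightarrow> bool" where
  "local_equivalence C M S = (\<lambda>(A, B, \<phi>). (A, B, \<phi>) \<in> Ar M \<and>
     (\<forall>Z. local_object C M S Z \<longrightarrow> sset_weq (pMap C B Z) (pMap C A Z) (Map_pre C A \<phi>)))"

definition left_bousfield ::
  "('o, 'm, 'z) cat_scheme \<Rightarrow> (('o, 'm, 'u) psp, ('o, 'm, 'u) psp_ar) model \<Rightarrow>
   ('o, 'm, 'u) psp_ar set \<Rightarrow> (('o, 'm, 'u) psp, ('o, 'm, 'u) psp_ar) model" where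
  "left_bousfield C M S = M\<lparr>
     weq := {f. local_equivalence C M S f},
     fib := {p \<in> Ar M. \<forall>i\<in>cof M. local_equivalence C M S i \<longrightarrow> has_lift M i p}\<rparr>"


section \<open>Commutative algebra\<close>

text \<open>The polynomial ring over \<open>R\<close> in the variables \<open>x\<^sub>i\<close>, \<open>i < n\<close>; monomials are multisets of
  indices, polynomials are given by their coefficients.\<close>

definition mpoly_ring :: "('r, 'y) ring_scheme \<Rightarrow> nat \<Rightarrow> (nat multiset \<Rightarrow> 'r) ring" where
  "mpoly_ring R n =
     \<lparr>carrier = {f. finite {m. f m \<noteq> \<zero>\<^bsub>R\<^esub>} \<and> (\<forall>m. f m \<in> carrier R) \<and>
                    (\<forall>m. f m \<noteq> \<zero>\<^bsub>R\<^esub> \<longrightarrow> set_mset m \<subseteq> {..<n})},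
      monoid.mult = (\<lambda>f g m. finsum R (\<lambda>k. f k \<otimes>\<^bsub>R\<^esub> g (m - k)) {k. k \<subseteq># m}),
      one = (\<lambda>m. if m = {#} then \<one>\<^bsub>R\<^esub> else \<zero>\<^bsub>R\<^esub>),
      zero = (\<lambda>m. \<zero>\<^bsub>R\<^esub>),
      add = (\<lambda>f g m. f m \<oplus>\<^bsub>R\<^esub> g m)\<rparr>"

definition mpoly_eval ::
  "('r, 'y) ring_scheme \<Rightarrow> ('s, 'z) ring_scheme \<Rightarrow> ('r \<Rightarrow> 's) \<Rightarrow> (nat \<Rightarrow> 's) \<Rightarrow> (nat multiset \<Rightarrow> 'r) \<Rightarrow> 's"
  where
  "mpoly_eval R A h a f =
     finsum A (\<lambda>m. h (f m) \<otimes>\<^bsub>A\<^esub> finprod A (\<lambda>i. a i [^]\<^bsub>A\<^esub> count m i) (set_mset m))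
       {m. f m \<noteq> \<zero>\<^bsub>R\<^esub>}"

definition mpoly_deriv ::
  "('r, 'y) ring_scheme \<Rightarrow> nat \<Rightarrow> (nat multiset \<Rightarrow> 'r) \<Rightarrow> nat multiset \<Rightarrow> 'r" where
  "mpoly_deriv R i f m = [Suc (count m i)] \<cdot>\<^bsub>R\<^esub> f (add_mset i m)"

definition ring_det :: "('s, 'z) ring_scheme \<Rightarrow> nat \<Rightarrow> (nat \<Rightarrow> nat \<Rightarrow> 's) \<Rightarrow> 's" where
  "ring_det A c J = finsum A (\<lambda>\<sigma>. (let d = finprod A (\<lambda>j. J j (\<sigma> j)) {..<c} in
       if evenperm \<sigma> then d else \<ominus>\<^bsub>A\<^esub> d)) {\<sigma>. \<sigma> permutes {..<c}}"

text \<open>\<open>A\<close> is, via \<open>h\<close>, isomorphic to \<open>R[x\<^sub>0,...,x\<^sub>n\<^sub>-\<^sub>1]/(f\<^sub>0,...,f\<^sub>c\<^sub>-\<^sub>1)\<close>, with the image in \<open>A\<close>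
  of the minor \<open>det (\<partial>f\<^sub>j/\<partial>x\<^sub>i)\<close>, \<open>i, j < c\<close>, invertible.\<close>

definition standard_smooth ::
  "('r, 'y) ring_scheme \<Rightarrow> ('s, 'z) ring_scheme \<Rightarrow> ('r \<Rightarrow> 's) \<Rightarrow> nat \<Rightarrow> nat \<Rightarrow> bool" where
  "standard_smooth R A h n c \<longleftrightarrow> c \<le> n \<and> h \<in> ring_hom R A \<and>
     (\<exists>a f. (\<forall>i<n. a i \<in> carrier A) \<and> (\<forall>j<c. f j \<in> carrier (mpoly_ring R n)) \<and>
        mpoly_eval R A h a ` carrier (mpoly_ring R n) = carrier A \<and>
        {g \<in> carrier (mpoly_ring R n). mpoly_eval R A h a g = \<zero>\<^bsub>A\<^esub>}
          = genideal (mpoly_ring R n) (f ` {..<c}) \<and>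
        ring_det A c (\<lambda>j i. mpoly_eval R A h a (mpoly_deriv R i (f j))) \<in> Units A)"

definition finite_type_alg ::
  "('r, 'y) ring_scheme \<Rightarrow> ('s, 'z) ring_scheme \<Rightarrow> ('r \<Rightarrow> 's) \<Rightarrow> bool" where
  "finite_type_alg R A h \<longleftrightarrow> h \<in> ring_hom R A \<and>
     (\<exists>n a. (\<forall>i<n. a i \<in> carrier A) \<and>
        mpoly_eval R A h a ` carrier (mpoly_ring R n) = carrier A)"

text \<open>\<open>h\<close> exhibits \<open>A\<close> as the localization of \<open>R\<close> at the powers of \<open>s\<close>.\<close>

definition localization_at ::
  "('r, 'y) ring_scheme \<Rightarrow> ('s, 'z) ring_scheme \<Rightarrow> ('r \<Rightarrow> 's) \<Rightarrow> 'r \<Rightarrow> bool" where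
  "localization_at R A h s \<longleftrightarrow> h \<in> ring_hom R A \<and> h s \<in> Units A \<and>
     (\<forall>b\<in>carrier A. \<exists>a\<in>carrier R. \<exists>k::nat. b \<otimes>\<^bsub>A\<^esub> (h s [^]\<^bsub>A\<^esub> k) = h a) \<and>
     (\<forall>a\<in>carrier R. h a = \<zero>\<^bsub>A\<^esub> \<longrightarrow> (\<exists>k::nat. (s [^]\<^bsub>R\<^esub> k) \<otimes>\<^bsub>R\<^esub> a = \<zero>\<^bsub>R\<^esub>))"

definition ring_krull_dim :: "('r, 'y) ring_scheme \<Rightarrow> enat" where
  "ring_krull_dim R = (SUP k\<in>{k. \<exists>P. (\<forall>i\<le>k. primeideal (P i) R) \<and> (\<forall>i<k. P i \<subset> P (Suc i))}. enat k)"


section \<open>Schemes\<close>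

text \<open>Ringed spaces whose points and sections are elements of the type \<open>'a\<close>; the values of \<open>osec\<close>
  and \<open>ores\<close> on sets that are not open are irrelevant.\<close>

record 'a scheme =
  stop :: "'a topology"
  osec :: "'a set \<Rightarrow> 'a ring"
  ores :: "'a set \<Rightarrow> 'a set \<Rightarrow> 'a \<Rightarrow> 'a"

definition is_ringed_space :: "'a scheme \<Rightarrow> bool" where
  "is_ringed_space Y \<longleftrightarrow>
     (\<forall>U. openin (stop Y) U \<longrightarrow> cring (osec Y U)) \<and>
     (\<forall>U V. openin (stop Y) U \<and> openin (stop Y) V \<and> V \<subseteq> U \<longrightarrow>
        ores Y U V \<in> ring_hom (osec Y U) (osec Y V)) \<and>
     (\<forall>U. openin (stop Y) U \<longrightarrow> (\<forall>s\<in>carrier (osec Y U). ores Y U U s = s)) \<and>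
     (\<forall>U V W. openin (stop Y) U \<and> openin (stop Y) V \<and> openin (stop Y) W \<and> W \<subseteq> V \<and> V \<subseteq> U \<longrightarrow>
        (\<forall>s\<in>carrier (osec Y U). ores Y V W (ores Y U V s) = ores Y U W s)) \<and>
     (\<forall>\<U>. (\<forall>V\<in>\<U>. openin (stop Y) V) \<longrightarrow>
        (\<forall>s\<in>carrier (osec Y (\<Union>\<U>)). \<forall>t\<in>carrier (osec Y (\<Union>\<U>)).
           (\<forall>V\<in>\<U>. ores Y (\<Union>\<U>) V s = ores Y (\<Union>\<U>) V t) \<longrightarrow> s = t) \<and>
        (\<forall>s. (\<forall>V\<in>\<U>. s V \<in> carrier (osec Y V)) \<and>
           (\<forall>V\<in>\<U>. \<forall>W\<in>\<U>. ores Y V (V \<inter> W) (s V) = ores Y W (V \<inter> W) (s W)) \<longrightarrow>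
           (\<exists>t\<in>carrier (osec Y (\<Union>\<U>)). \<forall>V\<in>\<U>. ores Y (\<Union>\<U>) V t = s V)))"

text \<open>The sections over \<open>U\<close> whose germ at \<open>x\<close> is not a unit.\<close>

definition vanishing :: "'a scheme \<Rightarrow> 'a set \<Rightarrow> 'a \<Rightarrow> 'a set" where
  "vanishing Y U x = {s \<in> carrier (osec Y U).
     \<not> (\<exists>V. openin (stop Y) V \<and> x \<in> V \<and> V \<subseteq> U \<and> ores Y U V s \<in> Units (osec Y V))}"

definition basic_open :: "'a scheme \<Rightarrow> 'a set \<Rightarrow> 'a \<Rightarrow> 'a set" where
  "basic_open Y U s = {x \<in> U. s \<notin> vanishing Y U x}"

text \<open>The open subspace \<open>U\<close> is isomorphic to \<open>Spec A\<close>, \<open>A = \<O>(U)\<close>: the canonical map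
  \<open>vanishing Y U\<close> from \<open>U\<close> to the set of prime ideals of \<open>A\<close> is a homeomorphism for the Zariski
  topology, and the structure sheaf is the one with \<open>\<O>(D(s)) = A\<^sub>s\<close>.\<close>

definition affine_open :: "'a scheme \<Rightarrow> 'a set \<Rightarrow> bool" where
  "affine_open Y U \<longleftrightarrow> openin (stop Y) U \<and>
     bij_betw (vanishing Y U) U {P. primeideal P (osec Y U)} \<and>
     (\<forall>V. V \<subseteq> U \<longrightarrow> (openin (stop Y) V \<longleftrightarrow>
        (\<exists>F. F \<subseteq> carrier (osec Y U) \<and> V = (\<Union>s\<in>F. basic_open Y U s)))) \<and>
     (\<forall>s\<in>carrier (osec Y U).
        localization_at (osec Y U) (osec Y (basic_open Y U s)) (ores Y U (basic_open Y U s)) s)"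

definition is_scheme :: "'a scheme \<Rightarrow> bool" where
  "is_scheme Y \<longleftrightarrow> is_ringed_space Y \<and> (\<forall>y\<in>topspace (stop Y). \<exists>U. affine_open Y U \<and> y \<in> U)"

definition noetherian_scheme :: "'a scheme \<Rightarrow> bool" where
  "noetherian_scheme Y \<longleftrightarrow> is_scheme Y \<and>
     (\<exists>\<U>. finite \<U> \<and> \<Union>\<U> = topspace (stop Y) \<and>
        (\<forall>U\<in>\<U>. affine_open Y U \<and> noetherian_ring (osec Y U)))"

text \<open>The diagonal of \<open>Y\<close> over \<open>Spec \<int>\<close> is a closed immersion, checked on the affine open
  cover of \<open>Y \<times> Y\<close> by the products \<open>U \<times> V\<close>, whose inverse images are the \<open>U \<inter> V\<close>.\<close>

definition separated_scheme :: "'a scheme \<Rightarrow> bool" where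
  "separated_scheme Y \<longleftrightarrow> is_scheme Y \<and>
     (\<forall>U V. affine_open Y U \<and> affine_open Y V \<longrightarrow> affine_open Y (U \<inter> V) \<and>
        (\<forall>s\<in>carrier (osec Y (U \<inter> V)). \<exists>k::nat. \<exists>a b.
           (\<forall>i<k. a i \<in> carrier (osec Y U) \<and> b i \<in> carrier (osec Y V)) \<and>
           s = finsum (osec Y (U \<inter> V))
             (\<lambda>i. ores Y U (U \<inter> V) (a i) \<otimes>\<^bsub>osec Y (U \<inter> V)\<^esub> ores Y V (U \<inter> V) (b i)) {..<k}))"

definition reduced_scheme :: "'a scheme \<Rightarrow> bool" where
  "reduced_scheme Y \<longleftrightarrow> is_scheme Y \<and>
     (\<forall>U. openin (stop Y) U \<longrightarrow> (\<forall>s\<in>carrier (osec Y U). \<forall>k::nat.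
        s [^]\<^bsub>osec Y U\<^esub> k = \<zero>\<^bsub>osec Y U\<^esub> \<longrightarrow> s = \<zero>\<^bsub>osec Y U\<^esub>))"

definition irreducible_in :: "'a topology \<Rightarrow> 'a set \<Rightarrow> bool" where
  "irreducible_in T S \<longleftrightarrow> S \<subseteq> topspace T \<and> S \<noteq> {} \<and>
     (\<forall>C D. closedin T C \<and> closedin T D \<and> S \<subseteq> C \<union> D \<longrightarrow> S \<subseteq> C \<or> S \<subseteq> D)"

definition space_krull_dim :: "'a topology \<Rightarrow> enat" where
  "space_krull_dim T = (SUP k\<in>{k. \<exists>Z. (\<forall>i\<le>k. closedin T (Z i) \<and> irreducible_in T (Z i)) \<and>
     (\<forall>i<k. Z i \<subset> Z (Suc i))}. enat k)"

text \<open>For a closed subset \<open>Z\<close>: the generic points of the irreducible components of \<open>Z\<close>.\<close>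

definition generic_points :: "'a topology \<Rightarrow> 'a set \<Rightarrow> 'a set" where
  "generic_points T Z = {z \<in> Z. \<forall>S. irreducible_in T S \<and> T closure_of {z} \<subseteq> S \<and> S \<subseteq> Z \<longrightarrow>
     S = T closure_of {z}}"

text \<open>The local ring \<open>\<O>\<^sub>Y\<^sub>,\<^sub>y\<close>, its elements being the germs, i.e. classes of pairs of an open
  neighbourhood and a section over it.\<close>

definition germ :: "'a scheme \<Rightarrow> 'a \<Rightarrow> 'a set \<Rightarrow> 'a \<Rightarrow> ('a set \<times> 'a) set" where
  "germ Y y U s = {(V, t). openin (stop Y) V \<and> y \<in> V \<and> t \<in> carrier (osec Y V) \<and>
     (\<exists>W. openin (stop Y) W \<and> y \<in> W \<and> W \<subseteq> U \<inter> V \<and> ores Y U W s = ores Y V W t)}"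

definition germ_op ::
  "'a scheme \<Rightarrow> 'a \<Rightarrow> ('a set \<Rightarrow> 'a \<Rightarrow> 'a \<Rightarrow> 'a) \<Rightarrow> ('a set \<times> 'a) set \<Rightarrow> ('a set \<times> 'a) set \<Rightarrow> ('a set \<times> 'a) set"
  where
  "germ_op Y y opr p q = (THE r. \<exists>U s t. openin (stop Y) U \<and> y \<in> U \<and>
     s \<in> carrier (osec Y U) \<and> t \<in> carrier (osec Y U) \<and>
     p = germ Y y U s \<and> q = germ Y y U t \<and> r = germ Y y U (opr U s t))"

definition stalk :: "'a scheme \<Rightarrow> 'a \<Rightarrow> ('a set \<times> 'a) set ring" where
  "stalk Y y =
     \<lparr>carrier = {germ Y y U s | U s. openin (stop Y) U \<and> y \<in> U \<and> s \<in> carrier (osec Y U)},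
      monoid.mult = germ_op Y y (\<lambda>U s t. s \<otimes>\<^bsub>osec Y U\<^esub> t),
      one = germ Y y (topspace (stop Y)) \<one>\<^bsub>osec Y (topspace (stop Y))\<^esub>,
      zero = germ Y y (topspace (stop Y)) \<zero>\<^bsub>osec Y (topspace (stop Y))\<^esub>,
      add = germ_op Y y (\<lambda>U s t. s \<oplus>\<^bsub>osec Y U\<^esub> t)\<rparr>"

definition codim :: "'a scheme \<Rightarrow> 'a set \<Rightarrow> enat" where
  "codim Y Z = (INF z\<in>generic_points (stop Y) Z. ring_krull_dim (stalk Y z))"

text \<open>Morphisms \<open>Y \<rightarrow> Z\<close>: a map on points and, for \<open>V\<close> open in \<open>Z\<close>, the pull-back of sections
  over \<open>V\<close>; both normalized to be \<open>undefined\<close> outside their domains.\<close>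

record 'a smor =
  mpt :: "'a \<Rightarrow> 'a"
  mpb :: "'a set \<Rightarrow> 'a \<Rightarrow> 'a"

definition preim :: "'a scheme \<Rightarrow> 'a smor \<Rightarrow> 'a set \<Rightarrow> 'a set" where
  "preim Y f V = {y \<in> topspace (stop Y). mpt f y \<in> V}"

definition is_mor :: "'a scheme \<Rightarrow> 'a scheme \<Rightarrow> 'a smor \<Rightarrow> bool" where
  "is_mor Y Z f \<longleftrightarrow>
     mpt f \<in> topspace (stop Y) \<rightarrow>\<^sub>E topspace (stop Z) \<and> continuous_map (stop Y) (stop Z) (mpt f) \<and>
     (\<forall>V. openin (stop Z) V \<longrightarrow>
        mpb f V \<in> ring_hom (osec Z V) (osec Y (preim Y f V)) \<inter> extensional (carrier (osec Z V))) \<and>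
     (\<forall>V. \<not> openin (stop Z) V \<longrightarrow> mpb f V = undefined) \<and>
     (\<forall>V W. openin (stop Z) V \<and> openin (stop Z) W \<and> W \<subseteq> V \<longrightarrow>
        (\<forall>s\<in>carrier (osec Z V).
           mpb f W (ores Z V W s) = ores Y (preim Y f V) (preim Y f W) (mpb f V s))) \<and>
     (\<forall>V. openin (stop Z) V \<longrightarrow> (\<forall>y\<in>preim Y f V. \<forall>s\<in>vanishing Z V (mpt f y).
        mpb f V s \<in> vanishing Y (preim Y f V) y))"

definition mor_id :: "'a scheme \<Rightarrow> 'a smor" where
  "mor_id Y = \<lparr>mpt = restrict (\<lambda>y. y) (topspace (stop Y)),
     mpb = (\<lambda>V. if openin (stop Y) V then restrict (\<lambda>s. s) (carrier (osec Y V)) else undefined)\<rparr>"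

definition mor_comp :: "'a scheme \<Rightarrow> 'a scheme \<Rightarrow> 'a scheme \<Rightarrow> 'a smor \<Rightarrow> 'a smor \<Rightarrow> 'a smor" where
  "mor_comp Y Z W g f = \<lparr>mpt = compose (topspace (stop Y)) (mpt g) (mpt f),
     mpb = (\<lambda>V. if openin (stop W) V
                then compose (carrier (osec W V)) (mpb f (preim Z g V)) (mpb g V)
                else undefined)\<rparr>"

text \<open>For \<open>U\<close> open in \<open>Y\<close> and \<open>V\<close> open in \<open>Z\<close> with \<open>f(U) \<subseteq> V\<close>: the ring map \<open>\<O>(V) \<rightarrow> \<O>(U)\<close>.\<close>

definition mor_sec :: "'a scheme \<Rightarrow> 'a smor \<Rightarrow> 'a set \<Rightarrow> 'a set \<Rightarrow> 'a \<Rightarrow> 'a" where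
  "mor_sec Y f U V s = ores Y (preim Y f V) U (mpb f V s)"

definition finite_type_mor :: "'a scheme \<Rightarrow> 'a scheme \<Rightarrow> 'a smor \<Rightarrow> bool" where
  "finite_type_mor Y Z f \<longleftrightarrow>
     (\<forall>z\<in>topspace (stop Z). \<exists>V. affine_open Z V \<and> z \<in> V \<and>
        (\<exists>\<U>. finite \<U> \<and> \<Union>\<U> = preim Y f V \<and>
           (\<forall>U\<in>\<U>. affine_open Y U \<and>
              finite_type_alg (osec Z V) (osec Y U) (mor_sec Y f U V))))"

definition smooth_mor :: "'a scheme \<Rightarrow> 'a scheme \<Rightarrow> 'a smor \<Rightarrow> bool" where
  "smooth_mor Y Z f \<longleftrightarrow>
     (\<forall>y\<in>topspace (stop Y). \<exists>U V n c. affine_open Y U \<and> affine_open Z V \<and> y \<in> U \<and>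
        U \<subseteq> preim Y f V \<and> standard_smooth (osec Z V) (osec Y U) (mor_sec Y f U V) n c)"

text \<open>Etale means smooth of relative dimension 0.\<close>

definition etale_mor :: "'a scheme \<Rightarrow> 'a scheme \<Rightarrow> 'a smor \<Rightarrow> bool" where
  "etale_mor Y Z f \<longleftrightarrow>
     (\<forall>y\<in>topspace (stop Y). \<exists>U V n. affine_open Y U \<and> affine_open Z V \<and> y \<in> U \<and>
        U \<subseteq> preim Y f V \<and> standard_smooth (osec Z V) (osec Y U) (mor_sec Y f U V) n n)"

definition open_immersion :: "'a scheme \<Rightarrow> 'a scheme \<Rightarrow> 'a smor \<Rightarrow> bool" where
  "open_immersion Y Z f \<longleftrightarrow> is_mor Y Z f \<and> embedding_map (stop Y) (stop Z) (mpt f) \<and>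
     openin (stop Z) (mpt f ` topspace (stop Y)) \<and>
     (\<forall>V. openin (stop Z) V \<and> V \<subseteq> mpt f ` topspace (stop Y) \<longrightarrow>
        mpb f V \<in> ring_iso (osec Z V) (osec Y (preim Y f V)))"

text \<open>The last condition: \<open>\<O>\<^sub>Z \<rightarrow> f\<^sub>*\<O>\<^sub>Y\<close> is surjective as a map of sheaves.\<close>

definition closed_immersion :: "'a scheme \<Rightarrow> 'a scheme \<Rightarrow> 'a smor \<Rightarrow> bool" where
  "closed_immersion Y Z f \<longleftrightarrow> is_mor Y Z f \<and> embedding_map (stop Y) (stop Z) (mpt f) \<and>
     closedin (stop Z) (mpt f ` topspace (stop Y)) \<and>
     (\<forall>V z. openin (stop Z) V \<and> z \<in> V \<longrightarrow> (\<forall>s\<in>carrier (osec Y (preim Y f V)).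
        \<exists>W t. openin (stop Z) W \<and> z \<in> W \<and> W \<subseteq> V \<and> t \<in> carrier (osec Z W) \<and>
          mpb f W t = ores Y (preim Y f V) (preim Y f W) s))"

text \<open>The extension of residue fields at \<open>y\<close> is an isomorphism; as it is injective, this means
  that each germ at \<open>y\<close> is, modulo the maximal ideal, the pull-back of a germ at \<open>f(y)\<close>.\<close>

definition residue_iso :: "'a scheme \<Rightarrow> 'a scheme \<Rightarrow> 'a smor \<Rightarrow> 'a \<Rightarrow> bool" where
  "residue_iso Y Z f y \<longleftrightarrow>
     (\<forall>U s. openin (stop Y) U \<and> y \<in> U \<and> s \<in> carrier (osec Y U) \<longrightarrow>
        (\<exists>V t. openin (stop Z) V \<and> mpt f y \<in> V \<and> t \<in> carrier (osec Z V) \<and>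
           (let W = U \<inter> preim Y f V in
              ores Y U W s \<ominus>\<^bsub>osec Y W\<^esub> mor_sec Y f W V t \<in> vanishing Y W y)))"


section \<open>Smooth schemes over a base, with the Nisnevich topology\<close>

text \<open>Objects are \<open>X\<close>-schemes, i.e. pairs of a scheme and its structure morphism. Points and
  sections are taken from the type \<open>'a\<close> of those of the base; when \<open>'a\<close> is infinite and \<open>X\<close>
  noetherian, every \<open>X\<close>-scheme of finite type has, up to isomorphism, this form.\<close>

type_synonym 'a sm_ob = "'a scheme \<times> 'a smor"
type_synonym 'a sm_ar = "'a sm_ob \<times> 'a sm_ob \<times> 'a smor"

definition Sm :: "'a scheme \<Rightarrow> ('a sm_ob, 'a sm_ar) cat" where
  "Sm X = (let obs = {(Y, p). is_scheme Y \<and> is_mor Y X p \<and> finite_type_mor Y X p \<and> smooth_mor Y X p}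
     in \<lparr>Ob = obs,
         Ar = {(A, B, f). A \<in> obs \<and> B \<in> obs \<and> is_mor (fst A) (fst B) f \<and>
                 mor_comp (fst A) (fst B) X (snd B) f = snd A},
         src = (\<lambda>(A, B, f). A),
         tgt = (\<lambda>(A, B, f). B),
         idn = (\<lambda>A. (A, A, mor_id (fst A))),
         cmp = (\<lambda>(B', D, g) (A, B, f). (A, D, mor_comp (fst A) (fst B) (fst D) g f))\<rparr>)"

definition nisnevich_cover :: "'a scheme \<Rightarrow> 'a sm_ob \<Rightarrow> 'a sm_ar set \<Rightarrow> bool" where
  "nisnevich_cover X Y R \<longleftrightarrow> Y \<in> Ob (Sm X) \<and>
     (\<forall>(U, V, f)\<in>R. (U, V, f) \<in> Ar (Sm X) \<and> V = Y \<and> etale_mor (fst U) (fst Y) f) \<and>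
     (\<forall>y\<in>topspace (stop (fst Y)). \<exists>(U, V, f)\<in>R. \<exists>u\<in>topspace (stop (fst U)).
        mpt f u = y \<and> residue_iso (fst U) (fst Y) f u)"

text \<open>The projections \<open>\<A>\<^sup>1\<^sub>Y \<rightarrow> Y\<close>, characterized by the universal property that a morphism
  \<open>T \<rightarrow> \<A>\<^sup>1\<^sub>Y\<close> over \<open>Y\<close> is the same as a global function on \<open>T\<close>, the pull-back of the coordinate \<open>t\<close>.\<close>

definition affine_line_projections :: "'a scheme \<Rightarrow> 'a sm_ar set" where
  "affine_line_projections X = {p \<in> Ar (Sm X).
     (let gs = (\<lambda>T :: 'a sm_ob. topspace (stop (fst T))); L = src (Sm X) p in
      \<exists>t\<in>carrier (osec (fst L) (gs L)).
        \<forall>g\<in>Ar (Sm X). tgt (Sm X) g = tgt (Sm X) p \<longrightarrow>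
          (\<forall>s\<in>carrier (osec (fst (src (Sm X) g)) (gs (src (Sm X) g))).
             \<exists>!h. in_hom (Sm X) (src (Sm X) g) L h \<and> cmp (Sm X) p h = g \<and>
               mpb (snd (snd h)) (gs L) t = s))}"

text \<open>The category \<open>\<M>\<close>; its presheaves take values in subsets of the type \<open>'u\<close>.\<close>

definition motivic ::
  "'a scheme \<Rightarrow> (('a sm_ob, 'a sm_ar, 'u) psp, ('a sm_ob, 'a sm_ar, 'u) psp_ar) model" where
  "motivic X = motivic_model (Sm X) (nisnevich_cover X) (affine_line_projections X)"

text \<open>The presheaf \<open>Y\<^sub>+\<close> represented by \<open>Y\<close>, with a disjoint base point, discrete in the simplicial
  direction. The injection \<open>e\<close> codes arrows \<open>f\<close> (as \<open>Some f\<close>) and the base point (as \<open>None\<close>) by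
  elements of \<open>'u\<close>.\<close>

definition plus ::
  "('m option \<Rightarrow> 'u) \<Rightarrow> ('o, 'm, 'z) cat_scheme \<Rightarrow> 'o \<Rightarrow> ('o, 'm, 'u) psp" where
  "plus e C Y =
     \<lparr>sect = (\<lambda>V. \<lparr>simp = (\<lambda>n. insert (e None) {e (Some f) | f. in_hom C V Y f}),
                   sact = (\<lambda>m n \<theta> x. x)\<rparr>),
      rstr = (\<lambda>g n x. e (map_option (\<lambda>f. cmp C f g) (the_inv e x))),
      bpt = (\<lambda>V. e None)\<rparr>"

definition plus_map ::
  "('m option \<Rightarrow> 'u) \<Rightarrow> ('o, 'm, 'z) cat_scheme \<Rightarrow> 'm \<Rightarrow> ('o, 'm, 'u) psp_ar" where
  "plus_map e C j = (plus e C (src C j), plus e C (tgt C j),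
     restrict (\<lambda>V n. restrict (\<lambda>x. e (map_option (cmp C j) (the_inv e x)))
       (simp (sect (plus e C (src C j)) V) n)) (Ob C))"

definition B_set ::
  "'a scheme \<Rightarrow> ('a sm_ar option \<Rightarrow> 'u) \<Rightarrow> nat \<Rightarrow> ('a sm_ob, 'a sm_ar, 'u) psp_ar set" where
  "B_set X e n = {plus_map e (Sm X) (U, Y, j) | U Y j. (U, Y, j) \<in> Ar (Sm X) \<and>
     open_immersion (fst U) (fst Y) j \<and>
     irreducible_in (stop (fst Y)) (topspace (stop (fst Y))) \<and>
     codim (fst Y) (topspace (stop (fst Y)) - mpt j ` topspace (stop (fst U))) \<ge> enat (n + 1)}"

text \<open>The complement, with its reduced structure, is given as a reduced closed subscheme.\<close>

definition WB_set ::
  "'a scheme \<Rightarrow> ('a sm_ar option \<Rightarrow> 'u) \<Rightarrow> nat \<Rightarrow> ('a sm_ob, 'a sm_ar, 'u) psp_ar set" where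
  "WB_set X e n = {plus_map e (Sm X) (U, Y, j) | U Y j. (U, Y, j) \<in> Ar (Sm X) \<and>
     open_immersion (fst U) (fst Y) j \<and>
     irreducible_in (stop (fst Y)) (topspace (stop (fst Y))) \<and>
     (\<exists>Z i. (Z, Y, i) \<in> Ar (Sm X) \<and> closed_immersion (fst Z) (fst Y) i \<and> reduced_scheme (fst Z) \<and>
        mpt i ` topspace (stop (fst Z))
          = topspace (stop (fst Y)) - mpt j ` topspace (stop (fst U))) \<and>
     codim (fst Y) (topspace (stop (fst Y)) - mpt j ` topspace (stop (fst U))) \<ge> enat (n + 1)}"

definition BM ::
  "'a scheme \<Rightarrow> ('a sm_ar option \<Rightarrow> 'u) \<Rightarrow> nat \<Rightarrow>
   (('a sm_ob, 'a sm_ar, 'u) psp, ('a sm_ob, 'a sm_ar, 'u) psp_ar) model" where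
  "BM X e n = left_bousfield (Sm X) (motivic X) (B_set X e n)"

definition WBM ::
  "'a scheme \<Rightarrow> ('a sm_ar option \<Rightarrow> 'u) \<Rightarrow> nat \<Rightarrow>
   (('a sm_ob, 'a sm_ar, 'u) psp, ('a sm_ob, 'a sm_ar, 'u) psp_ar) model" where
  "WBM X e n = left_bousfield (Sm X) (motivic X) (WB_set X e n)"

end

theory Submission
  imports Defs
begin

text \<open>Let \<open>M\<close> and \<open>N\<close> be model structures on one category with the same cofibrations, such that
  trivial cofibrations of \<open>M\<close> are weak equivalences of \<open>N\<close>. Trivial fibrations, being determined
  by the cofibrations, coincide, so that factorization gives \<open>weq M \<subseteq> weq N\<close>. A weak equivalence
  of \<open>N\<close> between \<open>N\<close>-fibrant objects lies in \<open>weq M\<close>: up to a common trivial fibration it is a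
  trivial cofibration of \<open>N\<close>, which has a retraction and is thus a homotopy equivalence with respect
  to a path object whose end point maps are trivial fibrations. Hence a fibrant replacement in
  \<open>N\<close> induces a functor \<open>Ho N \<rightarrow> Ho M\<close>, and the triangle identities follow from the naturality of
  \<open>\<eta>\<close> on zigzags. For \<open>N\<close> a Bousfield localization of the motivic structure \<open>M\<close>, the condition
  on trivial cofibrations is SM7 applied to the fibrations \<open>Z \<rightarrow> *\<close>; between two localizations,
  it holds as the sets of localized maps decrease with \<open>n\<close>.\<close>

section \<open>Localizations of categories\<close>

text \<open>The category axioms enter for empty \<open>u\<close>: the right side then asks for
  \<open>a \<in> Ob C\<close>, which a nonempty \<open>v\<close> gives only because ends of arrows
  are objects.\<close>

lemma zpath_append:
  "zpath C W a c (u @ v) \<longleftrightarrow> (\<exists>b. zpath C W a b u \<and> zpath C W b c v)" if "is_category C"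
proof (induction u arbitrary: a)
  case Nil
  have "zpath C W a c v \<Longrightarrow> a \<in> Ob C"
    using that by (induction C W a c v rule: zpath.induct) (auto simp: is_category_def)
  then show ?case by auto
next
  case (Cons s u)
  then show ?case by (cases s) auto
qed

lemma zpath_appendI:
  "is_category C \<Longrightarrow> zpath C W a b u \<Longrightarrow> zpath C W b c v \<Longrightarrow> zpath C W a c (u @ v)"
  by (auto simp: zpath_append)

lemma zpath_ends:
  assumes "is_category C" "zpath C W a b u" shows "a \<in> Ob C" "b \<in> Ob C"
  using assms(2,1) by (induction C W a b u rule: zpath.induct) (auto simp: is_category_def)

lemma zeq_zpath:
  assumes "zeq C W a b u v" "is_category C"
  shows "zpath C W a b u \<and> zpath C W a b v"
  using assms
proof (induction rule: zeq.induct)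
  case (zcong a b u c v v' d w)
  then show ?case by (auto intro!: zpath_appendI)
qed (auto simp: is_category_def in_hom_def)

text \<open>\<open>zcong\<close> rewrites one inner segment at a time, so \<open>u\<close> is
  replaced first and \<open>v\<close> afterwards. This is what makes composition of classes well
  defined.\<close>

lemma zeq_append:
  assumes "is_category C" "zeq C W a b u u'" "zeq C W b c v v'"
  shows "zeq C W a c (u @ v) (u' @ v')"
proof -
  note z = zeq_zpath[OF assms(2,1)] zeq_zpath[OF assms(3,1)]
  note e = zpath_ends[OF assms(1)]
  have "zeq C W a c ([] @ u @ v) ([] @ u' @ v)"
    using z e assms by (intro zcong) auto
  moreover have "zeq C W a c (u' @ v @ []) (u' @ v' @ [])"
    using z e assms by (intro zcong) auto
  ultimately show ?thesis by (auto intro: ztrans)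
qed

text \<open>Reduces equations between arrows of a localization to rewriting of zigzags. That
  \<open>v\<close> is a zigzag gives reflexivity; otherwise both classes could be empty.\<close>

lemma zclass_eq_iff:
  assumes "zpath C W a b v"
  shows "zclass C W a b u = zclass C W a b v \<longleftrightarrow> zeq C W a b u v"
proof
  assume "zclass C W a b u = zclass C W a b v"
  then have "{w. zeq C W a b u w} = {w. zeq C W a b v w}" by (simp add: zclass_def)
  with zrefl[OF assms] show "zeq C W a b u v" by blast
qed (auto simp: zclass_def intro: ztrans zsym)

lemma localization_simps:
  "Ob (localization C W) = Ob C"
  "idn (localization C W) a = zclass C W a a []"
  "src (localization C W) (zclass C W a b u) = a"
  "tgt (localization C W) (zclass C W a b u) = b"
  by (auto simp: localization_def zclass_def)

lemma localization_Ar: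
  "x \<in> Ar (localization C W) \<longleftrightarrow> (\<exists>a b u. x = zclass C W a b u \<and> zpath C W a b u)"
  by (auto simp: localization_def)

lemma localization_in_hom:
  "zpath C W a b u \<Longrightarrow> in_hom (localization C W) a b (zclass C W a b u)"
  by (auto simp: in_hom_def localization_Ar localization_simps)

text \<open>The definition ranges over all pairs of representatives; by \<open>zeq_append\<close>
  each pair gives the same class.\<close>

lemma localization_cmp:
  assumes "is_category C" "zpath C W a b u" "zpath C W b c v"
  shows "cmp (localization C W) (zclass C W b c v) (zclass C W a b u) = zclass C W a c (u @ v)"
proof -
  have "(\<exists>u'. zeq C W a b u u' \<and> (\<exists>v'. zeq C W b c v v' \<and> zeq C W a c (u' @ v') w))
      \<longleftrightarrow> zeq C W a c (u @ v) w" for w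
    using assms by (meson zeq_append zrefl ztrans)
  then show ?thesis by (simp add: localization_def zclass_def)
qed

lemma is_category_localization:
  assumes "is_category C" shows "is_category (localization C W)"
proof -
  let ?L = "localization C W"
  note s = localization_simps localization_in_hom localization_cmp[OF assms]
  have nil: "zpath C W a a []" if "a \<in> Ob C" for a using that by simp
  show ?thesis
    unfolding is_category_def
  proof (intro conjI ballI impI)
    fix f assume "f \<in> Ar ?L"
    then obtain a b u where f: "f = zclass C W a b u" "zpath C W a b u"
      by (auto simp: localization_Ar)
    note e = zpath_ends[OF assms f(2)]
    show "src ?L f \<in> Ob ?L" "tgt ?L f \<in> Ob ?L" using e by (auto simp: f s)
    show "cmp ?L f (idn ?L (src ?L f)) = f" using s(6)[OF nil[OF e(1)] f(2)] by (simp add: f s)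
    show "cmp ?L (idn ?L (tgt ?L f)) f = f" using s(6)[OF f(2) nil[OF e(2)]] by (simp add: f s)
    fix g assume "g \<in> Ar ?L" and fg: "tgt ?L f = src ?L g"
    then obtain c v where g: "g = zclass C W b c v" "zpath C W b c v"
      by (auto simp: localization_Ar f s)
    show "in_hom ?L (src ?L f) (tgt ?L g) (cmp ?L g f)"
      using zpath_appendI[OF assms f(2) g(2)] f(2) g(2) by (simp add: f(1) g(1) s)
  next
    fix f g h assume "f \<in> Ar ?L" "g \<in> Ar ?L" "h \<in> Ar ?L" "tgt ?L f = src ?L g \<and> tgt ?L g = src ?L h"
    then obtain a b c d u v w where
      f: "f = zclass C W a b u" "zpath C W a b u" and g: "g = zclass C W b c v" "zpath C W b c v"
      and h: "h = zclass C W c d w" "zpath C W c d w"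
      by (auto simp: localization_Ar s)
    show "cmp ?L h (cmp ?L g f) = cmp ?L (cmp ?L h g) f"
      using zpath_appendI[OF assms f(2) g(2)] zpath_appendI[OF assms g(2) h(2)] f(2) g(2) h(2)
      by (simp add: f(1) g(1) h(1) s)
  qed (auto simp: s)
qed

section \<open>Functors induced on localizations\<close>

lemma zpath_map:
  assumes "is_functor C D F" "far F ` (W \<inter> Ar C) \<subseteq> W'" "zpath C W a b u"
  shows "zpath D W' (fob F a) (fob F b) (map (map_zstep (far F)) u)"
  using assms(3,1,2)
  by (induction C W a b u rule: zpath.induct) (auto simp: is_functor_def in_hom_def)

text \<open>Each generating relation is carried to a relation of the same kind; the two inversion
  relations use that \<open>F\<close> sends \<open>W\<close> into \<open>W'\<close>.\<close>

lemma zeq_map: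
  assumes "zeq C W a b u v" "is_functor C D F" "far F ` (W \<inter> Ar C) \<subseteq> W'"
  shows "zeq D W' (fob F a) (fob F b) (map (map_zstep (far F)) u) (map (map_zstep (far F)) v)"
  using assms
proof (induction rule: zeq.induct)
  case (zcong a b u c v v' d w)
  then show ?case by (auto intro!: zeq.zcong intro: zpath_map)
next
  case (zcmp f g)
  have *: "far F f \<in> Ar D" "far F g \<in> Ar D" "tgt D (far F f) = src D (far F g)"
    "src D (far F f) = fob F (src C f)" "tgt D (far F g) = fob F (tgt C g)"
    "far F (cmp C g f) = cmp D (far F g) (far F f)"
    using zcmp by (auto simp: is_functor_def in_hom_def)
  show ?case using zeq.zcmp[OF *(1-3), of W'] * by simp
next
  case (zid a)
  then show ?case using zeq.zid[of "fob F a" D W'] by (auto simp: is_functor_def)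
next
  case (zinv1 w)
  then have "src D (far F w) = fob F (src C w)" "far F w \<in> W'" "far F w \<in> Ar D"
    by (auto simp: is_functor_def in_hom_def)
  then show ?case using zeq.zinv1[of "far F w" W' D] by simp
next
  case (zinv2 w)
  then have "tgt D (far F w) = fob F (tgt C w)" "far F w \<in> W'" "far F w \<in> Ar D"
    by (auto simp: is_functor_def in_hom_def)
  then show ?case using zeq.zinv2[of "far F w" W' D] by simp
qed (auto intro: zpath_map zeq.intros)

lemma ho_map_fob [simp]: "fob (ho_map N F) = fob F"
  by (simp add: ho_map_def)

lemma ho_map_zclass:
  assumes "is_functor M N F" "far F ` (weq M \<inter> Ar M) \<subseteq> weq N" "zpath M (weq M) a b u"
  shows "far (ho_map N F) (zclass M (weq M) a b u) =
    zclass N (weq N) (fob F a) (fob F b) (map (map_zstep (far F)) u)"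
proof -
  have "(\<exists>u'. zeq M (weq M) a b u u' \<and>
        zeq N (weq N) (fob F a) (fob F b) (map (map_zstep (far F)) u') w) \<longleftrightarrow>
      zeq N (weq N) (fob F a) (fob F b) (map (map_zstep (far F)) u) w" for w
    by (meson assms zeq_map zrefl ztrans)
  then show ?thesis by (simp add: ho_map_def zclass_def)
qed

lemma Ho_simps:
  "Ob (Ho M) = Ob M"
  "idn (Ho M) a = zclass M (weq M) a a []"
  "src (Ho M) (zclass M (weq M) a b u) = a"
  "tgt (Ho M) (zclass M (weq M) a b u) = b"
  by (auto simp: Ho_def localization_simps)

lemma Ho_Ar:
  "x \<in> Ar (Ho M) \<longleftrightarrow> (\<exists>a b u. x = zclass M (weq M) a b u \<and> zpath M (weq M) a b u)"
  by (simp add: Ho_def localization_Ar)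

lemma Ho_in_hom: "zpath M (weq M) a b u \<Longrightarrow> in_hom (Ho M) a b (zclass M (weq M) a b u)"
  by (simp add: Ho_def localization_in_hom)

lemma Ho_cmp:
  assumes "is_category M" "zpath M (weq M) a b u" "zpath M (weq M) b c v"
  shows "cmp (Ho M) (zclass M (weq M) b c v) (zclass M (weq M) a b u) = zclass M (weq M) a c (u @ v)"
  using localization_cmp[OF assms] by (simp add: Ho_def)

text \<open>Once \<open>ho_map\<close> can be computed on representatives, functoriality says that
  \<open>map\<close> respects concatenation, and the square with \<open>ho_proj\<close> is the case
  of zigzags of length one.\<close>

lemma induced_on_Ho:
  assumes F: "is_functor M N F" and W: "far F ` (weq M \<inter> Ar M) \<subseteq> weq N"
  shows "induced_on_Ho M N F"
proof -
  have cat: "is_category M" "is_category N" using F by (auto simp: is_functor_def)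
  note m = ho_map_zclass[OF F W] and p = zpath_map[OF F W]
  note s = Ho_simps Ho_in_hom Ho_cmp[OF cat(1)] Ho_cmp[OF cat(2)]
  have "is_functor (Ho M) (Ho N) (ho_map N F)"
    unfolding is_functor_def
  proof (intro conjI ballI impI)
    show "is_category (Ho M)" "is_category (Ho N)"
      using cat by (auto simp: Ho_def is_category_localization)
    fix a assume "a \<in> Ob (Ho M)"
    then show "fob (ho_map N F) a \<in> Ob (Ho N)"
      and "far (ho_map N F) (idn (Ho M) a) = idn (Ho N) (fob (ho_map N F) a)"
      using F m[of a a "[]"] by (auto simp: s is_functor_def)
  next
    fix f assume "f \<in> Ar (Ho M)"
    then obtain a b u where f: "f = zclass M (weq M) a b u" "zpath M (weq M) a b u"
      by (auto simp: Ho_Ar)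
    show "in_hom (Ho N) (fob (ho_map N F) (src (Ho M) f)) (fob (ho_map N F) (tgt (Ho M) f))
        (far (ho_map N F) f)"
      using f(2) by (simp add: f(1) s m p)
    fix g assume "g \<in> Ar (Ho M)" "tgt (Ho M) f = src (Ho M) g"
    then obtain c v where g: "g = zclass M (weq M) b c v" "zpath M (weq M) b c v"
      by (auto simp: Ho_Ar f s)
    show "far (ho_map N F) (cmp (Ho M) g f) =
        cmp (Ho N) (far (ho_map N F) g) (far (ho_map N F) f)"
      using f(2) g(2) zpath_appendI[OF cat(1) f(2) g(2)] p[OF f(2)] p[OF g(2)]
      by (simp add: f(1) g(1) s m)
  qed
  moreover have "far (ho_map N F) (far (ho_proj M) f) = far (ho_proj N) (far F f)" if "f \<in> Ar M" for f
  proof -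
    have "zpath M (weq M) (src M f) (tgt M f) [Fwd f]"
      using that cat(1) by (auto simp: is_category_def)
    moreover have "src N (far F f) = fob F (src M f)" "tgt N (far F f) = fob F (tgt M f)"
      using that F by (auto simp: is_functor_def in_hom_def)
    ultimately show ?thesis by (simp add: ho_proj_def m)
  qed
  ultimately show ?thesis
    by (auto simp: induced_on_Ho_def functor_eq_def comp_func_def ho_proj_def)
qed


section \<open>Model structures with the same cofibrations\<close>

text \<open>The axioms in \<open>in_hom\<close> form, so that sources and targets are matched by
  resolution. They are cited by position below: (2) is composition, (4) and (5) are the unit laws,
  (6) is associativity.\<close>

lemma category_rules:
  assumes "is_category C"
  shows hom_idn: "A \<in> Ob C \<Longrightarrow> in_hom C A A (idn C A)"
    and hom_cmp: "in_hom C A B f \<Longrightarrow> in_hom C B D g \<Longrightarrow> in_hom C A D (cmp C g f)"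
    and hom_Ob: "in_hom C A B f \<Longrightarrow> A \<in> Ob C \<and> B \<in> Ob C"
    and idn_right: "in_hom C A B f \<Longrightarrow> cmp C f (idn C A) = f"
    and idn_left: "in_hom C A B f \<Longrightarrow> cmp C (idn C B) f = f"
    and cmp_assoc: "in_hom C A B f \<Longrightarrow> in_hom C B D g \<Longrightarrow> in_hom C D E h \<Longrightarrow>
      cmp C (cmp C h g) f = cmp C h (cmp C g f)"
  using assms by (auto simp: is_category_def in_hom_def)

lemma hom_Ar: "f \<in> Ar C \<Longrightarrow> in_hom C (src C f) (tgt C f) f"
  by (simp add: in_hom_def)

lemma has_liftD:
  assumes "has_lift C i p" "in_hom C A B i" "in_hom C X Y p" "in_hom C A X u" "in_hom C B Y v"
    "cmp C p u = cmp C v i"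
  obtains h where "in_hom C B X h" "cmp C h i = u" "cmp C p h = v"
proof -
  have i: "tgt C i = B" and p: "src C p = X" and uv: "u \<in> Ar C" "v \<in> Ar C"
    and *: "src C u = src C i \<and> tgt C u = src C p \<and> src C v = tgt C i \<and> tgt C v = tgt C p \<and>
      cmp C p u = cmp C v i"
    using assms(2-) by (simp_all add: in_hom_def)
  from assms(1)[unfolded has_lift_def, THEN bspec, OF uv(1), THEN bspec, OF uv(2), THEN mp, OF *]
  show ?thesis using that by (auto simp: i p)
qed

lemma has_liftI:
  assumes "in_hom C A B i" "in_hom C X Y p"
    and "\<And>u v. in_hom C A X u \<Longrightarrow> in_hom C B Y v \<Longrightarrow> cmp C p u = cmp C v i \<Longrightarrow>
      \<exists>h. in_hom C B X h \<and> cmp C h i = u \<and> cmp C p h = v"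
  shows "has_lift C i p"
  unfolding has_lift_def using assms by (auto simp: in_hom_def)

text \<open>A lift in the square with the identity of \<open>A\<close> on top and \<open>q\<close>
  at the bottom is a retraction of \<open>j\<close> over \<open>D\<close>.\<close>

lemma retract_argument:
  assumes "is_category C" and j: "in_hom C A B j" and q: "in_hom C B D q"
    and lift: "has_lift C j (cmp C q j)"
  shows "is_retract C (cmp C q j) q"
proof -
  note c = category_rules[OF assms(1)]
  have p: "in_hom C A D (cmp C q j)" using c(2)[OF j q] .
  have Ob: "A \<in> Ob C" "D \<in> Ob C" using c(3)[OF p] by auto
  obtain h where h: "in_hom C B A h" "cmp C h j = idn C A" "cmp C (cmp C q j) h = q"
    using has_liftD[OF lift j p c(1)[OF Ob(1)] q] c(4)[OF p] by auto
  show ?thesis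
    unfolding is_retract_def
    using p q j h c(1)[OF Ob(2)] c(4,5)[OF c(1)[OF Ob(2)]] c(5)[OF p] c(5)[OF q]
    by (intro conjI exI[of _ j] exI[of _ h] exI[of _ "idn C D"]) (auto simp: in_hom_def)
qed

text \<open>Cited by position below: (5) to (7) are two out of three, (8) and (9) closure under
  retracts, (10) and (11) the lifting axioms.\<close>

lemma model_category_rules:
  assumes "model_category M"
  shows model_is_category: "is_category M"
    and cof_Ar: "i \<in> cof M \<Longrightarrow> i \<in> Ar M" and fib_Ar: "i \<in> fib M \<Longrightarrow> i \<in> Ar M"
    and weq_Ar: "i \<in> weq M \<Longrightarrow> i \<in> Ar M"
    and weq_cmp: "in_hom M A B f \<Longrightarrow> in_hom M B D g \<Longrightarrow> f \<in> weq M \<Longrightarrow> g \<in> weq M \<Longrightarrow> cmp M g f \<in> weq M"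
    and weq_cancel_right: "in_hom M A B f \<Longrightarrow> in_hom M B D g \<Longrightarrow> f \<in> weq M \<Longrightarrow> cmp M g f \<in> weq M \<Longrightarrow> g \<in> weq M"
    and weq_cancel_left: "in_hom M A B f \<Longrightarrow> in_hom M B D g \<Longrightarrow> g \<in> weq M \<Longrightarrow> cmp M g f \<in> weq M \<Longrightarrow> f \<in> weq M"
    and retract_fib: "is_retract M f g \<Longrightarrow> g \<in> fib M \<Longrightarrow> f \<in> fib M"
    and retract_weq: "is_retract M f g \<Longrightarrow> g \<in> weq M \<Longrightarrow> f \<in> weq M"
    and lift_trivial_cof: "i \<in> cof M \<Longrightarrow> i \<in> weq M \<Longrightarrow> p \<in> fib M \<Longrightarrow> has_lift M i p"
    and lift_trivial_fib: "i \<in> cof M \<Longrightarrow> p \<in> fib M \<Longrightarrow> p \<in> weq M \<Longrightarrow> has_lift M i p"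
  using assms by (auto simp: model_category_def in_hom_def)

lemma factor_trivial_cof:
  assumes "model_category M" "in_hom M A B f"
  obtains i p D where "in_hom M A D i" "in_hom M D B p" "f = cmp M p i"
    "i \<in> cof M" "i \<in> weq M" "p \<in> fib M"
proof -
  have "f \<in> Ar M" using assms by (simp add: in_hom_def)
  then obtain i p where *: "i \<in> cof M" "i \<in> weq M" "p \<in> fib M" "tgt M i = src M p" "f = cmp M p i"
    using assms(1) unfolding model_category_def by blast
  then have "i \<in> Ar M" "p \<in> Ar M" using model_category_rules[OF assms(1)] by auto
  then have "in_hom M (src M i) (tgt M p) f" "in_hom M (src M i) (tgt M i) i" "in_hom M (tgt M i) (tgt M p) p"
    using * model_is_category[OF assms(1)] by (auto simp: is_category_def in_hom_def)
  with * assms(2) show ?thesis by (intro that[of "tgt M i" i p]) (auto simp: in_hom_def)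
qed

lemma factor_trivial_fib:
  assumes "model_category M" "in_hom M A B f"
  obtains i p D where "in_hom M A D i" "in_hom M D B p" "f = cmp M p i"
    "i \<in> cof M" "p \<in> fib M" "p \<in> weq M"
proof -
  have "f \<in> Ar M" using assms by (simp add: in_hom_def)
  then obtain i p where *: "i \<in> cof M" "p \<in> weq M" "p \<in> fib M" "tgt M i = src M p" "f = cmp M p i"
    using assms(1) unfolding model_category_def by blast
  then have "i \<in> Ar M" "p \<in> Ar M" using model_category_rules[OF assms(1)] by auto
  then have "in_hom M (src M i) (tgt M p) f" "in_hom M (src M i) (tgt M i) i" "in_hom M (tgt M i) (tgt M p) p"
    using * model_is_category[OF assms(1)] by (auto simp: is_category_def in_hom_def)
  with * assms(2) show ?thesis by (intro that[of "tgt M i" i p]) (auto simp: in_hom_def)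
qed

text \<open>Factor \<open>p\<close> as a trivial cofibration \<open>j\<close> followed by a
  fibration \<open>q\<close>; as \<open>j\<close> lifts against \<open>p\<close>, the retract
  argument makes \<open>p\<close> a retract of \<open>q\<close>.\<close>

lemma fib_lifting:
  assumes M: "model_category M" and p: "in_hom M A B p"
    and lift: "\<And>i. i \<in> cof M \<Longrightarrow> i \<in> weq M \<Longrightarrow> has_lift M i p"
  shows "p \<in> fib M"
proof -
  note m = model_category_rules[OF M]
  obtain j q D where jq: "in_hom M A D j" "in_hom M D B q" "p = cmp M q j"
    "j \<in> cof M" "j \<in> weq M" "q \<in> fib M" using factor_trivial_cof[OF M p] .
  have "is_retract M p q" using retract_argument[OF m(1) jq(1,2)] lift[OF jq(4,5)] jq(3) by simp
  then show ?thesis using m(8) jq(6) by blast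
qed

text \<open>The same argument with the other factorization. It shows that the cofibrations alone
  determine the trivial fibrations.\<close>

lemma trivial_fib_lifting:
  assumes M: "model_category M" and p: "in_hom M A B p"
    and lift: "\<And>i. i \<in> cof M \<Longrightarrow> has_lift M i p"
  shows "p \<in> fib M" "p \<in> weq M"
proof -
  note m = model_category_rules[OF M]
  obtain j q D where jq: "in_hom M A D j" "in_hom M D B q" "p = cmp M q j"
    "j \<in> cof M" "q \<in> fib M" "q \<in> weq M" using factor_trivial_fib[OF M p] .
  have "is_retract M p q" using retract_argument[OF m(1) jq(1,2)] lift[OF jq(4)] jq(3) by simp
  then show "p \<in> fib M" "p \<in> weq M" using m(8)[OF _ jq(5)] m(9)[OF _ jq(6)] by blast+
qed

text \<open>Identities are not mentioned in the axioms for weak equivalences. Every cofibration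
  lifts against an identity, the lower arrow of the square being the filler.\<close>

lemma idn_weq:
  assumes "model_category M" "A \<in> Ob M" shows "idn M A \<in> weq M"
proof (rule trivial_fib_lifting(2)[OF assms(1)])
  note m = model_category_rules[OF assms(1)] and c = category_rules[OF model_is_category[OF assms(1)]]
  show id: "in_hom M A A (idn M A)" using c(1)[OF assms(2)] .
  fix i assume "i \<in> cof M"
  note i = hom_Ar[OF m(2)[OF this]]
  show "has_lift M i (idn M A)"
    using c(5) by (intro has_liftI[OF i id]) metis
qed

section \<open>Closure properties of fibrations\<close>

lemma fib_cmp:
  assumes M: "model_category M" and p: "in_hom M A B p" "p \<in> fib M" and q: "in_hom M B D q" "q \<in> fib M"
  shows "cmp M q p \<in> fib M"
proof (rule fib_lifting[OF M])
  note m = model_category_rules[OF M] and c = category_rules[OF model_is_category[OF M]]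
  show qp: "in_hom M A D (cmp M q p)" using c(2) p q by blast
  fix i assume i: "i \<in> cof M" "i \<in> weq M"
  define X Y where "X = src M i" and "Y = tgt M i"
  have ih: "in_hom M X Y i" using m(2)[OF i(1)] by (simp add: in_hom_def X_def Y_def)
  show "has_lift M i (cmp M q p)"
  proof (rule has_liftI[OF ih qp])
    fix u v assume u: "in_hom M X A u" and v: "in_hom M Y D v" and e: "cmp M (cmp M q p) u = cmp M v i"
    have e': "cmp M q (cmp M p u) = cmp M v i" using e c(6)[OF u p(1) q(1)] by simp
    obtain h where h: "in_hom M Y B h" "cmp M h i = cmp M p u" "cmp M q h = v"
      using has_liftD[OF m(10)[OF i q(2)] ih q(1) c(2)[OF u p(1)] v e'] .
    obtain k where k: "in_hom M Y A k" "cmp M k i = u" "cmp M p k = h"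
      using has_liftD[OF m(10)[OF i p(2)] ih p(1) u h(1)] h(2) by metis
    show "\<exists>h. in_hom M Y A h \<and> cmp M h i = u \<and> cmp M (cmp M q p) h = v"
      using k h c(6)[OF k(1) p(1) q(1)] by auto
  qed
qed

lemma is_pullback_homs:
  assumes "is_pullback C p q f g" "in_hom C A D f" "in_hom C B D g"
  shows "in_hom C (src C p) A p" "in_hom C (src C p) B q" "cmp C f p = cmp C g q"
  using assms by (auto simp: is_pullback_def in_hom_def)

lemma is_pullback_ex1:
  assumes "is_pullback C p q f g" "in_hom C A D f" "in_hom C B D g"
    "in_hom C X A u" "in_hom C X B v" "cmp C f u = cmp C g v"
  shows "\<exists>!h. in_hom C X (src C p) h \<and> cmp C p h = u \<and> cmp C q h = v"
proof -
  have X: "src C u = X" and "u \<in> Ar C" "v \<in> Ar C"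
    "src C u = src C v \<and> tgt C u = src C f \<and> tgt C v = src C g \<and> cmp C f u = cmp C g v"
    using assms(2-) by (auto simp: in_hom_def)
  with assms(1) show ?thesis unfolding is_pullback_def X[symmetric] by blast
qed

lemma is_pullback_commute: "is_pullback C p q f g \<Longrightarrow> is_pullback C q p g f"
  unfolding is_pullback_def by (simp add: conj_ac eq_commute[of "tgt C f"] insert_commute) metis

text \<open>A filler \<open>k\<close> for the outer square against \<open>g\<close> and the given
  arrow \<open>v\<close> are glued to \<open>l\<close> by the universal property; the triangle
  \<open>l i = u\<close> is the uniqueness part of that property.\<close>

lemma fib_pullback:
  assumes M: "model_category M" and pb: "is_pullback M p q f g"
    and f: "in_hom M A D f" and g: "in_hom M B D g" "g \<in> fib M"
  shows "p \<in> fib M"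
proof (rule fib_lifting[OF M])
  note m = model_category_rules[OF M] and c = category_rules[OF model_is_category[OF M]]
  note h = is_pullback_homs[OF pb f g(1)] and ex = is_pullback_ex1[OF pb f g(1)]
  show "in_hom M (src M p) A p" using h by simp
  fix i assume i: "i \<in> cof M" "i \<in> weq M"
  define X Y where "X = src M i" and "Y = tgt M i"
  have ih: "in_hom M X Y i" using m(2)[OF i(1)] by (simp add: in_hom_def X_def Y_def)
  show "has_lift M i p"
  proof (rule has_liftI[OF ih h(1)])
    fix u v assume u: "in_hom M X (src M p) u" and v: "in_hom M Y A v" and e: "cmp M p u = cmp M v i"
    have e': "cmp M g (cmp M q u) = cmp M (cmp M f v) i"
      using e c(6)[OF u h(2) g(1)] c(6)[OF u h(1) f] c(6)[OF ih v f] h(3) by simp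
    obtain k where k: "in_hom M Y B k" "cmp M k i = cmp M q u" "cmp M g k = cmp M f v"
      using has_liftD[OF m(10)[OF i g(2)] ih g(1) c(2)[OF u h(2)] c(2)[OF v f] e'] .
    obtain l where l: "in_hom M Y (src M p) l" "cmp M p l = v" "cmp M q l = k"
      using ex[OF v k(1) k(3)[symmetric]] by blast
    have "in_hom M X (src M p) (cmp M l i) \<and> cmp M p (cmp M l i) = cmp M p u \<and> cmp M q (cmp M l i) = cmp M q u"
      using c(2)[OF ih l(1)] c(6)[OF ih l(1) h(1)] c(6)[OF ih l(1) h(2)] l k e by simp
    moreover have "cmp M f (cmp M p u) = cmp M g (cmp M q u)"
      using c(6)[OF u h(2) g(1)] c(6)[OF u h(1) f] h(3) by simp
    ultimately have "cmp M l i = u"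
      using ex[OF c(2)[OF u h(1)] c(2)[OF u h(2)]] u by blast
    with l show "\<exists>h. in_hom M Y (src M p) h \<and> cmp M h i = u \<and> cmp M p h = v" by blast
  qed
qed

lemma is_terminal_unique:
  "is_terminal C T \<Longrightarrow> in_hom C A T f \<Longrightarrow> in_hom C A T g \<Longrightarrow> A \<in> Ob C \<Longrightarrow> f = g"
  unfolding is_terminal_def by blast

section \<open>Enlarging the weak equivalences of a model structure\<close>

text \<open>Only trivial cofibrations are required to stay weak equivalences, as this is what SM7
  gives for a Bousfield localization; \<open>weq_subset\<close> extends it to all of
  \<open>weq M\<close>.\<close>

locale model_enlargement =
  fixes M N :: "('o, 'm) model"
  assumes M: "model_category M" and N: "model_category N"
    and same: "Ob N = Ob M" "Ar N = Ar M" "src N = src M" "tgt N = tgt M" "idn N = idn M" "cmp N = cmp M"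
      "cof N = cof M"
    and trivial_cof: "cof M \<inter> weq M \<subseteq> weq N"
begin

lemma same_defs:
  "in_hom N = in_hom M" "has_lift N = has_lift M" "is_retract N = is_retract M"
  "is_terminal N = is_terminal M"
  by (auto simp: fun_eq_iff in_hom_def has_lift_def is_retract_def is_terminal_def same)

lemma trivial_fib_iff: "p \<in> fib N \<and> p \<in> weq N \<longleftrightarrow> p \<in> fib M \<and> p \<in> weq M"
proof
  note m = model_category_rules[OF M] and n = model_category_rules[OF N]
  show "p \<in> fib M \<and> p \<in> weq M" if "p \<in> fib N \<and> p \<in> weq N"
    using trivial_fib_lifting[OF M hom_Ar] n(3,11) that by (auto simp: same same_defs)
  show "p \<in> fib N \<and> p \<in> weq N" if "p \<in> fib M \<and> p \<in> weq M"
    using trivial_fib_lifting[OF N hom_Ar] m(3,11) that by (auto simp: same same_defs)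
qed

lemma weq_subset: "weq M \<subseteq> weq N"
proof
  note m = model_category_rules[OF M] and n = model_category_rules[OF N]
  fix f assume f: "f \<in> weq M"
  obtain i p D where ip: "in_hom M (src M f) D i" "in_hom M D (tgt M f) p" "f = cmp M p i"
    "i \<in> cof M" "i \<in> weq M" "p \<in> fib M"
    using factor_trivial_cof[OF M hom_Ar[OF m(4)[OF f]]] .
  then have "p \<in> weq M" using m(6) f by blast
  with ip have "p \<in> weq N" "i \<in> weq N" using trivial_fib_iff trivial_cof by auto
  with ip(1,2) show "f \<in> weq N" using n(5) by (simp add: same_defs ip(3) same)
qed

text \<open>A Whitehead argument: \<open>i\<close> has a retraction \<open>r\<close>, and a homotopy
  from the identity of \<open>W\<close> to \<open>i r\<close> lives in a path object whose end point
  maps are trivial fibrations, hence belong to \<open>weq M\<close>.\<close>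

lemma trivial_cof_fibrant:
  assumes i: "in_hom M X W i" "i \<in> cof M" "i \<in> weq N" and X: "fibrant N X" and W: "fibrant N W"
  shows "i \<in> weq M"
proof -
  note m = model_category_rules[OF M] and n = model_category_rules[OF N, unfolded same same_defs]
  note c = category_rules[OF model_is_category[OF M]] and a = category_rules(6)[OF model_is_category[OF M]]
  have Ob: "X \<in> Ob M" "W \<in> Ob M" using c(3)[OF i(1)] by auto
  note id = c(1)[OF Ob(1)] c(1)[OF Ob(2)] and idw = idn_weq[OF M Ob(1)] idn_weq[OF M Ob(2)]
  have lift: "has_lift M i p" if "p \<in> fib N" for p using n(10)[OF i(2,3) that] .
  obtain T t where t: "is_terminal M T" "in_hom M W T t" "t \<in> fib N"
    using W unfolding fibrant_def same_defs by blast
  obtain S s where s: "is_terminal M S" "in_hom M X S s" "s \<in> fib N"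
    using X unfolding fibrant_def same_defs by blast
  obtain w where w: "in_hom M W S w" using s(1) Ob unfolding is_terminal_def by blast
  have "cmp M s (idn M X) = cmp M w i"
    using is_terminal_unique[OF s(1) _ c(2)[OF i(1) w] Ob(1)] c(2)[OF id(1) s(2)] by blast
  \<comment> \<open>Lifting the identity of \<open>X\<close> along \<open>i\<close> against the
    fibration from \<open>X\<close> to the terminal object.\<close>
  then obtain r where r: "in_hom M W X r" "cmp M r i = idn M X"
    using has_liftD[OF lift[OF s(3)] i(1) s(2) id(1) w] by blast
  have "finitely_bicomplete M" using M by (simp add: model_category_def)
  \<comment> \<open>The pull-back over a terminal object is the product of \<open>W\<close> with
    itself; its projections are in \<open>fib N\<close> as pull-backs of \<open>t\<close>.\<close>
  then obtain p q where pb: "is_pullback M p q t t"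
    using t(2) unfolding finitely_bicomplete_def in_hom_def by blast
  note pq = is_pullback_homs[OF pb t(2,2)]
  define Q where "Q = src M p"
  have p: "in_hom M Q W p" and q: "in_hom M Q W q" using pq by (auto simp: Q_def)
  have pbN: "is_pullback N p q t t" using pb unfolding is_pullback_def same same_defs .
  have pqf: "p \<in> fib N" "q \<in> fib N"
    using fib_pullback[OF N _ _ _ t(3)] pbN is_pullback_commute[OF pbN] t(2) by (auto simp: same_defs)
  have pair: "\<exists>!h. in_hom M A Q h \<and> cmp M p h = u \<and> cmp M q h = v"
    if "in_hom M A W u" "in_hom M A W v" for A u v
  proof -
    have "cmp M t u = cmp M t v"
      using is_terminal_unique[OF t(1) c(2)[OF that(1) t(2)] c(2)[OF that(2) t(2)]] c(3) that by blast
    then show ?thesis using is_pullback_ex1[OF pb t(2,2) that] by (simp add: Q_def)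
  qed
  \<comment> \<open>\<open>d\<close> is the diagonal, and \<open>g\<close> below is the pair of the
    identity and \<open>i r\<close>, whose two components the homotopy has to join.\<close>
  obtain d where d: "in_hom M W Q d" "cmp M p d = idn M W" "cmp M q d = idn M W"
    using pair[OF id(2,2)] by blast
  have ir: "in_hom M W W (cmp M i r)" using c(2)[OF r(1) i(1)] .
  obtain g where g: "in_hom M W Q g" "cmp M p g = idn M W" "cmp M q g = cmp M i r"
    using pair[OF id(2) ir] by blast
  \<comment> \<open>\<open>P\<close> is a path object for \<open>W\<close>, from factoring the
    diagonal in \<open>N\<close>.\<close>
  obtain \<sigma> \<pi> P where P: "in_hom M W P \<sigma>" "in_hom M P Q \<pi>" "d = cmp M \<pi> \<sigma>" "\<sigma> \<in> weq N" "\<pi> \<in> fib N"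
    using factor_trivial_cof[OF N, unfolded same_defs same, OF d(1)] by metis
  \<comment> \<open>An end point map is split by \<open>\<sigma>\<close>, so it is a trivial
    fibration of \<open>N\<close>, and therefore one of \<open>M\<close>.\<close>
  have ev: "cmp M e \<pi> \<in> weq M" if e: "in_hom M Q W e" "e \<in> fib N" "cmp M e d = idn M W" for e
  proof -
    have "cmp M (cmp M e \<pi>) \<sigma> = idn M W" using a[OF P(1,2) e(1)] P(3) e(3) by simp
    moreover have "idn M W \<in> weq N" using idw(2) weq_subset by blast
    ultimately have "cmp M e \<pi> \<in> weq N" using n(6)[OF P(1) c(2)[OF P(2) e(1)] P(4)] by simp
    moreover have "cmp M e \<pi> \<in> fib N"
      using fib_cmp[OF N, unfolded same_defs same, OF P(2,5) e(1,2)] .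
    ultimately show ?thesis using trivial_fib_iff by blast
  qed
  \<comment> \<open>By \<open>r i = id\<close>, both sides have components \<open>i\<close> and
    \<open>i\<close>. The homotopy can thus be taken constant on \<open>X\<close>, and the filler
    \<open>k\<close> below is such a homotopy.\<close>
  have "cmp M \<pi> (cmp M \<sigma> i) = cmp M g i"
  proof -
    have di: "cmp M \<pi> (cmp M \<sigma> i) = cmp M d i" using a[OF i(1) P(1,2)] P(3) by simp
    have "cmp M p (cmp M d i) = i" "cmp M q (cmp M d i) = i" "cmp M p (cmp M g i) = i"
      using a[OF i(1) d(1) p] a[OF i(1) d(1) q] a[OF i(1) g(1) p] c(5)[OF i(1)] d g by simp_all
    moreover have "cmp M q (cmp M g i) = i"
      using a[OF i(1) g(1) q] g(3) a[OF i(1) r(1) i(1)] r(2) c(4)[OF i(1)] by simp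
    ultimately show ?thesis
      using pair[OF i(1,1)] c(2)[OF i(1) d(1)] c(2)[OF i(1) g(1)] di by metis
  qed
  then obtain k where k: "in_hom M W P k" "cmp M \<pi> k = g"
    using has_liftD[OF lift[OF P(5)] i(1) P(2) c(2)[OF i(1) P(1)] g(1)] by blast
  \<comment> \<open>The first end of \<open>k\<close> is an identity, so \<open>k\<close> is in
    \<open>weq M\<close>; then so is its other end \<open>i r\<close>.\<close>
  have "k \<in> weq M"
    using m(7)[OF k(1) c(2)[OF P(2) p] ev[OF p pqf(1) d(2)]] a[OF k(1) P(2) p] k(2) g(2) idw(2) by simp
  then have irw: "cmp M i r \<in> weq M"
    using m(5)[OF k(1) c(2)[OF P(2) q] _ ev[OF q pqf(2) d(3)]] a[OF k(1) P(2) q] k(2) g(3) by simp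
  \<comment> \<open>Identities of \<open>W\<close> on the sources; on the targets \<open>i\<close>
    and \<open>r\<close>, whose composite is the identity of \<open>X\<close>.\<close>
  have "is_retract M r (cmp M i r)"
    unfolding is_retract_def
    using r ir i(1) id a[OF r(1) i(1) r(1)] c(4)[OF ir] c(4,5)[OF r(1)] c(4)[OF id(2)]
    by (intro conjI exI[of _ "idn M W"] exI[of _ i] exI[of _ r]) (auto simp: in_hom_def)
  then have "r \<in> weq M" using m(9) irw by blast
  then show ?thesis using m(7)[OF i(1) r(1)] r(2) idw(1) by simp
qed

text \<open>Factoring through a trivial fibration of \<open>N\<close> keeps the middle object
  fibrant, so the remaining cofibration falls under \<open>trivial_cof_fibrant\<close>.\<close>

lemma weq_fibrant:
  assumes f: "in_hom M X Y f" "f \<in> weq N" and X: "fibrant N X" and Y: "fibrant N Y"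
  shows "f \<in> weq M"
proof -
  note m = model_category_rules[OF M] and n = model_category_rules[OF N, unfolded same same_defs]
  note c = category_rules[OF model_is_category[OF M]]
  obtain i p W where ip: "in_hom M X W i" "in_hom M W Y p" "f = cmp M p i" "i \<in> cof M"
    "p \<in> fib N" "p \<in> weq N"
    using factor_trivial_fib[OF N, unfolded same_defs same, OF f(1)] .
  obtain T t where t: "is_terminal M T" "in_hom M Y T t" "t \<in> fib N"
    using Y unfolding fibrant_def same_defs by blast
  have "cmp M t p \<in> fib N" using fib_cmp[OF N, unfolded same_defs same, OF ip(2,5) t(2,3)] .
  then have "fibrant N W" using t(1) c(2)[OF ip(2) t(2)] unfolding fibrant_def same_defs by blast
  moreover have "i \<in> weq N" using n(7)[OF ip(1,2,6)] f(2) ip(3) by simp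
  ultimately have "i \<in> weq M" using trivial_cof_fibrant[OF ip(1,4) _ X] by blast
  moreover have "p \<in> weq M" using trivial_fib_iff ip(5,6) by blast
  ultimately show ?thesis using m(5)[OF ip(1,2)] ip(3) by simp
qed

end


section \<open>Derived adjunctions of identity functors\<close>

lemma zpath_single:
  assumes "is_category C" "in_hom C a b f"
  shows "zpath C W a b [Fwd f]" and "f \<in> W \<Longrightarrow> zpath C W b a [Bwd f]"
  using assms by (auto simp: is_category_def in_hom_def)

lemma zeq_inv:
  assumes "in_hom C a b w" "w \<in> W"
  shows "zeq C W a a [Fwd w, Bwd w] []" "zeq C W b b [Bwd w, Fwd w] []"
  using assms zinv1[of w W C] zinv2[of w W C] by (auto simp: in_hom_def)

lemma zeq_cmp:
  assumes "in_hom C a b f" "in_hom C b c g"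
  shows "zeq C W a c [Fwd f, Fwd g] [Fwd (cmp C g f)]"
  using assms zcmp[of f C g W] by (auto simp: in_hom_def)

lemma zeq_square:
  assumes "in_hom C a b f" "in_hom C b d g" "in_hom C a c f'" "in_hom C c d g'"
    "cmp C g f = cmp C g' f'"
  shows "zeq C W a d [Fwd f, Fwd g] [Fwd f', Fwd g']"
  using zeq_cmp[OF assms(1,2)] zeq_cmp[OF assms(3,4)] assms(5) by (metis ztrans zsym)

lemma zeq_cancel_right:
  assumes C: "is_category C" and w: "in_hom C b c w" "w \<in> W"
    and u: "zpath C W a b u" "zpath C W a b v" and e: "zeq C W a c (u @ [Fwd w]) (v @ [Fwd w])"
  shows "zeq C W a b u v"
proof -
  have "zeq C W a b (u' @ [Fwd w, Bwd w]) u'" if "zpath C W a b u'" for u'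
    using zeq_append[OF C zrefl[OF that] zeq_inv(1)[OF w]] by simp
  moreover have "zeq C W a b (u @ [Fwd w, Bwd w]) (v @ [Fwd w, Bwd w])"
    using zeq_append[OF C e zrefl[OF zpath_single(2)[OF C w]]] by simp
  ultimately show ?thesis using u by (meson zsym ztrans)
qed

lemma nat_trans_idD:
  assumes "nat_trans C C id_func R \<eta>"
  shows "a \<in> Ob C \<Longrightarrow> in_hom C a (fob R a) (\<eta> a)"
    and "in_hom C a b f \<Longrightarrow> cmp C (\<eta> b) f = cmp C (far R f) (\<eta> a)"
  using assms by (auto simp: nat_trans_def id_func_def in_hom_def)

lemma functor_in_hom:
  "is_functor C D F \<Longrightarrow> in_hom C a b f \<Longrightarrow> in_hom D (fob F a) (fob F b) (far F f)"
  by (auto simp: is_functor_def in_hom_def)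

text \<open>Naturality of \<open>\<eta>\<close> extends to zigzags one step at a time. No
  \<open>\<eta> a\<close> gets inverted, so that this applies in \<open>Ho M\<close>, where
  \<open>\<eta>\<close> need not be invertible.\<close>

lemma zeq_natural:
  assumes u: "zpath C W a b u" and C: "is_category C" and R: "is_functor C C R"
    and RW: "far R ` (W \<inter> Ar C) \<subseteq> W" and \<eta>: "nat_trans C C id_func R \<eta>"
  shows "zeq C W a (fob R b) (u @ [Fwd (\<eta> b)]) (Fwd (\<eta> a) # map (map_zstep (far R)) u)"
  using u
proof (induction u arbitrary: a)
  case Nil
  then have "zpath C W a (fob R b) [Fwd (\<eta> b)]"
    using zpath_single(1)[OF C nat_trans_idD(1)[OF \<eta>]] by auto
  then show ?case using Nil by (auto intro: zrefl)
next
  case (Cons s u)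
  note h = nat_trans_idD(1)[OF \<eta>]
  show ?case
  proof (cases s)
    case (Fwd f)
    define c where "c = tgt C f"
    have f: "in_hom C a c f" and u: "zpath C W c b u"
      using Cons.prems Fwd by (auto simp: in_hom_def c_def)
    note Ob = category_rules(3)[OF C f]
    note Rf = functor_in_hom[OF R f] and Ru = zpath_map[OF R RW u]
    have "zeq C W a (fob R b) ([Fwd f] @ (u @ [Fwd (\<eta> b)]))
        ([Fwd f] @ (Fwd (\<eta> c) # map (map_zstep (far R)) u))"
      by (rule zeq_append[OF C zrefl[OF zpath_single(1)[OF C f]] Cons.IH[OF u]])
    moreover have "zeq C W a (fob R b) ([Fwd f, Fwd (\<eta> c)] @ map (map_zstep (far R)) u)
        ([Fwd (\<eta> a), Fwd (far R f)] @ map (map_zstep (far R)) u)"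
      using Ob nat_trans_idD(2)[OF \<eta> f]
      by (intro zeq_append[OF C zeq_square[OF f h h Rf] zrefl[OF Ru]]) auto
    ultimately show ?thesis using Fwd by (auto intro: ztrans)
  next
    case (Bwd w)
    define c where "c = src C w"
    have w: "in_hom C c a w" "w \<in> W" and u: "zpath C W c b u"
      using Cons.prems Bwd by (auto simp: in_hom_def c_def)
    have Ob: "c \<in> Ob C" "a \<in> Ob C" using category_rules(3)[OF C w(1)] by auto
    note Rw = functor_in_hom[OF R w(1)] and Ru = zpath_map[OF R RW u]
    have RwW: "far R w \<in> W" using RW w by (auto simp: in_hom_def)
    note hc = h[OF Ob(1)] and ha = h[OF Ob(2)]
    note sq = zeq_square[OF hc Rw w(1) ha nat_trans_idD(2)[OF \<eta> w(1), symmetric], of W]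
    note Bw = zrefl[OF zpath_single(2)[OF C w]]
    note BRw = zrefl[OF zpath_single(2)[OF C Rw RwW]]
    \<comment> \<open>A backward step: insert \<open>R w\<close> and its inverse after
      \<open>\<eta> c\<close>, exchange the two sides of the naturality square, and cancel
      \<open>w\<close> against its inverse.\<close>
    have "zeq C W a (fob R c) ([Bwd w, Fwd (\<eta> c)] @ [Fwd (far R w), Bwd (far R w)]) ([Bwd w, Fwd (\<eta> c)] @ [])"
      using zeq_append[OF C Bw zrefl[OF zpath_single(1)[OF C hc]]]
      by (intro zeq_append[OF C _ zeq_inv(1)[OF Rw RwW]]) simp
    moreover have "zeq C W a (fob R c) ([Bwd w] @ ([Fwd (\<eta> c), Fwd (far R w)] @ [Bwd (far R w)]))
        ([Bwd w] @ ([Fwd w, Fwd (\<eta> a)] @ [Bwd (far R w)]))"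
      by (intro zeq_append[OF C Bw] zeq_append[OF C sq] BRw)
    moreover have "zeq C W a (fob R c) ([Bwd w, Fwd w] @ [Fwd (\<eta> a), Bwd (far R w)])
        ([] @ [Fwd (\<eta> a), Bwd (far R w)])"
      using zeq_append[OF C zrefl[OF zpath_single(1)[OF C ha]] BRw]
      by (intro zeq_append[OF C zeq_inv(2)[OF w]]) simp
    ultimately have *: "zeq C W a (fob R c) [Bwd w, Fwd (\<eta> c)] [Fwd (\<eta> a), Bwd (far R w)]"
      by (simp, meson zsym ztrans)
    have "zeq C W a (fob R b) ([Bwd w] @ (u @ [Fwd (\<eta> b)]))
        ([Bwd w] @ (Fwd (\<eta> c) # map (map_zstep (far R)) u))"
      by (rule zeq_append[OF C Bw Cons.IH[OF u]])
    moreover have "zeq C W a (fob R b) ([Bwd w, Fwd (\<eta> c)] @ map (map_zstep (far R)) u)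
        ([Fwd (\<eta> a), Bwd (far R w)] @ map (map_zstep (far R)) u)"
      by (rule zeq_append[OF C * zrefl[OF Ru]])
    ultimately show ?thesis using Bwd by (auto intro: ztrans)
  qed
qed

text \<open>Followed by the invertible \<open>\<eta> b\<close>, both sides become the image of
  \<open>u\<close> under \<open>R\<close>, the right one by \<open>zeq_natural\<close>.\<close>

lemma zeq_natural_inverse:
  assumes u: "zpath C W a b u" and C: "is_category C" and R: "is_functor C C R"
    and RW: "far R ` (W \<inter> Ar C) \<subseteq> W" and \<eta>: "nat_trans C C id_func R \<eta>"
    and W: "\<And>a. a \<in> Ob C \<Longrightarrow> \<eta> a \<in> W"
  shows "zeq C W (fob R a) b (map (map_zstep (far R)) u @ [Bwd (\<eta> b)]) (Bwd (\<eta> a) # u)"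
proof -
  note Ob = zpath_ends[OF C u]
  note ha = nat_trans_idD(1)[OF \<eta> Ob(1)] W[OF Ob(1)] and hb = nat_trans_idD(1)[OF \<eta> Ob(2)] W[OF Ob(2)]
  note Ba = zpath_single(2)[OF C ha] and Ru = zpath_map[OF R RW u]
  have "zeq C W (fob R a) (fob R b) ([Bwd (\<eta> a)] @ (u @ [Fwd (\<eta> b)]))
      ([Bwd (\<eta> a)] @ (Fwd (\<eta> a) # map (map_zstep (far R)) u))"
    by (rule zeq_append[OF C zrefl[OF Ba] zeq_natural[OF u C R RW \<eta>]])
  moreover have "zeq C W (fob R a) (fob R b) ([Bwd (\<eta> a), Fwd (\<eta> a)] @ map (map_zstep (far R)) u)
      ([] @ map (map_zstep (far R)) u)"
    by (rule zeq_append[OF C zeq_inv(2)[OF ha] zrefl[OF Ru]])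
  moreover have "zeq C W (fob R a) (fob R b)
      (map (map_zstep (far R)) u @ [Bwd (\<eta> b), Fwd (\<eta> b)]) (map (map_zstep (far R)) u @ [])"
    by (rule zeq_append[OF C zrefl[OF Ru] zeq_inv(2)[OF hb]])
  ultimately have "zeq C W (fob R a) (fob R b) ((map (map_zstep (far R)) u @ [Bwd (\<eta> b)]) @ [Fwd (\<eta> b)])
      ((Bwd (\<eta> a) # u) @ [Fwd (\<eta> b)])"
    by (simp, meson zsym ztrans)
  then show ?thesis
    using zpath_appendI[OF C Ru zpath_single(2)[OF C hb]] zpath_appendI[OF C Ba u]
    by (intro zeq_cancel_right[OF C hb]) auto
qed

lemma id_func_simps [simp]: "fob id_func = (\<lambda>A. A)" "far id_func = (\<lambda>f. f)"
  by (auto simp: id_func_def)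

lemma map_zstep_ident: "map (map_zstep (\<lambda>f. f)) u = u"
  by (simp add: map_idI zstep.map_ident)

lemma comp_func_simps [simp]: "fob (comp_func G F) A = fob G (fob F A)" "far (comp_func G F) f = far G (far F f)"
  by (auto simp: comp_func_def)

section \<open>The identity as a left Quillen functor and its derived adjunction\<close>

context model_enlargement
begin

lemma categories: "is_category M" "is_category N"
  using M N model_is_category by auto

lemma is_functor_transfer:
  assumes "is_functor N N R" shows "is_functor M M R" "is_functor N M R"
  using assms categories by (auto simp: is_functor_def same same_defs)

lemma nat_trans_transfer: "nat_trans N N F G \<eta> = nat_trans M M F G \<eta>"
  by (simp add: nat_trans_def same same_defs)

lemma id_functor: "is_functor M N id_func" "is_functor N M id_func"
  using categories category_rules(1)[OF categories(1)]
  by (auto simp: is_functor_def same same_defs intro: hom_Ar)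

lemma adjunction_id: "adjunction M N id_func id_func (idn M) (idn M)"
  using id_functor category_rules[OF categories(1)]
  by (auto simp: adjunction_def nat_trans_def same same_defs) (metis hom_Ar)+

lemma left_quillen_id: "left_quillen M N id_func"
  using M N adjunction_id trivial_cof by (auto simp: left_quillen_def same)

text \<open>In the second triangle identity, \<open>\<eta>\<^bsub>RB\<^esub>\<close> and \<open>R\<eta>\<^bsub>B\<^esub>\<close> have to be identified in \<open>Ho M\<close>, where
  \<open>\<eta>\<^bsub>B\<^esub>\<close> need not be invertible. They agree in \<open>Ho N\<close>, hence have the same image under \<open>R\<close> in
  \<open>Ho M\<close>; by naturality of \<open>\<eta>\<close> they agree after composition with \<open>\<eta>\<^bsub>RRB\<^esub>\<close>, which is an isomorphism
  in \<open>Ho M\<close>.\<close>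

theorem derived_id_adjunction:
  assumes "fibrant_replacement N R \<eta>"
  shows "derived_id_adjunction M N R \<eta>"
proof -
  note C = categories and m = model_category_rules[OF M] and n = model_category_rules[OF N, unfolded same same_defs]
  note c = category_rules[OF C(1)]
  have RN: "is_functor N N R" and \<eta>N: "nat_trans N N id_func R \<eta>"
    and fibR: "\<And>a. a \<in> Ob M \<Longrightarrow> fibrant N (fob R a)" and \<eta>W: "\<And>a. a \<in> Ob M \<Longrightarrow> \<eta> a \<in> weq N"
    using assms by (auto simp: fibrant_replacement_def same)
  note RM = is_functor_transfer[OF RN] and \<eta>M = \<eta>N[unfolded nat_trans_transfer]
  note \<eta> = nat_trans_idD[OF \<eta>M]
  have Rob: "fob R a \<in> Ob M" if "a \<in> Ob M" for a using RM(1) that by (simp add: is_functor_def)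
  \<comment> \<open>By naturality and two out of three, \<open>R w\<close> is in
    \<open>weq N\<close>; as its ends are fibrant in \<open>N\<close>, it is even in
    \<open>weq M\<close>. Hence \<open>R\<close> induces a functor from \<open>Ho N\<close> to
    \<open>Ho M\<close>.\<close>
  have RW: "far R w \<in> weq M" if "w \<in> weq N" for w
  proof -
    define a b where "a = src M w" and "b = tgt M w"
    have w: "in_hom M a b w" using n(4)[OF that] by (simp add: in_hom_def a_def b_def)
    note Rw = functor_in_hom[OF RM(1) w]
    have Ob: "a \<in> Ob M" "b \<in> Ob M" using c(3)[OF w] by auto
    have "cmp M (far R w) (\<eta> a) \<in> weq N"
      using n(5)[OF w \<eta>(1)[OF Ob(2)] that \<eta>W[OF Ob(2)]] \<eta>(2)[OF w] by simp
    then have "far R w \<in> weq N" using n(6)[OF \<eta>(1)[OF Ob(1)] Rw \<eta>W[OF Ob(1)]] by blast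
    then show ?thesis using weq_fibrant[OF Rw] fibR Ob by blast
  qed
  have RNM: "far R ` (weq N \<inter> Ar N) \<subseteq> weq M" using RW by blast
  have RMM: "far R ` (weq M \<inter> Ar M) \<subseteq> weq M" using RW weq_subset by blast
  have RNN: "far R ` (weq N \<inter> Ar N) \<subseteq> weq N" using RW weq_subset by blast
  have idMN: "far id_func ` (weq M \<inter> Ar M) \<subseteq> weq N" using weq_subset by auto
  note ind = induced_on_Ho[OF id_functor(1) idMN] induced_on_Ho[OF RM(2) RNM]
  note hoR = ho_map_zclass[OF RM(2) RNM] and hoid = ho_map_zclass[OF id_functor(1) idMN, unfolded id_func_simps map_zstep_ident]
  have toN: "zpath N (weq N) a b u" if "zpath M (weq M) a b u" for a b u
    using zpath_map[OF id_functor(1) idMN that] by (simp add: map_zstep_ident)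
  have uM: "zpath M (weq M) a (fob R a) [Fwd (\<eta> a)]" if "a \<in> Ob M" for a
    using zpath_single(1)[OF C(1) \<eta>(1)[OF that]] .
  have uN: "zpath N (weq N) a (fob R a) [Fwd (\<eta> a)]" if "a \<in> Ob M" for a
    using toN[OF uM[OF that]] .
  have bN: "zpath N (weq N) (fob R a) a [Bwd (\<eta> a)]" if "a \<in> Ob M" for a
    using zpath_single(2)[OF C(2), unfolded same_defs, OF \<eta>(1)[OF that] \<eta>W[OF that]] .
  let ?unit = "\<lambda>a. zclass M (weq M) a (fob R a) [Fwd (\<eta> a)]"
  let ?counit = "\<lambda>a. zclass N (weq N) (fob R a) a [Bwd (\<eta> a)]"
  \<comment> \<open>Naturality of the unit is \<open>zeq_natural\<close> in \<open>M\<close>;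
    naturality of the counit below is \<open>zeq_natural_inverse\<close> in \<open>N\<close>, where
    \<open>\<eta>\<close> is inverted.\<close>
  have unit: "nat_trans (Ho M) (Ho M) id_func (comp_func (ho_map M R) (ho_map N id_func)) ?unit"
    unfolding nat_trans_def
  proof (intro conjI ballI)
    fix a assume "a \<in> Ob (Ho M)"
    then show "in_hom (Ho M) (fob id_func a) (fob (comp_func (ho_map M R) (ho_map N id_func)) a) (?unit a)"
      using Ho_in_hom[OF uM] by (simp add: Ho_simps)
  next
    fix f assume "f \<in> Ar (Ho M)"
    then obtain a b u where f: "f = zclass M (weq M) a b u" and u: "zpath M (weq M) a b u"
      by (auto simp: Ho_Ar)
    note Ob = zpath_ends[OF C(1) u] and Ru = zpath_map[OF RM(1) RMM u]
    show "cmp (Ho M) (?unit (tgt (Ho M) f)) (far id_func f) =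
        cmp (Ho M) (far (comp_func (ho_map M R) (ho_map N id_func)) f) (?unit (src (Ho M) f))"
      using zeq_natural[OF u C(1) RM(1) RMM \<eta>M] zpath_appendI[OF C(1) uM[OF Ob(1)] Ru]
      by (simp add: f Ho_simps hoid[OF u] hoR[OF toN[OF u]] Ho_cmp[OF C(1) u uM[OF Ob(2)]]
        Ho_cmp[OF C(1) uM[OF Ob(1)] Ru] zclass_eq_iff)
  qed
  have counit: "nat_trans (Ho N) (Ho N) (comp_func (ho_map N id_func) (ho_map M R)) id_func ?counit"
    unfolding nat_trans_def
  proof (intro conjI ballI)
    fix a assume "a \<in> Ob (Ho N)"
    then show "in_hom (Ho N) (fob (comp_func (ho_map N id_func) (ho_map M R)) a) (fob id_func a) (?counit a)"
      using Ho_in_hom[OF bN] by (simp add: Ho_simps same)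
  next
    fix f assume "f \<in> Ar (Ho N)"
    then obtain a b u where f: "f = zclass N (weq N) a b u" and u: "zpath N (weq N) a b u"
      by (auto simp: Ho_Ar)
    have Ob: "a \<in> Ob M" "b \<in> Ob M" using zpath_ends[OF C(2) u] by (auto simp: same)
    note Ru = zpath_map[OF RM(2) RNM u]
    show "cmp (Ho N) (?counit (tgt (Ho N) f)) (far (comp_func (ho_map N id_func) (ho_map M R)) f) =
        cmp (Ho N) (far id_func f) (?counit (src (Ho N) f))"
      using zeq_natural_inverse[OF u C(2) RN RNN \<eta>N \<eta>W] zpath_appendI[OF C(2) bN[OF Ob(1)] u]
      by (simp add: f Ho_simps hoR[OF u] hoid[OF Ru] Ho_cmp[OF C(2) toN[OF Ru] bN[OF Ob(2)]]
        Ho_cmp[OF C(2) bN[OF Ob(1)] u] zclass_eq_iff same)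
  qed
  have tri1: "cmp (Ho N) (?counit a) (far (ho_map N id_func) (?unit a)) = idn (Ho N) a"
    if a: "a \<in> Ob M" for a
    using zeq_inv(1)[of N a "fob R a" "\<eta> a" "weq N"] \<eta>(1)[OF a] \<eta>W[OF a] a
    by (simp add: hoid[OF uM[OF a]] Ho_cmp[OF C(2) uN[OF a] bN[OF a]] Ho_simps zclass_eq_iff same same_defs)
  have tri2: "cmp (Ho M) (far (ho_map M R) (?counit a)) (?unit (fob R a)) = idn (Ho M) (fob R a)"
    if a: "a \<in> Ob M" for a
  proof -
    let ?b = "fob R a" let ?c = "fob R ?b" let ?x = "\<eta> ?b" and ?y = "far R (\<eta> a)"
    have b: "?b \<in> Ob M" "?c \<in> Ob M" using Rob a by auto
    note x = \<eta>(1)[OF b(1)] and h = \<eta>(1)[OF a] and h' = \<eta>(1)[OF b(2)]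
    note y = functor_in_hom[OF RM(1) h]
    note xp = zpath_single(1)[OF C(1) x] and yp = zpath_single(1)[OF C(1) y]
    have "zeq N (weq N) a ?c [Fwd (\<eta> a), Fwd ?x] [Fwd (\<eta> a), Fwd ?y]"
      using zeq_square[of N a ?b "\<eta> a" ?c ?x ?b "\<eta> a" ?y] h x y \<eta>(2)[OF h] by (simp add: same_defs same)
    then have "zeq N (weq N) ?b ?c ([Bwd (\<eta> a)] @ [Fwd (\<eta> a), Fwd ?x]) ([Bwd (\<eta> a)] @ [Fwd (\<eta> a), Fwd ?y])"
      by (intro zeq_append[OF C(2) zrefl[OF bN[OF a]]])
    moreover have "zeq N (weq N) ?b ?c ([Bwd (\<eta> a), Fwd (\<eta> a)] @ [Fwd z]) ([] @ [Fwd z])"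
      if "in_hom M ?b ?c z" for z
      using zeq_append[OF C(2) zeq_inv(2)[of N, unfolded same_defs, OF h \<eta>W[OF a]]
          zrefl[OF zpath_single(1)[OF C(2), unfolded same_defs, OF that]]] .
    ultimately have "zeq N (weq N) ?b ?c [Fwd ?x] [Fwd ?y]"
      using x y by (simp, meson zsym ztrans)
    from zeq_map[OF this RM(2) RNM]
    have "zeq M (weq M) ?b (fob R ?c) ([Fwd ?x] @ map (map_zstep (far R)) [Fwd ?x])
        ([Fwd ?x] @ map (map_zstep (far R)) [Fwd ?y])"
      by (intro zeq_append[OF C(1) zrefl[OF xp]])
    then have "zeq M (weq M) ?b (fob R ?c) ([Fwd ?x] @ [Fwd (\<eta> ?c)]) ([Fwd ?y] @ [Fwd (\<eta> ?c)])"
      using zeq_natural[OF xp C(1) RM(1) RMM \<eta>M] zeq_natural[OF yp C(1) RM(1) RMM \<eta>M]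
      by (simp, meson zsym ztrans)
    moreover have "\<eta> ?c \<in> weq M"
      using weq_fibrant[OF h' \<eta>W[OF b(2)]] fibR b Rob by blast
    ultimately have xy: "zeq M (weq M) ?b ?c [Fwd ?x] [Fwd ?y]"
      by (intro zeq_cancel_right[OF C(1) h' _ xp yp])
    note yW = RW[OF \<eta>W[OF a]] and By = zpath_single(2)[OF C(1) y RW[OF \<eta>W[OF a]]]
    have "zeq M (weq M) ?b ?b ([Fwd ?x] @ [Bwd ?y]) []"
      using zeq_append[OF C(1) xy zrefl[OF By]] zeq_inv(1)[OF y yW] by (simp, meson ztrans)
    then show ?thesis
      using hoR[OF bN[OF a]] Ho_cmp[OF C(1) xp By] b
      by (simp add: Ho_simps zclass_eq_iff)
  qed
  show ?thesis
    unfolding derived_id_adjunction_def adjunction_def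
    using ind unit counit tri1 tri2 by (auto simp: induced_on_Ho_def Ho_simps same)
qed

end


section \<open>Realizations of isomorphic simplicial sets\<close>

definition cell_open :: "'u sset \<Rightarrow> 'u gpoint set set \<Rightarrow> nat \<Rightarrow> 'u \<Rightarrow> bool" where
  "cell_open K S n x \<longleftrightarrow> openin (subtopology (powertop_real UNIV) (standard_simplex n))
     {t \<in> standard_simplex n. gclass K (n, x, t) \<in> S}"

definition realization_points :: "'u sset \<Rightarrow> 'u gpoint set set" where
  "realization_points K = {gclass K (n, x, t) | n x t. x \<in> simp K n \<and> t \<in> standard_simplex n}"

text \<open>As \<open>realization\<close> is built with \<open>topology\<close>, its open sets are
  known only after checking \<open>istopology\<close>: preimages in the cells commute with
  intersections and unions.\<close>

lemma openin_realization:
  "openin (realization K) S \<longleftrightarrow> S \<subseteq> realization_points K \<and> (\<forall>n. \<forall>x\<in>simp K n. cell_open K S n x)"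
proof -
  let ?P = "\<lambda>S. S \<subseteq> realization_points K \<and> (\<forall>n. \<forall>x\<in>simp K n. cell_open K S n x)"
  have Int: "cell_open K (S \<inter> T) n x" if "cell_open K S n x" "cell_open K T n x" for S T n x
  proof -
    have "{t \<in> standard_simplex n. gclass K (n, x, t) \<in> S \<inter> T} =
      {t \<in> standard_simplex n. gclass K (n, x, t) \<in> S} \<inter> {t \<in> standard_simplex n. gclass K (n, x, t) \<in> T}"
      by blast
    with that show ?thesis unfolding cell_open_def by (simp add: openin_Int)
  qed
  have Un: "cell_open K (\<Union>\<S>) n x" if "\<forall>S\<in>\<S>. cell_open K S n x" for \<S> n x
  proof -
    have "{t \<in> standard_simplex n. gclass K (n, x, t) \<in> \<Union>\<S>} =
      (\<Union>S\<in>\<S>. {t \<in> standard_simplex n. gclass K (n, x, t) \<in> S})"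
      by blast
    with that show ?thesis unfolding cell_open_def by (auto intro: openin_Union)
  qed
  have "istopology ?P"
    unfolding istopology_def
  proof (intro conjI allI impI)
    fix \<S> assume *: "\<forall>S\<in>\<S>. S \<subseteq> realization_points K \<and> (\<forall>n. \<forall>x\<in>simp K n. cell_open K S n x)"
    show "\<Union>\<S> \<subseteq> realization_points K" using * by blast
    show "\<forall>x\<in>simp K n. cell_open K (\<Union>\<S>) n x" for n using * Un by simp
  qed (use Int in auto)
  then show ?thesis
    by (simp add: realization_def topology_inverse' cell_open_def[symmetric]
      realization_points_def[symmetric])
qed

lemma topspace_realization: "topspace (realization K) = realization_points K"
proof -
  have "cell_open K (realization_points K) n x" if "x \<in> simp K n" for n x
  proof -
    have "{t \<in> standard_simplex n. gclass K (n, x, t) \<in> realization_points K} = standard_simplex n"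
      using that by (auto simp: realization_points_def)
    then show ?thesis
      using openin_topspace[of "subtopology (powertop_real UNIV) (standard_simplex n)"]
      by (simp add: cell_open_def)
  qed
  then have "openin (realization K) (realization_points K)" by (simp add: openin_realization)
  moreover have "topspace (realization K) \<subseteq> realization_points K"
    using openin_topspace[of "realization K"] by (simp only: openin_realization)
  ultimately show ?thesis by (simp add: openin_subset subset_antisym)
qed

lemma gclass_eq_iff:
  "gclass K p = gclass K q \<longleftrightarrow> (p, q) \<in> (grel K \<union> (grel K)\<inverse>)\<^sup>*"
proof -
  let ?R = "(grel K \<union> (grel K)\<inverse>)\<^sup>*"
  have "sym ?R" by (intro sym_rtrancl sym_Un_converse)
  then show ?thesis
    unfolding gclass_def by (auto elim: symE intro: rtrancl_trans)
qed

text \<open>\<open>realization_map\<close> is a union over all representatives. A simplicial map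
  sends generating pairs of the gluing relation to generating pairs, so all terms of the union
  coincide.\<close>

lemma realization_map_gclass:
  assumes "is_sset_map K L f"
  shows "realization_map L f (gclass K (n, x, t)) = gclass L (n, f n x, t)"
proof -
  let ?F = "\<lambda>(n, x, t). (n, f n x, t)"
  have step: "(?F p, ?F q) \<in> grel L" if "(p, q) \<in> grel K" for p q
    using that assms unfolding grel_def is_sset_map_def by fastforce
  have closure: "(?F p, ?F q) \<in> (grel L \<union> (grel L)\<inverse>)\<^sup>*" if "(p, q) \<in> (grel K \<union> (grel K)\<inverse>)\<^sup>*" for p q
    using that
  proof (induction rule: rtrancl_induct)
    case (step q r)
    then have "(?F q, ?F r) \<in> grel L \<union> (grel L)\<inverse>" using \<open>\<And>p q. (p, q) \<in> grel K \<Longrightarrow> (?F p, ?F q) \<in> grel L\<close> by blast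
    with step.IH show ?case by (rule rtrancl_into_rtrancl)
  qed simp
  have "gclass L (?F q) = gclass L (n, f n x, t)" if "q \<in> gclass K (n, x, t)" for q
  proof -
    have "((n, x, t), q) \<in> (grel K \<union> (grel K)\<inverse>)\<^sup>*" using that by (simp add: gclass_def)
    from closure[OF this] have "gclass L (?F (n, x, t)) = gclass L (?F q)" by (simp only: gclass_eq_iff)
    then show ?thesis by simp
  qed
  moreover have "(n, x, t) \<in> gclass K (n, x, t)" by (simp add: gclass_def)
  moreover have "realization_map L f c = (\<Union>q\<in>c. gclass L (?F q))" for c
    by (auto simp: realization_map_def)
  ultimately show ?thesis by auto
qed

text \<open>The trace of a preimage on the cell of \<open>x\<close> is the trace of the open set on
  the cell of \<open>f n x\<close>.\<close>

lemma continuous_realization_map: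
  assumes f: "is_sset_map K L f"
  shows "continuous_map (realization K) (realization L) (realization_map L f)"
  unfolding continuous_map_def topspace_realization
proof (intro conjI allI impI)
  show maps: "realization_map L f \<in> realization_points K \<rightarrow> realization_points L"
    using f realization_map_gclass[OF f] unfolding realization_points_def is_sset_map_def by fastforce
  fix S assume S: "openin (realization L) S"
  have "cell_open K {c \<in> realization_points K. realization_map L f c \<in> S} n x" if x: "x \<in> simp K n" for n x
  proof -
    have "cell_open L S n (f n x)"
      using S f x unfolding openin_realization is_sset_map_def by blast
    moreover have "gclass K (n, x, t) \<in> realization_points K" if "t \<in> standard_simplex n" for t
      using x that unfolding realization_points_def by blast
    ultimately show ?thesis
      unfolding cell_open_def by (simp add: realization_map_gclass[OF f] cong: conj_cong)
  qed
  then show "openin (realization K) {c \<in> realization_points K. realization_map L f c \<in> S}"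
    unfolding openin_realization by blast
qed

lemma realization_map_cmp:
  assumes "is_sset_map K L f" "is_sset_map L M g" "is_sset_map K M h"
    and "\<And>n x. x \<in> simp K n \<Longrightarrow> h n x = g n (f n x)" and "c \<in> topspace (realization K)"
  shows "realization_map M h c = realization_map M g (realization_map L f c)"
  using assms by (auto simp: topspace_realization realization_points_def realization_map_gclass)

lemma realization_map_id:
  assumes "is_sset_map K K h" "\<And>n x. x \<in> simp K n \<Longrightarrow> h n x = x" "c \<in> topspace (realization K)"
  shows "realization_map K h c = c"
  using assms by (auto simp: topspace_realization realization_points_def realization_map_gclass)

lemma vertex_point_in_realization:
  assumes "x \<in> simp K 0" shows "vertex_point K x \<in> topspace (realization K)"
proof -
  have "(\<lambda>i. if i = 0 then 1 else 0) \<in> standard_simplex 0" by (simp add: standard_simplex_def)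
  with assms show ?thesis
    unfolding topspace_realization realization_points_def vertex_point_def by blast
qed

section \<open>Homotopy groups and homeomorphisms\<close>

lemma cube_boundary_0: "cube_boundary 0 = {}"
  by (simp add: cube_boundary_def)

text \<open>Base points have to match only for \<open>n \<noteq> 0\<close>: the 0-cube has empty
  boundary, and \<open>sset_weq\<close> uses \<open>undefined\<close> as base point there.\<close>

lemma spheroid_cmp:
  assumes "spheroid n S a \<gamma>" "continuous_map S T f" "n \<noteq> 0 \<Longrightarrow> f a = b"
  shows "spheroid n T b (f \<circ> \<gamma>)"
proof -
  have "(f \<circ> \<gamma>) ` cube_boundary n \<subseteq> {b}"
    using assms(1,3) by (cases "n = 0") (auto simp: spheroid_def cube_boundary_0)
  with assms(1,2) show ?thesis
    unfolding spheroid_def by (auto intro: continuous_map_compose)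
qed

lemma spheroid_htpc_cmp:
  assumes "spheroid_htpc n S a \<gamma> \<delta>" "continuous_map S T f" "n \<noteq> 0 \<Longrightarrow> f a = b"
  shows "spheroid_htpc n T b (f \<circ> \<gamma>) (f \<circ> \<delta>)"
  unfolding spheroid_htpc_def
proof (rule homotopic_with_compose_continuous_map_left[OF assms(1)[unfolded spheroid_htpc_def] assms(2)])
  fix h :: "(nat \<Rightarrow> real) \<Rightarrow> 'a" assume "h ` cube_boundary n \<subseteq> {a}"
  then show "(f \<circ> h) ` cube_boundary n \<subseteq> {b}"
    using assms(3) by (cases "n = 0") (auto simp: cube_boundary_0)
qed

text \<open>Composites with inverse homeomorphisms agree with the original spheroids only on the
  cube; the boundary condition is unaffected, as the boundary lies in the cube.\<close>

lemma spheroid_htpc_cong: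
  assumes "spheroid_htpc n S a \<gamma> \<delta>"
    and "\<And>t. t \<in> topspace (cube n) \<Longrightarrow> \<gamma>' t = \<gamma> t" "\<And>t. t \<in> topspace (cube n) \<Longrightarrow> \<delta>' t = \<delta> t"
  shows "spheroid_htpc n S a \<gamma>' \<delta>'"
proof -
  have sub: "cube_boundary n \<subseteq> topspace (cube n)" by (auto simp: cube_boundary_def)
  have img: "h ` cube_boundary n = k ` cube_boundary n" if "\<And>t. t \<in> topspace (cube n) \<Longrightarrow> h t = k t"
    for h k :: "(nat \<Rightarrow> real) \<Rightarrow> 'a"
    using that sub by (intro image_cong) auto
  show ?thesis
    unfolding spheroid_htpc_def
  proof (rule homotopic_with_eq[OF assms(1)[unfolded spheroid_htpc_def] assms(2,3)])
    fix h k :: "(nat \<Rightarrow> real) \<Rightarrow> 'a" assume "\<And>t. t \<in> topspace (cube n) \<Longrightarrow> h t = k t"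
    from img[OF this] show "h ` cube_boundary n \<subseteq> {a} \<longleftrightarrow> k ` cube_boundary n \<subseteq> {a}" by (simp only:)
  qed
qed

text \<open>For injectivity a homotopy in \<open>T'\<close> is moved to \<open>T\<close> by
  \<open>G\<close>; for surjectivity a spheroid of \<open>T'\<close> is moved by \<open>G\<close>,
  and the homotopy found in \<open>T\<close> is moved back by \<open>H\<close>.\<close>

lemma bij_on_pi_homeomorphism:
  assumes bij: "bij_on_pi n S a T b f" and f: "continuous_map S T f"
    and H: "homeomorphic_maps T T' H G" and b: "n \<noteq> 0 \<Longrightarrow> b \<in> topspace T \<and> H b = b'"
    and f': "\<And>x. x \<in> topspace S \<Longrightarrow> f' x = H (f x)"
  shows "bij_on_pi n S a T' b' f'"
proof -
  have cont: "continuous_map T T' H" "continuous_map T' T G"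
    and inv: "\<And>x. x \<in> topspace T \<Longrightarrow> G (H x) = x" "\<And>x. x \<in> topspace T' \<Longrightarrow> H (G x) = x"
    using H by (auto simp: homeomorphic_maps_def)
  have Gb: "G b' = b" if "n \<noteq> 0" using b[OF that] inv by auto
  have Hb: "H b = b'" if "n \<noteq> 0" using b[OF that] by auto
  have sph: "\<gamma> t \<in> topspace U" if "spheroid n U c \<gamma>" "t \<in> topspace (cube n)"
    for t and U :: "'z topology" and c \<gamma>
    using that continuous_map_image_subset_topspace unfolding spheroid_def by blast
  have fT: "f x \<in> topspace T" if "x \<in> topspace S" for x
    using f that continuous_map_image_subset_topspace by blast
  show ?thesis
    unfolding bij_on_pi_def
  proof (intro conjI allI impI; (elim conjE)?)
    fix \<gamma> \<delta> assume s: "spheroid n S a \<gamma>" "spheroid n S a \<delta>"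
      and h: "spheroid_htpc n T' b' (f' \<circ> \<gamma>) (f' \<circ> \<delta>)"
    have "spheroid_htpc n T b (f \<circ> \<gamma>) (f \<circ> \<delta>)"
      by (rule spheroid_htpc_cong[OF spheroid_htpc_cmp[OF h cont(2) Gb]])
        (simp_all add: f' fT inv sph[OF s(1)] sph[OF s(2)])
    with bij s show "spheroid_htpc n S a \<gamma> \<delta>" unfolding bij_on_pi_def by blast
  next
    fix \<gamma> assume s: "spheroid n T' b' \<gamma>"
    have "spheroid n T b (G \<circ> \<gamma>)" by (rule spheroid_cmp[OF s cont(2) Gb])
    then obtain \<delta> where d: "spheroid n S a \<delta>" "spheroid_htpc n T b (f \<circ> \<delta>) (G \<circ> \<gamma>)"
      using bij unfolding bij_on_pi_def by blast
    have "spheroid_htpc n T' b' (f' \<circ> \<delta>) \<gamma>"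
      by (rule spheroid_htpc_cong[OF spheroid_htpc_cmp[OF d(2) cont(1) Hb]])
        (simp_all add: f' fT inv sph[OF d(1)] sph[OF s])
    with d(1) show "\<exists>\<delta>. spheroid n S a \<delta> \<and> spheroid_htpc n T' b' (f' \<circ> \<delta>) \<gamma>" by blast
  qed
qed

section \<open>Transport along isomorphisms of simplicial sets\<close>

lemma is_sset_bij:
  assumes K: "is_sset K" and bij: "\<And>n. bij_betw (h n) (simp K n) (simp L n)"
    and nat: "\<And>m n \<theta> x. \<theta> \<in> Delta m n \<Longrightarrow> x \<in> simp K n \<Longrightarrow>
      h m (sact K m n \<theta> x) = sact L m n \<theta> (h n x)"
  shows "is_sset L"
proof -
  have h: "h n x \<in> simp L n" if "x \<in> simp K n" for n x using bij that by (auto simp: bij_betw_def)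
  have surj: "\<exists>x\<in>simp K n. y = h n x" if "y \<in> simp L n" for n y
    using bij[of n] that by (auto simp: bij_betw_def)
  have act: "sact K m n \<theta> x \<in> simp K m" if "\<theta> \<in> Delta m n" "x \<in> simp K n" for m n \<theta> x
    using K that by (auto simp: is_sset_def)
  have id: "restrict (\<lambda>i. i) {..n} \<in> Delta n n" for n
    by (auto simp: Delta_def mono_on_def)
  have comp: "compose {..l} \<theta> \<psi> \<in> Delta l n" if "\<psi> \<in> Delta l m" "\<theta> \<in> Delta m n" for l m n \<psi> \<theta>
    using that by (auto simp: Delta_def mono_on_def compose_def PiE_def Pi_def)
  show ?thesis
    unfolding is_sset_def
  proof (intro conjI allI ballI)
    fix m n \<theta> y assume "\<theta> \<in> Delta m n" "y \<in> simp L n"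
    then show "sact L m n \<theta> y \<in> simp L m"
      using surj h nat act by metis
  next
    fix n y assume "y \<in> simp L n"
    then obtain x where x: "x \<in> simp K n" "y = h n x" using surj by blast
    then show "sact L n n (restrict (\<lambda>i. i) {..n}) y = y"
      using nat[OF id x(1)] K by (simp add: is_sset_def)
  next
    fix l m n \<psi> \<theta> y assume t: "\<psi> \<in> Delta l m" "\<theta> \<in> Delta m n" and "y \<in> simp L n"
    then obtain x where x: "x \<in> simp K n" "y = h n x" using surj by blast
    have "sact K l m \<psi> (sact K m n \<theta> x) = sact K l n (compose {..l} \<theta> \<psi>) x"
      using K t x by (simp add: is_sset_def)
    then show "sact L l m \<psi> (sact L m n \<theta> y) = sact L l n (compose {..l} \<theta> \<psi>) y"
      using nat[OF t(2) x(1)] nat[OF t(1) act[OF t(2) x(1)]] nat[OF comp[OF t] x(1)] x(2) by simp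
  qed
qed

text \<open>The degreewise inverse of \<open>h\<close> is again simplicial, so \<open>h\<close>
  realizes to a homeomorphism. Below this replaces the target of an SM7 corner map by an isomorphic
  mapping space.\<close>

theorem sset_weq_iso:
  assumes f: "sset_weq A K f" and bij: "\<And>n. bij_betw (h n) (simp K n) (simp L n)"
    and nat: "\<And>m n \<theta> x. \<theta> \<in> Delta m n \<Longrightarrow> x \<in> simp K n \<Longrightarrow>
      h m (sact K m n \<theta> x) = sact L m n \<theta> (h n x)"
    and f': "\<And>n x. x \<in> simp A n \<Longrightarrow> f' n x = h n (f n x)"
  shows "sset_weq A L f'"
proof -
  have A: "is_sset A" and K: "is_sset K" and fm: "is_sset_map A K f"
    and pi0: "bij_on_pi 0 (realization A) undefined (realization K) undefined (realization_map K f)"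
    and pin: "\<And>n x. n \<ge> 1 \<Longrightarrow> x \<in> simp A 0 \<Longrightarrow> bij_on_pi n (realization A) (vertex_point A x)
      (realization K) (vertex_point K (f 0 x)) (realization_map K f)"
    using f by (auto simp: sset_weq_def)
  have L: "is_sset L" using is_sset_bij[OF K bij nat] .
  have act: "sact K m n \<theta> x \<in> simp K m" if "\<theta> \<in> Delta m n" "x \<in> simp K n" for m n \<theta> x
    using K that by (auto simp: is_sset_def)
  define g where "g n = the_inv_into (simp K n) (h n)" for n
  have hK: "h n x \<in> simp L n" "g n (h n x) = x" if "x \<in> simp K n" for n x
    using bij[of n] that by (auto simp: bij_betw_def g_def the_inv_into_f_f)
  have gL: "g n y \<in> simp K n" "h n (g n y) = y" if "y \<in> simp L n" for n y
    using bij[of n] that the_inv_into_into[of "h n" "simp K n" y] f_the_inv_into_f[of "h n" "simp K n" y]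
    by (auto simp: bij_betw_def g_def)
  have hm: "is_sset_map K L h" using hK nat by (auto simp: is_sset_map_def)
  have gm: "is_sset_map L K g"
    unfolding is_sset_map_def
  proof (intro conjI allI ballI)
    fix m n \<theta> y assume t: "\<theta> \<in> Delta m n" and y: "y \<in> simp L n"
    show "g m (sact L m n \<theta> y) = sact K m n \<theta> (g n y)"
      using nat[OF t gL(1)[OF y]] gL[OF y] hK(2)[OF act[OF t gL(1)[OF y]]] by simp
  qed (use gL in auto)
  have fs: "\<And>n x. x \<in> simp A n \<Longrightarrow> f n x \<in> simp K n"
    "\<And>m n \<theta> x. \<theta> \<in> Delta m n \<Longrightarrow> x \<in> simp A n \<Longrightarrow> f m (sact A m n \<theta> x) = sact K m n \<theta> (f n x)"
    using fm by (auto simp: is_sset_map_def)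
  have actA: "sact A m n \<theta> x \<in> simp A m" if "\<theta> \<in> Delta m n" "x \<in> simp A n" for m n \<theta> x
    using A that by (auto simp: is_sset_def)
  have f'm: "is_sset_map A L f'"
    unfolding is_sset_map_def using f' fs nat actA hK by simp
  have id: "is_sset_map K K (\<lambda>n x. g n (h n x))" "is_sset_map L L (\<lambda>n y. h n (g n y))"
    using hm gm by (auto simp: is_sset_map_def)
  have "homeomorphic_maps (realization K) (realization L) (realization_map L h) (realization_map K g)"
    unfolding homeomorphic_maps_def
  proof (intro conjI ballI)
    fix c assume c: "c \<in> topspace (realization K)"
    show "realization_map K g (realization_map L h c) = c"
      using realization_map_cmp[OF hm gm id(1) _ c] realization_map_id[OF id(1) _ c] hK by simp
  next
    fix c assume c: "c \<in> topspace (realization L)"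
    show "realization_map L h (realization_map K g c) = c"
      using realization_map_cmp[OF gm hm id(2) _ c] realization_map_id[OF id(2) _ c] gL by simp
  qed (intro continuous_realization_map hm gm)+
  note transport = bij_on_pi_homeomorphism[OF _ continuous_realization_map[OF fm] this _
      realization_map_cmp[OF fm hm f'm f']]
  have v: "realization_map L h (vertex_point K y) = vertex_point L (h 0 y)" for y
    by (simp add: vertex_point_def realization_map_gclass[OF hm])
  have "bij_on_pi n (realization A) (vertex_point A x) (realization L) (vertex_point L (f' 0 x))
      (realization_map L f')" if "n \<ge> 1" "x \<in> simp A 0" for n x
    using vertex_point_in_realization[OF fs(1)[OF that(2)]]
    by (intro transport[OF pin[OF that]]) (simp_all add: v f' that)
  moreover have "bij_on_pi 0 (realization A) undefined (realization L) undefined (realization_map L f')"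
    by (intro transport[OF pi0]) simp_all
  ultimately show ?thesis
    using A L f'm by (simp add: sset_weq_def)
qed


section \<open>Mapping spaces of pointed simplicial presheaves\<close>

lemma motivic_model_simps:
  "Ob (motivic_model C cov J) = Ob (psp_cat C)" "Ar (motivic_model C cov J) = Ar (psp_cat C)"
  "src (motivic_model C cov J) = src (psp_cat C)" "tgt (motivic_model C cov J) = tgt (psp_cat C)"
  "idn (motivic_model C cov J) = idn (psp_cat C)" "cmp (motivic_model C cov J) = cmp (psp_cat C)"
  by (simp_all add: motivic_model_def Let_def cat.defs)

definition point_psp :: "'u \<Rightarrow> ('o, 'm, 'u) psp" where
  "point_psp c = \<lparr>sect = (\<lambda>U. \<lparr>simp = (\<lambda>n. {c}), sact = (\<lambda>m n \<theta> x. c)\<rparr>), rstr = (\<lambda>f n x. c), bpt = (\<lambda>U. c)\<rparr>"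

definition constant_map :: "('o, 'm, 'z) cat_scheme \<Rightarrow> ('o, 'm, 'u) psp \<Rightarrow> 'v \<Rightarrow> 'o \<Rightarrow> nat \<Rightarrow> 'u \<Rightarrow> 'v" where
  "constant_map C A c = restrict (\<lambda>U n. restrict (\<lambda>x. c) (simp (sect A U) n)) (Ob C)"

lemma is_psp_point: "is_psp C (point_psp c)"
  by (simp add: point_psp_def is_psp_def is_spsh_def is_sset_def is_sset_map_def)

lemma is_psp_rules:
  assumes "is_psp C A"
  shows psp_act: "U \<in> Ob C \<Longrightarrow> \<theta> \<in> Delta m n \<Longrightarrow> x \<in> simp (sect A U) n \<Longrightarrow>
      sact (sect A U) m n \<theta> x \<in> simp (sect A U) m"
    and psp_rstr: "f \<in> Ar C \<Longrightarrow> x \<in> simp (sect A (tgt C f)) n \<Longrightarrow> rstr A f n x \<in> simp (sect A (src C f)) n"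
    and psp_bpt: "U \<in> Ob C \<Longrightarrow> bpt A U \<in> simp (sect A U) 0"
  using assms by (auto simp: is_psp_def is_spsh_def is_sset_def is_sset_map_def)

lemma psp_bptn:
  assumes "is_psp C A" "U \<in> Ob C" shows "bptn A U n \<in> simp (sect A U) n"
proof -
  have "restrict (\<lambda>_. 0) {..n} \<in> Delta n 0" by (simp add: Delta_def mono_on_def)
  then show ?thesis unfolding bptn_def using psp_act[OF assms(1,2)] psp_bpt[OF assms] by blast
qed

lemma psp_map_point:
  assumes A: "is_psp C A" and ends: "\<And>f. f \<in> Ar C \<Longrightarrow> src C f \<in> Ob C \<and> tgt C f \<in> Ob C"
  shows "psp_map C A (point_psp c) (constant_map C A c)"
  using is_psp_rules[OF A] ends
  by (simp add: psp_map_def spsh_map_def is_sset_map_def constant_map_def point_psp_def)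

text \<open>A terminal object is known only up to isomorphism. Its identity equals the composite
  through \<open>point_psp\<close>, so every section is the image of the one point.\<close>

lemma terminal_psp_singleton:
  fixes C :: "('o, 'm, 'z) cat_scheme" and T :: "('o, 'm, 'u) psp"
  assumes cat: "is_category (psp_cat C :: (('o, 'm, 'u) psp, ('o, 'm, 'u) psp_ar) cat)"
    and T: "is_terminal (psp_cat C) T"
    and ends: "\<And>f. f \<in> Ar C \<Longrightarrow> src C f \<in> Ob C \<and> tgt C f \<in> Ob C"
  obtains \<tau> where "\<And>U n. U \<in> Ob C \<Longrightarrow> simp (sect T U) n = {\<tau> U n}"
proof -
  let ?K = "psp_cat C :: (('o, 'm, 'u) psp, ('o, 'm, 'u) psp_ar) cat"
  let ?pt = "point_psp undefined :: ('o, 'm, 'u) psp"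
  have TOb: "T \<in> Ob ?K" and hom: "\<And>A. A \<in> Ob ?K \<Longrightarrow> \<exists>!f. in_hom ?K A T f"
    using T by (auto simp: is_terminal_def)
  have Tp: "is_psp C T" using TOb by (simp add: psp_cat_def)
  let ?k = "(T, ?pt, constant_map C T undefined)"
  have k: "in_hom ?K T ?pt ?k"
    using Tp psp_map_point[OF Tp ends] is_psp_point by (simp add: psp_cat_def in_hom_def)
  have "?pt \<in> Ob ?K" using is_psp_point by (simp add: psp_cat_def)
  then obtain g where g: "in_hom ?K ?pt T g" using hom by blast
  obtain \<gamma> where \<gamma>: "g = (?pt, T, \<gamma>)" "psp_map C ?pt T \<gamma>"
    using g by (cases g) (auto simp: psp_cat_def in_hom_def)
  have "in_hom ?K T T (idn ?K T)" "in_hom ?K T T (cmp ?K g ?k)"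
    using cat TOb g k by (auto simp: is_category_def in_hom_def)
  then have "idn ?K T = cmp ?K g ?k" using hom[OF TOb] by blast
  then have id: "restrict (\<lambda>U n. restrict (\<lambda>x. x) (simp (sect T U) n)) (Ob C) =
      spsh_comp C T \<gamma> (constant_map C T undefined)"
    by (simp add: psp_cat_def \<gamma>(1))
  have "simp (sect T U) n = {\<gamma> U n undefined}" if U: "U \<in> Ob C" for U n
  proof -
    have "x = \<gamma> U n undefined" if "x \<in> simp (sect T U) n" for x
      using fun_cong[OF fun_cong[OF fun_cong[OF id, of U], of n], of x] U that
      by (simp add: spsh_comp_def constant_map_def)
    moreover have "\<gamma> U n undefined \<in> simp (sect T U) n"
      using \<gamma>(2) U by (auto simp: psp_map_def spsh_map_def point_psp_def)
    ultimately show ?thesis by blast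
  qed
  then show ?thesis by (rule that[of "\<lambda>U n. \<gamma> U n undefined"])
qed

lemma simp_pMap:
  "\<phi> \<in> simp (pMap C A B) n \<longleftrightarrow> spsh_map C (prism A n) B \<phi> \<and>
     (\<forall>U\<in>Ob C. \<forall>k. \<forall>\<sigma>\<in>Delta k n. \<phi> U k (bptn A U k, \<sigma>) = bptn B U k)"
  by (simp add: pMap_def Map_def)

lemma spsh_map_apply:
  assumes "spsh_map C A B \<phi>" "U \<in> Ob C" "x \<in> simp (sect A U) n"
  shows "\<phi> U n x \<in> simp (sect B U) n"
  using assms unfolding spsh_map_def by blast

lemma pMap_apply:
  assumes "\<phi> \<in> simp (pMap C A B) n" "U \<in> Ob C" "x \<in> simp (sect A U) k" "\<sigma> \<in> Delta k n"
  shows "\<phi> U k (x, \<sigma>) \<in> simp (sect B U) k"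
  using spsh_map_apply[of C "prism A n" B \<phi> U "(x, \<sigma>)" k] assms by (simp add: simp_pMap prism_def)

lemma compose_Delta:
  "\<psi> \<in> Delta l m \<Longrightarrow> \<theta> \<in> Delta m n \<Longrightarrow> compose {..l} \<theta> \<psi> \<in> Delta l n"
  by (auto simp: Delta_def mono_on_def compose_def PiE_def Pi_def)

text \<open>Into one-element sets of sections there is one family of functions; all compatibilities
  hold automatically.\<close>

lemma simp_pMap_singleton:
  assumes A: "is_psp C A" and T: "is_psp C T"
    and ends: "\<And>f. f \<in> Ar C \<Longrightarrow> src C f \<in> Ob C \<and> tgt C f \<in> Ob C"
    and \<tau>: "\<And>U n. U \<in> Ob C \<Longrightarrow> simp (sect T U) n = {\<tau> U n}"
  obtains \<psi> where "simp (pMap C A T) n = {\<psi>}"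
proof -
  define \<psi> where "\<psi> = restrict (\<lambda>U k. restrict (\<lambda>p. \<tau> U k) (simp (sect A U) k \<times> Delta k n)) (Ob C)"
  have "spsh_map C (prism A n) T \<psi>"
    unfolding spsh_map_def
  proof (intro conjI ballI allI)
    fix U assume U: "U \<in> Ob C"
    have "sact (sect T U) l k \<theta> (\<tau> U k) = \<tau> U l" if "\<theta> \<in> Delta l k" for l k \<theta>
      using psp_act[OF T U that, of "\<tau> U k"] \<tau>[OF U] by simp
    then show "is_sset_map (sect (prism A n) U) (sect T U) (\<psi> U)"
      using U \<tau>[OF U] psp_act[OF A U]
      by (auto simp: is_sset_map_def prism_def \<psi>_def compose_Delta)
    show "\<psi> U k \<in> simp (sect (prism A n) U) k \<rightarrow>\<^sub>E simp (sect T U) k" for k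
      using U \<tau>[OF U] by (auto simp: prism_def \<psi>_def)
  next
    fix f k p assume f: "f \<in> Ar C" and "p \<in> simp (sect (prism A n) (tgt C f)) k"
    then obtain x \<sigma> where p: "p = (x, \<sigma>)" "x \<in> simp (sect A (tgt C f)) k" "\<sigma> \<in> Delta k n"
      by (auto simp: prism_def)
    note Ob = ends[OF f]
    have "rstr T f k (\<tau> (tgt C f) k) = \<tau> (src C f) k"
      using psp_rstr[OF T f, of "\<tau> (tgt C f) k" k] \<tau> Ob by simp
    then show "\<psi> (src C f) k (rstr (prism A n) f k p) = rstr T f k (\<psi> (tgt C f) k p)"
      using p psp_rstr[OF A f p(2)] Ob by (simp add: prism_def \<psi>_def)
  qed (simp add: \<psi>_def)
  moreover have "\<psi> U k (bptn A U k, \<sigma>) = bptn T U k" if "U \<in> Ob C" "\<sigma> \<in> Delta k n" for U k \<sigma>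
    using psp_bptn[OF A that(1), of k] psp_bptn[OF T that(1), of k] \<tau>[OF that(1)] that
    by (simp add: \<psi>_def)
  ultimately have "\<psi> \<in> simp (pMap C A T) n" by (simp add: simp_pMap)
  \<comment> \<open>Equality as functions also concerns arguments outside the domains, where both
    are \<open>undefined\<close> by normalization.\<close>
  moreover have "\<phi> = \<psi>" if \<phi>: "\<phi> \<in> simp (pMap C A T) n" for \<phi>
  proof (rule ext, rule ext, rule ext)
    fix U k p
    have ext: "\<phi> \<in> extensional (Ob C)"
      "U \<in> Ob C \<Longrightarrow> \<phi> U k \<in> extensional (simp (sect A U) k \<times> Delta k n)"
      using \<phi> by (auto simp: simp_pMap spsh_map_def prism_def PiE_def)
    show "\<phi> U k p = \<psi> U k p"
    proof (cases "U \<in> Ob C")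
      case True
      then show ?thesis
        using pMap_apply[OF \<phi> True] \<tau>[OF True] ext(2)
        by (cases p) (auto simp: \<psi>_def extensional_def)
    qed (use ext(1) in \<open>simp add: \<psi>_def extensional_def\<close>)
  qed
  ultimately have "simp (pMap C A T) n = {\<psi>}" by blast
  then show ?thesis by (rule that)
qed

text \<open>SM7 for \<open>i : A \<rightarrow> B\<close> and \<open>p : Z \<rightarrow> *\<close>: the pull-back of mapping spaces is \<open>Map(A, Z)\<close>.\<close>

lemma trivial_cof_local_equivalence:
  fixes M :: "(('o, 'm, 'u) psp, ('o, 'm, 'u) psp_ar) model" and C :: "('o, 'm, 'z) cat_scheme"
  assumes M: "M = motivic_model C cov J" and SM: "simplicial_model_category C M"
    and ends: "\<And>f. f \<in> Ar C \<Longrightarrow> src C f \<in> Ob C \<and> tgt C f \<in> Ob C"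
    and i: "i \<in> cof M" "i \<in> weq M"
  shows "local_equivalence C M S i"
proof -
  have Ms: "Ob M = Ob (psp_cat C)" "Ar M = Ar (psp_cat C)" "src M = src (psp_cat C)"
    "tgt M = tgt (psp_cat C)" "idn M = idn (psp_cat C)" "cmp M = cmp (psp_cat C)"
    unfolding M by (rule motivic_model_simps)+
  have model: "model_category M" using SM by (simp add: simplicial_model_category_def)
  then have "i \<in> Ar M" and catM: "is_category M" using i by (auto simp: model_category_def)
  then obtain A B \<iota> where iA: "i = (A, B, \<iota>)" and A: "is_psp C A" and B: "is_psp C B" and \<iota>: "psp_map C A B \<iota>"
    by (cases i) (auto simp: Ms psp_cat_def)
  have cat: "is_category (psp_cat C :: (('o, 'm, 'u) psp, ('o, 'm, 'u) psp_ar) cat)"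
    using catM by (simp add: is_category_def in_hom_def Ms)
  have "sset_weq (pMap C B Z) (pMap C A Z) (Map_pre C A \<iota>)" if Z: "fibrant M Z" for Z
  proof -
    obtain T p where T: "is_terminal M T" and p: "in_hom M Z T p" "p \<in> fib M"
      using Z unfolding fibrant_def by blast
    obtain \<pi> where \<pi>: "p = (Z, T, \<pi>)" "psp_map C Z T \<pi>" and Tp: "is_psp C T"
      using p(1) by (cases p) (auto simp: in_hom_def Ms psp_cat_def)
    have "is_terminal (psp_cat C) T" using T by (simp add: is_terminal_def in_hom_def Ms)
    then obtain \<tau> where \<tau>: "\<And>U n. U \<in> Ob C \<Longrightarrow> simp (sect T U) n = {\<tau> U n}"
      using terminal_psp_singleton[OF cat _ ends] by metis
    let ?P = "pMap_pullback C i p"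
    have tgt: "tgt M i = B" and src: "src M p = Z" by (simp_all add: Ms psp_cat_def iA \<pi>)
    have weq: "sset_weq (pMap C B Z) ?P (pMap_corner C i p)"
      using SM i p(2) tgt src unfolding simplicial_model_category_def by metis
    \<comment> \<open>Both composites land in the one-element sections of \<open>T\<close>, so every
      pair satisfies the matching condition of the pull-back.\<close>
    have eq: "Map_post C A \<pi> n \<phi> = Map_pre C A \<iota> n \<psi>"
      if \<phi>: "\<phi> \<in> simp (pMap C A Z) n" and \<psi>: "\<psi> \<in> simp (pMap C B T) n" for n \<phi> \<psi>
    proof -
      have "\<pi> U k (\<phi> U k (x, \<sigma>)) = \<psi> U k (\<iota> U k x, \<sigma>)"
        if U: "U \<in> Ob C" and x: "x \<in> simp (sect A U) k" "\<sigma> \<in> Delta k n" for U k x \<sigma>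
      proof -
        have "\<pi> U k (\<phi> U k (x, \<sigma>)) \<in> simp (sect T U) k"
          using \<pi>(2) pMap_apply[OF \<phi> U x] U by (auto simp: psp_map_def intro: spsh_map_apply)
        moreover have "\<iota> U k x \<in> simp (sect B U) k"
          using \<iota> x U by (auto simp: psp_map_def intro: spsh_map_apply)
        then have "\<psi> U k (\<iota> U k x, \<sigma>) \<in> simp (sect T U) k" using pMap_apply[OF \<psi> U _ x(2)] by blast
        ultimately show ?thesis using \<tau>[OF U] by simp
      qed
      then show ?thesis by (auto simp: Map_post_def Map_pre_def fun_eq_iff restrict_def)
    qed
    show ?thesis
    \<comment> \<open>The second factor of the pull-back has a single simplex in each degree, so
      \<open>fst\<close> is an isomorphism; it turns the corner map into
      \<open>Map_pre\<close>.\<close>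
    proof (rule sset_weq_iso[OF weq, of "\<lambda>n. fst"])
      fix n
      obtain \<psi> where \<psi>: "simp (pMap C B T) n = {\<psi>}"
        using simp_pMap_singleton[OF B Tp ends \<tau>] by metis
      then have "simp ?P n = simp (pMap C A Z) n \<times> {\<psi>}"
        using eq by (auto simp: pMap_pullback_def iA \<pi>(1))
      then show "bij_betw fst (simp ?P n) (simp (pMap C A Z) n)"
        by (auto simp: bij_betw_def inj_on_def)
    qed (auto simp: pMap_pullback_def pMap_corner_def iA \<pi>(1))
  qed
  then show ?thesis
    using \<open>i \<in> Ar M\<close> by (auto simp: local_equivalence_def local_object_def iA)
qed


section \<open>Left Bousfield localizations\<close>

lemma (in model_enlargement) ho_map_id_zclass:
  assumes "zpath M (weq M) a b u"
  shows "far (ho_map N id_func) (zclass M (weq M) a b u) = zclass N (weq N) a b u"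
    and "zpath N (weq N) a b u"
proof -
  have W: "far id_func ` (weq M \<inter> Ar M) \<subseteq> weq N" using weq_subset by auto
  show "far (ho_map N id_func) (zclass M (weq M) a b u) = zclass N (weq N) a b u"
    and "zpath N (weq N) a b u"
    using ho_map_zclass[OF id_functor(1) W assms] zpath_map[OF id_functor(1) W assms]
    by (simp_all add: map_zstep_ident)
qed

text \<open>Each functor keeps the representing zigzag and only coarsens the equivalence. This gives
  the commutativity of the tower under the homotopy category of \<open>M\<close>.\<close>

lemma ho_map_id_comp:
  assumes "model_enlargement M N" "model_enlargement N P"
  shows "functor_eq (Ho M) (comp_func (ho_map P id_func) (ho_map N id_func)) (ho_map P id_func)"
proof -
  interpret MN: model_enlargement M N by fact
  interpret NP: model_enlargement N P by fact
  interpret MP: model_enlargement M P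
    using MN.M NP.N MN.trivial_cof NP.weq_subset by unfold_locales (auto simp: MN.same NP.same)
  show ?thesis
    unfolding functor_eq_def
  proof (intro conjI ballI)
    fix f assume "f \<in> Ar (Ho M)"
    then obtain a b u where "f = zclass M (weq M) a b u" "zpath M (weq M) a b u"
      unfolding Ho_Ar by blast
    then show "far (comp_func (ho_map P id_func) (ho_map N id_func)) f = far (ho_map P id_func) f"
      by (simp add: MN.ho_map_id_zclass NP.ho_map_id_zclass MP.ho_map_id_zclass)
  qed simp
qed

lemma functor_eq_id_comp: "functor_eq C (comp_func id_func id_func) id_func"
  by (simp add: functor_eq_def)

lemma left_bousfield_simps:
  "Ob (left_bousfield C M S) = Ob M" "Ar (left_bousfield C M S) = Ar M"
  "src (left_bousfield C M S) = src M" "tgt (left_bousfield C M S) = tgt M"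
  "idn (left_bousfield C M S) = idn M" "cmp (left_bousfield C M S) = cmp M"
  "cof (left_bousfield C M S) = cof M" "weq (left_bousfield C M S) = {f. local_equivalence C M S f}"
  by (simp_all add: left_bousfield_def)

text \<open>More maps in \<open>S\<close> leave fewer local objects, hence fewer conditions on a
  local equivalence.\<close>

lemma local_equivalence_mono:
  assumes "S \<subseteq> S'" "local_equivalence C M S f" shows "local_equivalence C M S' f"
proof -
  have "local_object C M S Z" if "local_object C M S' Z" for Z
    using that assms(1) unfolding local_object_def by blast
  then show ?thesis using assms(2) unfolding local_equivalence_def by auto
qed

lemma motivic_enlargement:
  assumes M: "M = motivic_model C cov J" and SM: "simplicial_model_category C M"
    and loc: "model_category (left_bousfield C M S)"
    and ends: "\<And>f. f \<in> Ar C \<Longrightarrow> src C f \<in> Ob C \<and> tgt C f \<in> Ob C"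
  shows "model_enlargement M (left_bousfield C M S)"
proof
  show "cof M \<inter> weq M \<subseteq> weq (left_bousfield C M S)"
    using trivial_cof_local_equivalence[OF M SM ends] by (auto simp: left_bousfield_simps)
qed (use SM loc in \<open>simp_all add: left_bousfield_simps simplicial_model_category_def\<close>)

lemma left_bousfield_enlargement:
  assumes "model_category (left_bousfield C M S)" "model_category (left_bousfield C M S')" "S \<subseteq> S'"
  shows "model_enlargement (left_bousfield C M S) (left_bousfield C M S')"
  using assms local_equivalence_mono[OF assms(3)]
  by unfold_locales (auto simp: left_bousfield_simps)

lemma Sm_ends: "f \<in> Ar (Sm X) \<Longrightarrow> src (Sm X) f \<in> Ob (Sm X) \<and> tgt (Sm X) f \<in> Ob (Sm X)"
  by (auto simp: Sm_def Let_def)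

text \<open>Codimension at least \<open>n + 2\<close> implies codimension at least
  \<open>n + 1\<close>. So passing from level \<open>n + 1\<close> to level \<open>n\<close> inverts
  more maps.\<close>

lemma B_set_decreasing: "B_set X e (n + 1) \<subseteq> B_set X e n"
proof -
  have "enat (n + 1) \<le> c" if "enat (n + 1 + 1) \<le> c" for c
    using that by (rule order_trans[rotated]) simp
  then show ?thesis unfolding B_set_def by blast
qed

lemma WB_set_decreasing: "WB_set X e (n + 1) \<subseteq> WB_set X e n"
proof -
  have "enat (n + 1) \<le> c" if "enat (n + 1 + 1) \<le> c" for c
    using that by (rule order_trans[rotated]) simp
  then show ?thesis unfolding WB_set_def by blast
qed

text \<open>The existence of the model structures, with SM7 for the motivic one, is a hypothesis;
  the fibrant replacements are arbitrary functorial ones. Each \<open>functor_eq\<close> expresses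
  that a tower commutes, under the motivic structure or under its homotopy category.\<close>

theorem theorem2p14:
  fixes X :: "'a scheme" and e :: "'a sm_ar option \<Rightarrow> 'u"
    and b wb :: "nat \<Rightarrow> (('a sm_ob, 'a sm_ar, 'u) psp, ('a sm_ob, 'a sm_ar, 'u) psp_ar,
                  ('a sm_ob, 'a sm_ar, 'u) psp, ('a sm_ob, 'a sm_ar, 'u) psp_ar) func"
    and \<eta> w\<eta> :: "nat \<Rightarrow> ('a sm_ob, 'a sm_ar, 'u) psp \<Rightarrow> ('a sm_ob, 'a sm_ar, 'u) psp_ar"
  assumes "infinite (UNIV :: 'a set)"
    and "noetherian_scheme X" and "separated_scheme X" and "space_krull_dim (stop X) \<noteq> \<infinity>"
    and "inj e"
    and "simplicial_model_category (Sm X) (motivic X ::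
           (('a sm_ob, 'a sm_ar, 'u) psp, ('a sm_ob, 'a sm_ar, 'u) psp_ar) model)"
    and "\<And>n. model_category (BM X e n)" and "\<And>n. fibrant_replacement (BM X e n) (b n) (\<eta> n)"
    and "\<And>n. model_category (WBM X e n)" and "\<And>n. fibrant_replacement (WBM X e n) (wb n) (w\<eta> n)"
  shows
    "(\<forall>n. left_quillen (motivic X) (BM X e n) id_func \<and>
          left_quillen (BM X e (n + 1)) (BM X e n) id_func \<and>
          functor_eq (motivic X) (comp_func id_func id_func) id_func \<and>
          derived_id_adjunction (motivic X) (BM X e n) (b n) (\<eta> n) \<and>
          derived_id_adjunction (BM X e (n + 1)) (BM X e n) (b n) (\<eta> n) \<and>
          functor_eq (Ho (motivic X))
            (comp_func (ho_map (BM X e n) id_func) (ho_map (BM X e (n + 1)) id_func))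
            (ho_map (BM X e n) id_func)) \<and>
     (\<forall>n. left_quillen (motivic X) (WBM X e n) id_func \<and>
          left_quillen (WBM X e (n + 1)) (WBM X e n) id_func \<and>
          functor_eq (motivic X) (comp_func id_func id_func) id_func \<and>
          derived_id_adjunction (motivic X) (WBM X e n) (wb n) (w\<eta> n) \<and>
          derived_id_adjunction (WBM X e (n + 1)) (WBM X e n) (wb n) (w\<eta> n) \<and>
          functor_eq (Ho (motivic X))
            (comp_func (ho_map (WBM X e n) id_func) (ho_map (WBM X e (n + 1)) id_func))
            (ho_map (WBM X e n) id_func))"
proof -
  \<comment> \<open>All conclusions come from four enlargements: from the motivic structure to each
    localization, and from level \<open>n + 1\<close> to level \<open>n\<close>.\<close>
  have B: "model_enlargement (motivic X) (BM X e n)" for n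
    using motivic_enlargement[OF motivic_def assms(6) assms(7)[of n, unfolded BM_def] Sm_ends]
    unfolding BM_def .
  have BB: "model_enlargement (BM X e (n + 1)) (BM X e n)" for n
    using left_bousfield_enlargement[OF assms(7)[of "n + 1", unfolded BM_def]
        assms(7)[of n, unfolded BM_def] B_set_decreasing]
    unfolding BM_def .
  have W: "model_enlargement (motivic X) (WBM X e n)" for n
    using motivic_enlargement[OF motivic_def assms(6) assms(9)[of n, unfolded WBM_def] Sm_ends]
    unfolding WBM_def .
  have WW: "model_enlargement (WBM X e (n + 1)) (WBM X e n)" for n
    using left_bousfield_enlargement[OF assms(9)[of "n + 1", unfolded WBM_def]
        assms(9)[of n, unfolded WBM_def] WB_set_decreasing]
    unfolding WBM_def .
  note lq = model_enlargement.left_quillen_id and adj = model_enlargement.derived_id_adjunction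
  show ?thesis
    by (intro conjI allI functor_eq_id_comp lq[OF B] lq[OF BB] lq[OF W] lq[OF WW]
      adj[OF B assms(8)] adj[OF BB assms(8)] adj[OF W assms(10)] adj[OF WW assms(10)]
      ho_map_id_comp[OF B BB] ho_map_id_comp[OF W WW])
qed

end
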